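(* Let $-\infty\le a<b\le\infty$, $m,n_1,n_2\in\mathbb{N}$, $n=n_1+n_2$, $f_j\in L^2((a,b);dx)^{m\times n_j}$, $g_j\in L^2((a,b);dx)^{n_j\times m}$, $j=1,2$. Let $K$ be the Hilbert–Schmidt operator in $L^2((a,b);dx)^m$ with integral kernel $K(x,x')=f_1(x)g_1(x')$ for $a<x'<x<b$ and $K(x,x')=f_2(x)g_2(x')$ for $a<x<x'<b$. Let $\alpha\in\mathbb{C}$, and let $H_a,H_b,Q,R,S,T,\hat f_1,\hat f_2$ be as in the context. Then $$\det\nolimits_2(I-\alpha H_a)=\det\nolimits_2(I-\alpha H_b)=1.$$ Moreover, if $U(\cdot,\alpha)$ is the $n\times n$ matrix function $$U(x,\alpha)=\begin{pmatrix} I_{n_1}-\alpha\int_x^b dx'\,g_1(x')\hat f_1(x',\alpha) & \alpha\int_a^x dx'\,g_1(x')\hat f_2(x',\alpha)\\ \alpha\int_x^b dx'\,g_2(x')\hat f_1(x',\alpha) & I_{n_2}-\alpha\int_a^x dx'\,g_2(x')\hat f_2(x',\alpha)\end{pmatrix},$$ then $$\begin{aligned}\det\nolimits_2(I-\alpha K)&=\det\nolimits_{\mathbb{C}^{n_1}}\big(I_{n_1}-\alpha T(I-\alpha H_b)^{-1}S\big)\exp(\alpha\operatorname{tr}(ST))\\&=\det\nolimits_{\mathbb{C}^{n_1}}\Big(I_{n_1}-\alpha\int_a^b dx\,g_1(x)\hat f_1(x,\alpha)\Big)\exp\Big(\alpha\int_a^b dx\,\operatorname{tr}_{\mathbb{C}^m}(f_1(x)g_1(x))\Big)\\&=\det\nolimits_{\mathbb{C}^n}(U(a,\alpha))\exp\Big(\alpha\int_a^b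 dx\,\operatorname{tr}_{\mathbb{C}^m}(f_1(x)g_1(x))\Big)\\&=\det\nolimits_{\mathbb{C}^{n_2}}\big(I_{n_2}-\alpha R(I-\alpha H_a)^{-1}Q\big)\exp(\alpha\operatorname{tr}(QR))\\&=\det\nolimits_{\mathbb{C}^{n_2}}\Big(I_{n_2}-\alpha\int_a^b dx\,g_2(x)\hat f_2(x,\alpha)\Big)\exp\Big(\alpha\int_a^b dx\,\operatorname{tr}_{\mathbb{C}^m}(f_2(x)g_2(x))\Big)\\&=\det\nolimits_{\mathbb{C}^n}(U(b,\alpha))\exp\Big(\alpha\int_a^b dx\,\operatorname{tr}_{\mathbb{C}^m}(f_2(x)g_2(x))\Big).\end{aligned}$$
   Context: $I$ is the identity operator in $L^2((a,b);dx)^m$, $I_k$ the $k\times k$ identity matrix; $\det_2(I-A)=\det((I-A)\exp(A))$ is the $2$-modified Fredholm determinant of a Hilbert–Schmidt operator $A$; $\operatorname{tr}$ is the operator trace. With $H(x,x')=f_1(x)g_1(x')-f_2(x)g_2(x')$, the Volterra operators $H_a,H_b$ in $L^2((a,b);dx)^m$ are $$(H_af)(x)=\int_a^x dx'\,H(x,x')f(x'),\qquad (H_bf)(x)=-\int_x^b dx'\,H(x,x')f(x').$$ ($I-\alpha H_a$ and $I-\alpha H_b$ are boundedly invertible for all $\alpha\in\mathbb{C}$.) The linear maps $Q:\mathbb{C}^{n_2}\to L^2((a,b);dx)^m$, $R:L^2((a,b);dx)^m\to\mathbb{C}^{n_2}$, $S:\mathbb{C}^{n_1}\to L^2((a,b);dx)^m$,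 $T:L^2((a,b);dx)^m\to\mathbb{C}^{n_1}$ are $$(Q\underline u)(x)=f_2(x)\underline u,\quad Rf=\int_a^b dx'\,g_2(x')f(x'),\quad (S\underline v)(x)=f_1(x)\underline v,\quad Tf=\int_a^b dx'\,g_1(x')f(x').$$ One has $K=H_a+QR=H_b+ST$. The functions $\hat f_j(\cdot,\alpha)\in L^2((a,b);dx)^{m\times n_j}$ are the solutions of the Volterra integral equations $$\hat f_1(x,\alpha)=f_1(x)-\alpha\int_x^b dx'\,H(x,x')\hat f_1(x',\alpha),\qquad \hat f_2(x,\alpha)=f_2(x)+\alpha\int_a^x dx'\,H(x,x')\hat f_2(x',\alpha).$$ $U(a,\alpha)$ and $U(b,\alpha)$ denote the values of the formula for $U$ at $x=a$ and $x=b$ (limits $x\downarrow a$, $x\uparrow b$). *)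

theory Defs
  imports "Jordan_Normal_Form.Determinant" "HOL-Analysis.Analysis"
begin

hide_const (open) Determinant.det Matrix.mat Matrix.vec Matrix.row
no_notation Matrix.vec_index (infixl "$" 100)

text \<open>
  The space \<open>L\<^sup>2(M)\<close> is handled through representatives: its elements are square-integrable
  functions, equality in \<open>L\<^sup>2(M)\<close> is equality almost everywhere, and an operator is a map on
  functions of which only the values on \<open>L2 M\<close>, modulo null sets, matter.
\<close>

definition L2 :: "real measure \<Rightarrow> (real \<Rightarrow> 'a::real_normed_vector) set" where
  "L2 M = {f \<in> borel_measurable M. integrable M (\<lambda>x. (norm (f x))\<^sup>2)}"

definition L2_norm :: "real measure \<Rightarrow> (real \<Rightarrow> 'a::real_normed_vector) \<Rightarrow> real" where
  "L2_norm M f = sqrt (LINT x|M. (norm (f x))\<^sup>2)"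

definition L2_inner :: "real measure \<Rightarrow> (real \<Rightarrow> complex^'m) \<Rightarrow> (real \<Rightarrow> complex^'m) \<Rightarrow> complex" where
  "L2_inner M f g = (LINT x|M. (\<Sum>i\<in>UNIV. f x $ i * cnj (g x $ i)))"

type_synonym 'm operator = "(real \<Rightarrow> complex^'m) \<Rightarrow> (real \<Rightarrow> complex^'m)"

definition bounded_operator :: "real measure \<Rightarrow> 'm::finite operator \<Rightarrow> bool" where
  "bounded_operator M A \<longleftrightarrow>
     (\<forall>f\<in>L2 M. A f \<in> L2 M) \<and>
     (\<forall>f\<in>L2 M. \<forall>g\<in>L2 M. AE x in M. A (\<lambda>y. f y + g y) x = A f x + A g x) \<and>
     (\<forall>c. \<forall>f\<in>L2 M. AE x in M. A (\<lambda>y. c *s f y) x = c *s A f x) \<and>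
     (\<exists>C. \<forall>f\<in>L2 M. L2_norm M (A f) \<le> C * L2_norm M f)"

text \<open>Indexing bases by \<open>nat\<close> presupposes that \<open>L\<^sup>2(M)\<close> is separable and infinite-dimensional,
  as is the case for Lebesgue measure on a nonempty open interval.\<close>

definition orthonormal_basis :: "real measure \<Rightarrow> (nat \<Rightarrow> real \<Rightarrow> complex^'m) \<Rightarrow> bool" where
  "orthonormal_basis M e \<longleftrightarrow>
     (\<forall>i. e i \<in> L2 M) \<and>
     (\<forall>i j. L2_inner M (e i) (e j) = (if i = j then 1 else 0)) \<and>
     (\<forall>f\<in>L2 M. (\<forall>i. L2_inner M f (e i) = 0) \<longrightarrow> (AE x in M. f x = 0))"

definition hilbert_schmidt :: "real measure \<Rightarrow> 'm::finite operator \<Rightarrow> bool" where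
  "hilbert_schmidt M A \<longleftrightarrow> bounded_operator M A \<and>
     (\<forall>e. orthonormal_basis M e \<longrightarrow> summable (\<lambda>i. (L2_norm M (A (e i)))\<^sup>2))"

text \<open>The inverse and the exponential are only determined up to null sets, hence the choice of
  a representative.\<close>

definition op_inverse :: "real measure \<Rightarrow> 'm::finite operator \<Rightarrow> 'm operator" where
  "op_inverse M A f = (SOME u. u \<in> L2 M \<and> (AE x in M. A u x = f x))"

definition op_exp :: "real measure \<Rightarrow> 'm::finite operator \<Rightarrow> 'm operator" where
  "op_exp M A f = (SOME u. u \<in> L2 M \<and>
     (\<lambda>N. L2_norm M (\<lambda>x. u x - (\<Sum>k<N. (1 / fact k) *s (A ^^ k) f x))) \<longlonglongrightarrow> 0)"

text \<open>Trace of a trace class operator, and Fredholm determinant of an operator \<open>C\<close> for which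
  \<open>C - I\<close> is of trace class. For such operators the sum of the diagonal matrix elements and the
  limit of the determinants of the finite sections exist and do not depend on the orthonormal
  basis.\<close>

definition op_trace :: "real measure \<Rightarrow> 'm::finite operator \<Rightarrow> complex" where
  "op_trace M A =
     (THE t. \<forall>e. orthonormal_basis M e \<longrightarrow> (\<lambda>i. L2_inner M (A (e i)) (e i)) sums t)"

definition fredholm_det :: "real measure \<Rightarrow> 'm::finite operator \<Rightarrow> complex" where
  "fredholm_det M C =
     (THE d. \<forall>e. orthonormal_basis M e \<longrightarrow>
        (\<lambda>N. Determinant.det (Matrix.mat N N (\<lambda>(i, j). L2_inner M (C (e j)) (e i)))) \<longlonglongrightarrow> d)"

definition op_I_minus :: "complex \<Rightarrow> 'm::finite operator \<Rightarrow> 'm operator" where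
  "op_I_minus \<alpha> A f = (\<lambda>x. f x - \<alpha> *s A f x)"

text \<open>\<open>det2_I_minus M A\<close> is \<open>det\<^sub>2(I - A)\<close>, for Hilbert--Schmidt \<open>A\<close>.\<close>

definition det2_I_minus :: "real measure \<Rightarrow> 'm::finite operator \<Rightarrow> complex" where
  "det2_I_minus M A =
     (if hilbert_schmidt M A then fredholm_det M (op_I_minus 1 A \<circ> op_exp M A) else undefined)"

definition block_matrix ::
  "'a^'n1^'n1 \<Rightarrow> 'a^'n2^'n1 \<Rightarrow> 'a^'n1^'n2 \<Rightarrow> 'a^'n2^'n2 \<Rightarrow> 'a^('n1+'n2)^('n1+'n2)" where
  "block_matrix A B C D = (\<chi> i j.
     case i of
       Inl p \<Rightarrow> (case j of Inl q \<Rightarrow> A $ p $ q | Inr q \<Rightarrow> B $ p $ q)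
     | Inr p \<Rightarrow> (case j of Inl q \<Rightarrow> C $ p $ q | Inr q \<Rightarrow> D $ p $ q))"

end

(* For an N x N section a of the matrix of a Hilbert-Schmidt operator A, put
   det2 N a = det (I - a) exp (tr a). By Hadamard's inequality this is at most exp (|a|^2 / 2), |a| being the
   Hilbert-Schmidt norm, so Cauchy's inequality for the entire function z -> det2 N (b + z (a - b)) makes
   det2 N Lipschitz on bounded sets, uniformly in N. The same argument for det (I + x) in terms of the trace
   and the Hilbert-Schmidt norm shows that the sections of (I - A) exp A have the same limiting determinant
   as det2 N a.

   A Volterra operator with kernel f1(x) g1(x') - f2(x) g2(x') is a Hilbert-Schmidt limit of finite rank
   operators whose kernels live on strictly ordered cells; these are nilpotent, so its determinant is 1.
   If K = A + Q R with R of finite rank and (I - A) V = Q, then I - K = (I - A) (I - V R), and Sylvester's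
   identity for the sections gives det2 (I - K) = det2 (I - A) det (I - R V) exp (tr Q R). With V = v and
   Q = 0 this also shows that I - A is injective. The solutions of the Volterra integral equations are the
   columns of V. The two forms of the result come from the same statement, read in both directions of the
   line. *)

theory Submission
  imports Defs "HOL-Complex_Analysis.Complex_Analysis" "Jordan_Normal_Form.Schur_Decomposition"
begin

text \<open>The import of further theories on matrices makes these names visible again.\<close>

hide_const (open) Determinant.det Matrix.mat Matrix.vec Matrix.row
no_notation Matrix.vec_index (infixl "$" 100)

text \<open>Two obstacles shape the estimates. The traces of the sections of a Hilbert-Schmidt
  operator need not converge, so determinant and exponential factor are never separated in a limit:
  what converges is the product \<open>det2 N\<close>. And the section of a product is not the
  product of the sections, whereas the determinant in the statement is built from the sections of
  the single operator (I - A) exp A. The comparison succeeds because (1 - z) exp z = 1 + O(z^2):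
  every term beyond the identity contains two Hilbert-Schmidt factors, and such a product has a
  controlled trace. Convergence of \<open>det2 N\<close> is passed along a chain of operators: zero,
  staircase, Volterra, Volterra plus finite rank. Determinant and trace are defined by descriptions
  ranging over all orthonormal bases, so each limit is proved in an arbitrary basis, and one basis
  has to be constructed for the descriptions to have a unique solution. Operators are handled
  through a pointwise bound by a square-integrable function; this alone controls the Hilbert-Schmidt
  norms of all sections.\<close>

text \<open>Induction on \<open>n\<close>. A Householder reflection \<open>W\<close>, applied from
  the right, turns row 0 into a multiple of the first unit vector. Being unitary, it preserves the
  length of every row and the modulus of the determinant. Laplace expansion along row 0 then leaves
  one minor, and deleting a column can only shorten the other rows.\<close>

lemma hadamard_inequality:
  fixes A :: "complex mat"
  assumes "A \<in> carrier_mat n n"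
  shows "(cmod (Determinant.det A))\<^sup>2 \<le> (\<Prod>i<n. \<Sum>j<n. (cmod (A $$ (i,j)))\<^sup>2)"
  using assms
proof (induction n arbitrary: A)
  case 0
  then show ?case by simp
next
  case (Suc n)
  note A = Suc.prems
  define r where "r = (\<lambda>j. A $$ (0,j))"
  define \<rho> where "\<rho> = sqrt (\<Sum>j<Suc n. (cmod (r j))\<^sup>2)"
  have \<rho>2: "\<rho>\<^sup>2 = (\<Sum>j<Suc n. (cmod (r j))\<^sup>2)" unfolding \<rho>_def by (intro real_sqrt_pow2 sum_nonneg) auto
  have \<rho>0: "\<rho> \<ge> 0" unfolding \<rho>_def by (intro real_sqrt_ge_zero sum_nonneg) auto
  show ?case
  proof (cases "\<rho> = 0")
    case True
    then have "(\<Sum>j<Suc n. (cmod (r j))\<^sup>2) = 0" using \<rho>2 by simp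
    then have z: "r j = 0" if "j < Suc n" for j
      using that by (subst (asm) sum_nonneg_eq_0_iff) auto
    have "Determinant.det A = (\<Sum>j<Suc n. A $$ (0,j) * cofactor A 0 j)"
      by (rule laplace_expansion_row[OF A]) simp
    also have "\<dots> = 0" using z by (intro sum.neutral) (auto simp: r_def)
    finally show ?thesis by (auto intro!: prod_nonneg sum_nonneg simp del: sum.lessThan_Suc prod.lessThan_Suc)
  next
    case False
    then have \<rho>p: "\<rho> > 0" using \<rho>0 by simp
    \<comment> \<open>\<open>s\<close> is the phase of \<open>r 0\<close>. The new entry
      \<open>c\<close> gets the opposite phase, so that \<open>w 0 = r 0 - c\<close> suffers no
      cancellation and the vector of the reflection cannot vanish.\<close>
    define s where "s = (if r 0 = 0 then 1 else r 0 / cmod (r 0))"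
    have s1: "cmod s = 1" by (auto simp: s_def norm_divide)
    have r0: "r 0 = cmod (r 0) * s" by (auto simp: s_def)
    define c where "c = - \<rho> * s"
    define w where "w = (\<lambda>j. r j - (if j = (0::nat) then c else 0))"
    \<comment> \<open>The value that the squared length of \<open>w\<close> turns out to have
      (\<open>ww\<close>), in a form that shows it to be positive.\<close>
    define \<nu> where "\<nu> = 2 * \<rho>\<^sup>2 + 2 * \<rho> * cmod (r 0)"
    have \<nu>p: "\<nu> > 0" unfolding \<nu>_def using \<rho>p by (intro add_pos_nonneg) auto
    have ss: "s * cnj s = 1" using s1 by (metis complex_norm_square of_real_1 one_power2)
    have rc: "(\<Sum>j<Suc n. r j * cnj (r j)) = complex_of_real (\<rho>\<^sup>2)"
      unfolding \<rho>2 of_real_sum by (intro sum.cong refl) (simp only: complex_norm_square)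
    have rs: "r 0 * cnj s = cmod (r 0)" using r0 ss by (metis mult.assoc mult.right_neutral)
    have rs': "s * cnj (r 0) = cmod (r 0)" using arg_cong[OF rs, of cnj] by (simp add: mult.commute)
    have rw: "(\<Sum>j<Suc n. r j * cnj (w j)) = \<nu> / 2"
    proof -
      have "(\<Sum>j<Suc n. r j * cnj (w j)) = (\<Sum>j<Suc n. r j * cnj (r j) - (if j = 0 then r j * cnj c else 0))"
        by (intro sum.cong refl) (auto simp: w_def algebra_simps)
      also have "\<dots> = \<rho>\<^sup>2 - r 0 * cnj c" unfolding sum_subtractf rc by (simp add: sum.delta del: sum.lessThan_Suc)
      also have "\<dots> = \<rho>\<^sup>2 + \<rho> * (r 0 * cnj s)" by (simp add: c_def algebra_simps)
      finally show ?thesis unfolding rs by (simp add: \<nu>_def)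
    qed
    have ww: "(\<Sum>j<Suc n. w j * cnj (w j)) = \<nu>"
    proof -
      have "(\<Sum>j<Suc n. w j * cnj (w j)) = (\<Sum>j<Suc n. r j * cnj (w j) - (if j = 0 then c * cnj (w j) else 0))"
        by (intro sum.cong refl) (auto simp: w_def algebra_simps)
      also have "\<dots> = \<nu> / 2 - c * cnj (w 0)" unfolding sum_subtractf rw by (simp add: sum.delta del: sum.lessThan_Suc)
      also have "c * cnj (w 0) = - \<rho> * (s * cnj (r 0)) - \<rho>\<^sup>2 * (s * cnj s)"
        by (simp add: w_def c_def algebra_simps power2_eq_square)
      finally show ?thesis unfolding rs' ss by (simp add: \<nu>_def)
    qed
    define W where "W = Matrix.mat (Suc n) (Suc n) (\<lambda>(i,j). (if i = j then 1 else 0) - 2 * cnj (w i) * w j / \<nu>)"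
    have W: "W \<in> carrier_mat (Suc n) (Suc n)" by (simp add: W_def)
    have WW: "W * W = 1\<^sub>m (Suc n)"
    proof (rule eq_matI)
      fix i j assume "i < dim_row (1\<^sub>m (Suc n) :: complex mat)" "j < dim_col (1\<^sub>m (Suc n) :: complex mat)"
      then have ij: "i < Suc n" "j < Suc n" by auto
      have "(W * W) $$ (i,j) = (\<Sum>l<Suc n. W $$ (i,l) * W $$ (l,j))"
        using W ij by (simp add: scalar_prod_def lessThan_atLeast0 del: sum.lessThan_Suc sum.op_ivl_Suc)
      also have "\<dots> = (\<Sum>l<Suc n. (if i = l then (if i = j then 1 else 0) - 2 * cnj (w i) * w j / \<nu> else 0)
           - (if l = j then 2 * cnj (w i) * w j / \<nu> else 0) + 4 * cnj (w i) * w j / \<nu>\<^sup>2 * (w l * cnj (w l)))"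
        using ij by (intro sum.cong refl) (auto simp: W_def algebra_simps power2_eq_square)
      also have "\<dots> = (if i = j then 1 else 0) - 2 * cnj (w i) * w j / \<nu> - 2 * cnj (w i) * w j / \<nu> + 4 * cnj (w i) * w j / \<nu>\<^sup>2 * \<nu>"
        unfolding sum.distrib sum_subtractf sum_distrib_left[symmetric] ww using ij by (simp add: sum.delta sum.delta' del: sum.lessThan_Suc)
      also have "\<dots> = (if i = j then 1 else 0)" using \<nu>p by (simp add: field_simps power2_eq_square)
      finally show "(W * W) $$ (i,j) = 1\<^sub>m (Suc n) $$ (i,j)" using ij by simp
    qed (use W in auto)
    have "Determinant.det W * Determinant.det W = 1" using det_mult[OF W W] unfolding WW by simp
    then have dW: "cmod (Determinant.det W) = 1" by (metis norm_mult norm_one norm_ge_zero real_sqrt_abs2 real_sqrt_one abs_of_nonneg)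
    define B where "B = A * W"
    have B: "B \<in> carrier_mat (Suc n) (Suc n)" using A W by (simp add: B_def)
    define t where "t = (\<lambda>i. \<Sum>l<Suc n. A $$ (i,l) * cnj (w l))"
    have Bij: "B $$ (i,j) = A $$ (i,j) - 2 / \<nu> * t i * w j" if "i < Suc n" "j < Suc n" for i j
    proof -
      have "B $$ (i,j) = (\<Sum>l<Suc n. A $$ (i,l) * W $$ (l,j))"
        using A W that by (simp add: B_def scalar_prod_def lessThan_atLeast0 del: sum.lessThan_Suc sum.op_ivl_Suc)
      also have "\<dots> = (\<Sum>l<Suc n. (if l = j then A $$ (i,l) else 0) - 2 / \<nu> * w j * (A $$ (i,l) * cnj (w l)))"
        using that by (intro sum.cong refl) (auto simp: W_def algebra_simps)
      also have "\<dots> = A $$ (i,j) - 2 / \<nu> * w j * t i"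
        unfolding sum_subtractf sum_distrib_left[symmetric] t_def using that by (simp add: sum.delta del: sum.lessThan_Suc)
      finally show ?thesis by (simp add: mult_ac)
    qed
    have Bn: "(\<Sum>j<Suc n. (cmod (B $$ (i,j)))\<^sup>2) = (\<Sum>j<Suc n. (cmod (A $$ (i,j)))\<^sup>2)" if i: "i < Suc n" for i
    proof -
      have ct: "(\<Sum>l<Suc n. w l * cnj (A $$ (i,l))) = cnj (t i)"
        unfolding t_def by (simp add: mult.commute del: sum.lessThan_Suc)
      have tt: "(\<Sum>j<Suc n. A $$ (i,j) * cnj (w j)) = t i" by (simp only: t_def)
      have "complex_of_real (\<Sum>j<Suc n. (cmod (B $$ (i,j)))\<^sup>2) = (\<Sum>j<Suc n. B $$ (i,j) * cnj (B $$ (i,j)))"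
        unfolding of_real_sum by (intro sum.cong refl) (simp only: complex_norm_square)
      also have "\<dots> = (\<Sum>j<Suc n. A $$ (i,j) * cnj (A $$ (i,j)) - 2 / \<nu> * t i * (w j * cnj (A $$ (i,j)))
           - 2 / \<nu> * cnj (t i) * (A $$ (i,j) * cnj (w j)) + 4 / \<nu>\<^sup>2 * t i * cnj (t i) * (w j * cnj (w j)))"
        by (intro sum.cong refl) (auto simp: Bij i algebra_simps power2_eq_square)
      also have "\<dots> = (\<Sum>j<Suc n. A $$ (i,j) * cnj (A $$ (i,j))) - 2 / \<nu> * t i * cnj (t i)
           - 2 / \<nu> * cnj (t i) * t i + 4 / \<nu>\<^sup>2 * t i * cnj (t i) * \<nu>"
        unfolding sum.distrib sum_subtractf sum_distrib_left[symmetric] ww ct tt ..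
      also have "\<dots> = (\<Sum>j<Suc n. A $$ (i,j) * cnj (A $$ (i,j)))"
        using \<nu>p by (simp add: field_simps power2_eq_square del: sum.lessThan_Suc)
      also have "\<dots> = complex_of_real (\<Sum>j<Suc n. (cmod (A $$ (i,j)))\<^sup>2)"
        unfolding of_real_sum by (intro sum.cong refl) (simp only: complex_norm_square)
      finally show ?thesis by (simp only: of_real_eq_iff)
    qed
    have t0: "t 0 = \<nu> / 2" using rw by (simp add: t_def r_def)
    have B0: "B $$ (0,j) = (if j = 0 then c else 0)" if "j < Suc n" for j
      using Bij[OF _ that, of 0] \<nu>p unfolding t0 by (simp add: r_def w_def)
    have "Determinant.det B = (\<Sum>j<Suc n. B $$ (0,j) * cofactor B 0 j)"
      by (rule laplace_expansion_row[OF B]) simp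
    also have "\<dots> = (\<Sum>j<Suc n. if j = 0 then c * cofactor B 0 0 else 0)"
      by (intro sum.cong refl) (auto simp: B0)
    also have "\<dots> = c * cofactor B 0 0" by (simp add: sum.delta del: sum.lessThan_Suc)
    finally have dB: "Determinant.det B = c * Determinant.det (mat_delete B 0 0)" by (simp add: cofactor_def)
    have D: "mat_delete B 0 0 \<in> carrier_mat n n" using B by (metis mat_delete_carrier diff_Suc_1)
    have Dij: "mat_delete B 0 0 $$ (i,j) = B $$ (Suc i, Suc j)" if "i < n" "j < n" for i j
      using B that by (simp add: mat_delete_def)
    have "(cmod (Determinant.det A))\<^sup>2 = (cmod (Determinant.det B))\<^sup>2"
      using det_mult[OF A W] dW by (simp add: B_def norm_mult)
    also have "\<dots> = \<rho>\<^sup>2 * (cmod (Determinant.det (mat_delete B 0 0)))\<^sup>2"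
      using s1 by (simp add: dB c_def norm_mult power_mult_distrib)
    also have "\<dots> \<le> \<rho>\<^sup>2 * (\<Prod>i<n. \<Sum>j<n. (cmod (mat_delete B 0 0 $$ (i,j)))\<^sup>2)"
      by (intro mult_left_mono Suc.IH D) auto
    also have "\<dots> \<le> \<rho>\<^sup>2 * (\<Prod>i<n. \<Sum>j<Suc n. (cmod (B $$ (Suc i,j)))\<^sup>2)"
    proof (intro mult_left_mono prod_mono conjI sum_nonneg)
      fix i assume "i \<in> {..<n}"
      then have "(\<Sum>j<n. (cmod (mat_delete B 0 0 $$ (i,j)))\<^sup>2) = (\<Sum>j<n. (cmod (B $$ (Suc i, Suc j)))\<^sup>2)"
        by (intro sum.cong refl) (simp add: Dij)
      also have "\<dots> \<le> (\<Sum>j<Suc n. (cmod (B $$ (Suc i,j)))\<^sup>2)"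
        unfolding sum.lessThan_Suc_shift by simp
      finally show "(\<Sum>j<n. (cmod (mat_delete B 0 0 $$ (i,j)))\<^sup>2) \<le> (\<Sum>j<Suc n. (cmod (B $$ (Suc i,j)))\<^sup>2)" .
    qed auto
    also have "\<dots> = (\<Sum>j<Suc n. (cmod (A $$ (0,j)))\<^sup>2) * (\<Prod>i<n. \<Sum>j<Suc n. (cmod (A $$ (Suc i,j)))\<^sup>2)"
      unfolding \<rho>2 r_def by (intro arg_cong2[where f = "(*)"] prod.cong refl Bn) simp
    also have "\<dots> = (\<Prod>i<Suc n. \<Sum>j<Suc n. (cmod (A $$ (i,j)))\<^sup>2)"
      by (simp only: prod.lessThan_Suc_shift)
    finally show ?thesis .
  qed
qed

section \<open>Finite sections and regularized determinants\<close>

definition kron :: "nat \<Rightarrow> nat \<Rightarrow> complex" where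
  "kron i j = (if i = j then 1 else 0)"

text \<open>Infinite matrices are total functions of two indices, and the size is a separate
  argument throughout: one matrix thus has sections of every size, free of carrier
  conditions.\<close>

definition sec :: "nat \<Rightarrow> (nat \<Rightarrow> nat \<Rightarrow> complex) \<Rightarrow> complex mat" where
  "sec N a = Matrix.mat N N (\<lambda>(i,j). a i j)"

definition hs :: "nat \<Rightarrow> (nat \<Rightarrow> nat \<Rightarrow> complex) \<Rightarrow> real" where
  "hs N a = L2_set (\<lambda>(i,j). cmod (a i j)) ({..<N} \<times> {..<N})"

definition tr :: "nat \<Rightarrow> (nat \<Rightarrow> nat \<Rightarrow> complex) \<Rightarrow> complex" where
  "tr N a = (\<Sum>i<N. a i i)"

definition mm :: "nat \<Rightarrow> (nat \<Rightarrow> nat \<Rightarrow> complex) \<Rightarrow> (nat \<Rightarrow> nat \<Rightarrow> complex) \<Rightarrow> nat \<Rightarrow> nat \<Rightarrow> complex" where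
  "mm N a b = (\<lambda>i j. \<Sum>l<N. a i l * b l j)"

primrec mpow :: "nat \<Rightarrow> (nat \<Rightarrow> nat \<Rightarrow> complex) \<Rightarrow> nat \<Rightarrow> nat \<Rightarrow> nat \<Rightarrow> complex" where
  "mpow N a 0 = kron"
| "mpow N a (Suc k) = mm N a (mpow N a k)"

definition det_I_plus :: "nat \<Rightarrow> (nat \<Rightarrow> nat \<Rightarrow> complex) \<Rightarrow> complex" where
  "det_I_plus N x = Determinant.det (sec N (\<lambda>i j. kron i j + x i j))"

text \<open>The exponential removes the term - tr a from the logarithm of det (I - a). What is left
  is of second order in \<open>a\<close>, hence governed by the Hilbert-Schmidt norm.\<close>

definition det2 :: "nat \<Rightarrow> (nat \<Rightarrow> nat \<Rightarrow> complex) \<Rightarrow> complex" where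
  "det2 N a = det_I_plus N (\<lambda>i j. - a i j) * exp (tr N a)"

lemma sec_carrier [simp]: "sec N a \<in> carrier_mat N N"
  by (simp add: sec_def)

lemma sec_dim [simp]: "dim_row (sec N a) = N" "dim_col (sec N a) = N"
  by (simp_all add: sec_def)

lemma sec_index [simp]: "i < N \<Longrightarrow> j < N \<Longrightarrow> sec N a $$ (i,j) = a i j"
  by (simp add: sec_def)

lemma sec_mm: "sec N (mm N a b) = sec N a * sec N b"
  by (rule eq_matI) (auto simp: mm_def scalar_prod_def lessThan_atLeast0 intro!: sum.cong)

lemma sec_cong: "(\<And>i j. i < N \<Longrightarrow> j < N \<Longrightarrow> a i j = b i j) \<Longrightarrow> sec N a = sec N b"
  by (rule eq_matI) auto

lemma hs_nonneg [simp]: "0 \<le> hs N a"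
  by (simp add: hs_def)

lemma hs_power2: "(hs N a)\<^sup>2 = (\<Sum>i<N. \<Sum>j<N. (cmod (a i j))\<^sup>2)"
  unfolding hs_def L2_set_def sum.cartesian_product
  by (subst real_sqrt_pow2) (auto intro!: sum_nonneg sum.cong simp: case_prod_unfold)

lemma hs_cong: "(\<And>i j. i < N \<Longrightarrow> j < N \<Longrightarrow> cmod (a i j) = cmod (b i j)) \<Longrightarrow> hs N a = hs N b"
  unfolding hs_def by (intro L2_set_cong) auto

lemma hs_add: "hs N (\<lambda>i j. a i j + b i j) \<le> hs N a + hs N b"
proof -
  have "hs N (\<lambda>i j. a i j + b i j) \<le> L2_set (\<lambda>p. (case p of (i,j) \<Rightarrow> cmod (a i j)) + (case p of (i,j) \<Rightarrow> cmod (b i j))) ({..<N} \<times> {..<N})"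
    unfolding hs_def by (intro L2_set_mono) (auto intro: norm_triangle_ineq)
  also have "\<dots> \<le> hs N a + hs N b" unfolding hs_def by (rule L2_set_triangle_ineq)
  finally show ?thesis .
qed

lemma hs_scale: "hs N (\<lambda>i j. c * a i j) = cmod c * hs N a"
proof -
  have "(hs N (\<lambda>i j. c * a i j))\<^sup>2 = (cmod c * hs N a)\<^sup>2"
    by (simp add: hs_power2 norm_mult power_mult_distrib sum_distrib_left)
  then show ?thesis by (rule power2_eq_imp_eq) auto
qed

lemma hs_zero [simp]: "hs N (\<lambda>i j. 0) = 0"
  by (simp add: hs_def L2_set_def)

lemma hs_uminus [simp]: "hs N (\<lambda>i j. - a i j) = hs N a"
  by (rule hs_cong) simp

lemma hs_sum: "hs N (\<lambda>i j. \<Sum>k\<in>K. a k i j) \<le> (\<Sum>k\<in>K. hs N (a k))"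
proof (induction K rule: infinite_finite_induct)
  case (insert k K)
  then show ?case using hs_add[of N "a k" "\<lambda>i j. \<Sum>k\<in>K. a k i j"] by simp
qed auto

lemma hs_mono: "N \<le> L \<Longrightarrow> hs N a \<le> hs L a"
  unfolding hs_def L2_set_def by (intro real_sqrt_le_mono sum_mono2) auto

text \<open>Cauchy-Schwarz over pairs of indices. The trace stops at \<open>N\<close> although the
  product is formed in size \<open>L\<close>, as needed for corners of products taken in a larger
  section.\<close>

lemma tr_mm_bound:
  assumes "N \<le> L"
  shows "cmod (tr N (mm L a b)) \<le> hs L a * hs L b"
proof -
  have "cmod (tr N (mm L a b)) \<le> (\<Sum>i<N. \<Sum>l<L. cmod (a i l) * cmod (b l i))"
    unfolding tr_def mm_def by (intro sum_norm_le) (simp add: norm_mult[symmetric] sum_norm_le)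
  also have "\<dots> \<le> (\<Sum>i<L. \<Sum>l<L. cmod (a i l) * cmod (b l i))"
    using assms by (intro sum_mono2) (auto intro: sum_nonneg)
  also have "\<dots> = (\<Sum>(i,l)\<in>{..<L} \<times> {..<L}. \<bar>cmod (a i l)\<bar> * \<bar>cmod (b l i)\<bar>)"
    by (simp add: sum.cartesian_product)
  also have "\<dots> \<le> L2_set (\<lambda>(i,l). cmod (a i l)) ({..<L} \<times> {..<L}) * L2_set (\<lambda>(i,l). cmod (b l i)) ({..<L} \<times> {..<L})"
    using L2_set_mult_ineq[of "\<lambda>(i,l). cmod (a i l)" "\<lambda>(i,l). cmod (b l i)" "{..<L} \<times> {..<L}"]
    by (simp add: case_prod_unfold)
  also have "L2_set (\<lambda>(i,l). cmod (b l i)) ({..<L} \<times> {..<L}) = hs L b"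
    unfolding hs_def L2_set_def
    by (intro arg_cong[where f = sqrt] sum.reindex_bij_witness[of _ prod.swap prod.swap]) auto
  finally show ?thesis by (simp add: hs_def)
qed

lemma hs_mm: "hs N (mm N a b) \<le> hs N a * hs N b"
proof (rule power2_le_imp_le)
  have *: "(cmod (mm N a b i j))\<^sup>2 \<le> (\<Sum>l<N. (cmod (a i l))\<^sup>2) * (\<Sum>l<N. (cmod (b l j))\<^sup>2)" for i j
  proof -
    have "cmod (mm N a b i j) \<le> (\<Sum>l<N. \<bar>cmod (a i l)\<bar> * \<bar>cmod (b l j)\<bar>)"
      unfolding mm_def by (intro sum_norm_le) (simp add: norm_mult)
    also have "\<dots> \<le> L2_set (\<lambda>l. cmod (a i l)) {..<N} * L2_set (\<lambda>l. cmod (b l j)) {..<N}"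
      by (rule L2_set_mult_ineq)
    finally have "(cmod (mm N a b i j))\<^sup>2 \<le> (L2_set (\<lambda>l. cmod (a i l)) {..<N} * L2_set (\<lambda>l. cmod (b l j)) {..<N})\<^sup>2"
      by (intro power_mono) auto
    then show ?thesis by (simp add: power_mult_distrib L2_set_def sum_nonneg)
  qed
  have "(hs N (mm N a b))\<^sup>2 \<le> (\<Sum>i<N. \<Sum>j<N. (\<Sum>l<N. (cmod (a i l))\<^sup>2) * (\<Sum>l<N. (cmod (b l j))\<^sup>2))"
    unfolding hs_power2 by (intro sum_mono *)
  also have "\<dots> = (\<Sum>i<N. \<Sum>l<N. (cmod (a i l))\<^sup>2) * (\<Sum>j<N. \<Sum>l<N. (cmod (b l j))\<^sup>2)"
    by (simp add: sum_product)
  also have "(\<Sum>j<N. \<Sum>l<N. (cmod (b l j))\<^sup>2) = (hs N b)\<^sup>2"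
    unfolding hs_power2 by (rule sum.swap)
  finally show "(hs N (mm N a b))\<^sup>2 \<le> (hs N a * hs N b)\<^sup>2" by (simp add: hs_power2 power_mult_distrib)
qed auto

text \<open>Exponents start at one because the identity of size \<open>N\<close> has Hilbert-Schmidt
  norm \<open>sqrt N\<close>, which is unbounded.\<close>

lemma hs_mpow: "hs N (mpow N a (Suc k)) \<le> hs N a ^ Suc k"
proof (induction k)
  case 0
  have "hs N (mm N a kron) = hs N a"
    by (rule hs_cong) (simp add: mm_def kron_def if_distrib[of "\<lambda>x. _ * x"] cong: if_cong)
  then show ?case by simp
next
  case (Suc k)
  have "hs N (mpow N a (Suc (Suc k))) \<le> hs N a * hs N (mpow N a (Suc k))"
    unfolding mpow.simps(2)[of N a "Suc k"] by (rule hs_mm)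
  also have "\<dots> \<le> hs N a * hs N a ^ Suc k" by (intro mult_left_mono Suc) auto
  finally show ?case by simp
qed

text \<open>Row i of I + x has squared length 1 + 2 Re x_ii + sum_j |x_ij|^2, and 1 + t \<le> exp t
  turns Hadamard's product into an exponential. Keeping the real part of the trace, rather than its
  modulus, is what lets it cancel in \<open>norm_det2_le\<close>.\<close>

lemma norm_det_I_plus_le: "cmod (det_I_plus N x) \<le> exp (Re (tr N x) + (hs N x)\<^sup>2 / 2)"
proof -
  have "(cmod (det_I_plus N x))\<^sup>2 \<le> (\<Prod>i<N. \<Sum>j<N. (cmod (kron i j + x i j))\<^sup>2)"
    unfolding det_I_plus_def by (rule order.trans[OF hadamard_inequality[OF sec_carrier]]) simp
  also have "\<dots> \<le> (\<Prod>i<N. exp (2 * Re (x i i) + (\<Sum>j<N. (cmod (x i j))\<^sup>2)))"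
  proof (intro prod_mono conjI sum_nonneg)
    fix i assume i: "i \<in> {..<N}"
    have "(cmod (kron i j + x i j))\<^sup>2 = (if i = j then 1 + 2 * Re (x i j) else 0) + (cmod (x i j))\<^sup>2" for j
      by (simp add: kron_def cmod_power2) (simp add: power2_eq_square algebra_simps)
    then have "(\<Sum>j<N. (cmod (kron i j + x i j))\<^sup>2) = 1 + (2 * Re (x i i) + (\<Sum>j<N. (cmod (x i j))\<^sup>2))"
      using i by (simp add: sum.distrib)
    also have "\<dots> \<le> exp (2 * Re (x i i) + (\<Sum>j<N. (cmod (x i j))\<^sup>2))"
      by (rule exp_ge_add_one_self)
    finally show "(\<Sum>j<N. (cmod (kron i j + x i j))\<^sup>2) \<le> exp (2 * Re (x i i) + (\<Sum>j<N. (cmod (x i j))\<^sup>2))" .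
  qed auto
  also have "\<dots> = exp (2 * Re (tr N x) + (hs N x)\<^sup>2)"
    by (simp add: exp_sum[symmetric] sum.distrib tr_def hs_power2 sum_distrib_left Re_sum)
  also have "\<dots> = (exp (Re (tr N x) + (hs N x)\<^sup>2 / 2))\<^sup>2"
    by (simp add: power2_eq_square exp_add[symmetric] algebra_simps)
  finally show ?thesis by (rule power2_le_imp_le) simp
qed

lemma tr_uminus [simp]: "tr N (\<lambda>i j. - a i j) = - tr N a"
  by (simp add: tr_def sum_negf)

lemma tr_add: "tr N (\<lambda>i j. a i j + b i j) = tr N a + tr N b"
  by (simp add: tr_def sum.distrib)

lemma tr_scale: "tr N (\<lambda>i j. c * a i j) = c * tr N a"
  by (simp add: tr_def sum_distrib_left)

lemma norm_det2_le: "cmod (det2 N a) \<le> exp ((hs N a)\<^sup>2 / 2)"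
proof -
  have "cmod (det2 N a) \<le> exp (Re (tr N (\<lambda>i j. - a i j)) + (hs N (\<lambda>i j. - a i j))\<^sup>2 / 2) * exp (Re (tr N a))"
    unfolding det2_def norm_mult norm_exp_eq_Re by (intro mult_right_mono norm_det_I_plus_le) auto
  then show ?thesis by (simp add: exp_add[symmetric])
qed

section \<open>Lipschitz estimates from Cauchy's inequality\<close>

text \<open>Mean value inequality on the unit disc. The derivative is estimated by Cauchy's
  inequality on discs of radius 1/d - 1 about points of the unit disc, which stay where the bound
  \<open>M\<close> holds.\<close>

lemma entire_difference_bound:
  assumes f: "f holomorphic_on UNIV" and d: "0 < d" "d \<le> 1/2"
    and M: "\<And>z. cmod z \<le> 1 / d \<Longrightarrow> cmod (f z) \<le> M"
  shows "cmod (f 1 - f 0) \<le> 2 * M * d"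
proof -
  define r where "r = 1 / d - 1"
  \<comment> \<open>The radius is \<open>2 * e - 1\<close>, which is at least \<open>e\<close> once
    \<open>e\<close> is at least 1; this is the purpose of d \<le> 1/2.\<close>
  define e where "e = 1 / (2 * d)"
  have e: "1 \<le> e" using d by (simp add: e_def le_divide_eq)
  have re: "r = 2 * e - 1" by (simp add: r_def e_def)
  have "1 / r \<le> 1 / e" using e by (intro divide_left_mono) (auto simp: re)
  then have r: "r > 0" "1 / r \<le> 2 * d" using e by (auto simp: re e_def)
  have "cmod (f 0) \<le> M" using d by (intro M) auto
  then have M0: "M \<ge> 0" using norm_ge_zero[of "f 0"] by linarith
  have hol: "f holomorphic_on S" for S using f holomorphic_on_subset by blast
  have "cmod (f 1 - f 0) \<le> (M / r) * cmod (1 - 0)"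
  proof (rule field_differentiable_bound[where S = "cball 0 1"])
    fix w :: complex assume w: "w \<in> cball 0 1"
    show "(f has_field_derivative deriv f w) (at w within cball 0 1)"
      using f by (metis UNIV_I has_field_derivative_at_within holomorphic_derivI open_UNIV)
    have "cmod ((deriv ^^ 1) f w) \<le> fact 1 * M / r ^ 1"
    proof (rule Cauchy_inequality)
      fix x assume "cmod (w - x) = r"
      then have "cmod x \<le> 1 + r" using w norm_triangle_ineq4[of w "w - x"] by simp
      then show "cmod (f x) \<le> M" by (intro M) (simp add: r_def)
    qed (use hol r holomorphic_on_imp_continuous_on in auto)
    then show "cmod (deriv f w) \<le> M / r" by simp
  qed auto
  also have "\<dots> = M * (1 / r)" by simp
  also have "\<dots> \<le> M * (2 * d)" using r M0 by (intro mult_left_mono) auto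
  finally show ?thesis by (simp add: mult_ac)
qed

lemma holomorphic_det_I_plus: "(\<lambda>z. det_I_plus N (\<lambda>i j. x i j + z * y i j)) holomorphic_on UNIV"
proof -
  have "det_I_plus N (\<lambda>i j. x i j + z * y i j) =
      (\<Sum>p\<in>{p. p permutes {0..<N}}. signof p * (\<Prod>i = 0..<N. kron i (p i) + (x i (p i) + z * y i (p i))))" for z
    unfolding det_I_plus_def det_def'[OF sec_carrier]
    by (intro sum.cong refl arg_cong2[where f = "(*)"] prod.cong) (auto dest: permutes_in_image)
  then show ?thesis by (simp only:) (intro holomorphic_intros)
qed

text \<open>For such \<open>z\<close> the displacement from \<open>y\<close> has norm at most 1.
  This is the origin of the \<open>+ 1\<close> in the Lipschitz constants below.\<close>

lemma hs_line_bound: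
  assumes "hs N (\<lambda>i j. x i j - y i j) \<le> d" "0 < d" "cmod z \<le> 1 / d"
  shows "hs N (\<lambda>i j. y i j + z * (x i j - y i j)) \<le> hs N y + 1"
proof -
  have "hs N (\<lambda>i j. y i j + z * (x i j - y i j)) \<le> hs N y + cmod z * hs N (\<lambda>i j. x i j - y i j)"
    using hs_add[of N y "\<lambda>i j. z * (x i j - y i j)"] by (simp add: hs_scale)
  also have "cmod z * hs N (\<lambda>i j. x i j - y i j) \<le> 1 / d * d"
    using assms by (intro mult_mono) auto
  finally show ?thesis using assms by simp
qed

text \<open>With no exponential factor to cancel it, the trace has to be controlled as well, both
  for the difference and at the base point.\<close>

lemma det_I_plus_lipschitz:
  assumes h: "hs N (\<lambda>i j. x i j - y i j) \<le> d" and t: "cmod (tr N (\<lambda>i j. x i j - y i j)) \<le> d"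
    and d: "0 < d" "d \<le> 1/2"
  shows "cmod (det_I_plus N x - det_I_plus N y) \<le> 2 * exp (cmod (tr N y) + 1 + (hs N y + 1)\<^sup>2 / 2) * d"
proof -
  let ?f = "\<lambda>z. det_I_plus N (\<lambda>i j. y i j + z * (x i j - y i j))"
  have "cmod (?f 1 - ?f 0) \<le> 2 * exp (cmod (tr N y) + 1 + (hs N y + 1)\<^sup>2 / 2) * d"
  proof (rule entire_difference_bound[OF holomorphic_det_I_plus d])
    fix z assume z: "cmod z \<le> 1 / d"
    have "cmod (tr N (\<lambda>i j. y i j + z * (x i j - y i j))) \<le> cmod (tr N y) + cmod z * cmod (tr N (\<lambda>i j. x i j - y i j))"
      unfolding tr_add tr_scale by (rule order.trans[OF norm_triangle_ineq]) (simp add: norm_mult)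
    also have "cmod z * cmod (tr N (\<lambda>i j. x i j - y i j)) \<le> 1 / d * d"
      using t z d by (intro mult_mono) auto
    finally have "Re (tr N (\<lambda>i j. y i j + z * (x i j - y i j))) \<le> cmod (tr N y) + 1"
      using d complex_Re_le_cmod order_trans by fastforce
    moreover have "(hs N (\<lambda>i j. y i j + z * (x i j - y i j)))\<^sup>2 \<le> (hs N y + 1)\<^sup>2"
      by (intro power_mono hs_line_bound[OF h d(1) z]) auto
    ultimately show "cmod (?f z) \<le> exp (cmod (tr N y) + 1 + (hs N y + 1)\<^sup>2 / 2)"
      by (intro order.trans[OF norm_det_I_plus_le], unfold exp_le_cancel_iff) linarith
  qed
  then show ?thesis by simp
qed

text \<open>The constant involves the section only through the Hilbert-Schmidt norm of the base
  point. For operators this is bounded in \<open>N\<close>, and that uniformity later allows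
  approximation of an operator before the limit in \<open>N\<close> is taken.\<close>

lemma det2_lipschitz:
  assumes h: "hs N (\<lambda>i j. a i j - b i j) \<le> d" and d: "0 < d" "d \<le> 1/2"
  shows "cmod (det2 N a - det2 N b) \<le> 2 * exp ((hs N b + 1)\<^sup>2 / 2) * d"
proof -
  let ?f = "\<lambda>z. det2 N (\<lambda>i j. b i j + z * (a i j - b i j))"
  have "cmod (?f 1 - ?f 0) \<le> 2 * exp ((hs N b + 1)\<^sup>2 / 2) * d"
  proof (rule entire_difference_bound[OF _ d])
    have "?f z = det_I_plus N (\<lambda>i j. (- b i j) + z * (b i j - a i j)) * exp (tr N b + z * tr N (\<lambda>i j. a i j - b i j))" for z
      unfolding det2_def tr_add tr_scale by (simp add: algebra_simps)
    then show "?f holomorphic_on UNIV" by (simp only:) (intro holomorphic_intros holomorphic_det_I_plus)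
    fix z assume z: "cmod z \<le> 1 / d"
    have "(hs N (\<lambda>i j. b i j + z * (a i j - b i j)))\<^sup>2 \<le> (hs N b + 1)\<^sup>2"
      by (intro power_mono hs_line_bound[OF h d(1) z]) auto
    then show "cmod (?f z) \<le> exp ((hs N b + 1)\<^sup>2 / 2)"
      by (intro order.trans[OF norm_det2_le]) simp
  qed
  then show ?thesis by simp
qed

text \<open>It trades a determinant of growing size \<open>N\<close> for one of fixed size
  \<open>c\<close>, whose finitely many entries can be followed as \<open>N\<close> grows.\<close>

lemma det_I_plus_sylvester:
  "det_I_plus N (\<lambda>i j. - (\<Sum>q<c. V q i * R q j)) = det_I_plus c (\<lambda>p q. - (\<Sum>i<N. R p i * V q i))"
proof -
  define Vm where "Vm = Matrix.mat N c (\<lambda>(i,q). V q i)"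
  define Rm where "Rm = Matrix.mat c N (\<lambda>(q,i). R q i)"
  have V: "Vm \<in> carrier_mat N c" and R: "Rm \<in> carrier_mat c N" by (auto simp: Vm_def Rm_def)
  have e1: "sec N (\<lambda>i j. kron i j + - (\<Sum>q<c. V q i * R q j)) = 1\<^sub>m N - Vm * Rm"
    by (rule eq_matI) (auto simp: Vm_def Rm_def scalar_prod_def kron_def lessThan_atLeast0)
  have e2: "sec c (\<lambda>p q. kron p q + - (\<Sum>i<N. R p i * V q i)) = 1\<^sub>m c - Rm * Vm"
    by (rule eq_matI) (auto simp: Vm_def Rm_def scalar_prod_def kron_def lessThan_atLeast0)
  have VR: "Vm * Rm \<in> carrier_mat N N" and RV: "Rm * Vm \<in> carrier_mat c c" using V R by auto
  have oVR: "1\<^sub>m N - Vm * Rm \<in> carrier_mat N N" and oRV: "1\<^sub>m c - Rm * Vm \<in> carrier_mat c c" using VR RV by (auto intro: minus_carrier_mat)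
  \<comment> \<open>The two sides are the Schur complements of \<open>X\<close> with respect to its
    two identity blocks; each comes from one block triangular factorization.\<close>
  define X where "X = four_block_mat (1\<^sub>m N) Vm Rm (1\<^sub>m c)"
  have "X = four_block_mat (1\<^sub>m N) (0\<^sub>m N c) Rm (1\<^sub>m c) * four_block_mat (1\<^sub>m N) Vm (0\<^sub>m c N) (1\<^sub>m c - Rm * Vm)"
    unfolding X_def using V R RV
    by (subst mult_four_block_mat[of _ N N _ c _ c _ _ N _ c]) (auto intro!: arg_cong2[where f = "four_block_mat _ _"] eq_matI)
  then have "Determinant.det X = Determinant.det (four_block_mat (1\<^sub>m N) (0\<^sub>m N c) Rm (1\<^sub>m c))
      * Determinant.det (four_block_mat (1\<^sub>m N) Vm (0\<^sub>m c N) (1\<^sub>m c - Rm * Vm))"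
    by (simp only: det_mult[OF four_block_carrier_mat[OF one_carrier_mat one_carrier_mat] four_block_carrier_mat[OF one_carrier_mat oRV]])
  also have "\<dots> = Determinant.det (1\<^sub>m c - Rm * Vm)"
    by (simp add: det_four_block_mat_upper_right_zero[OF one_carrier_mat refl R one_carrier_mat]
        det_four_block_mat_lower_left_zero[OF one_carrier_mat V refl oRV])
  finally have d1: "Determinant.det X = Determinant.det (1\<^sub>m c - Rm * Vm)" .
  have "X = four_block_mat (1\<^sub>m N) Vm (0\<^sub>m c N) (1\<^sub>m c) * four_block_mat (1\<^sub>m N - Vm * Rm) (0\<^sub>m N c) Rm (1\<^sub>m c)"
    unfolding X_def using V R VR
    by (subst mult_four_block_mat[of _ N N _ c _ c _ _ N _ c]) (auto intro!: arg_cong2[where f = "\<lambda>x. four_block_mat x _ _"] eq_matI)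
  then have "Determinant.det X = Determinant.det (four_block_mat (1\<^sub>m N) Vm (0\<^sub>m c N) (1\<^sub>m c))
      * Determinant.det (four_block_mat (1\<^sub>m N - Vm * Rm) (0\<^sub>m N c) Rm (1\<^sub>m c))"
    by (simp only: det_mult[OF four_block_carrier_mat[OF one_carrier_mat one_carrier_mat] four_block_carrier_mat[OF oVR one_carrier_mat]])
  also have "\<dots> = Determinant.det (1\<^sub>m N - Vm * Rm)"
    by (simp add: det_four_block_mat_upper_right_zero[OF oVR refl R one_carrier_mat]
        det_four_block_mat_lower_left_zero[OF one_carrier_mat V refl one_carrier_mat])
  finally show ?thesis using d1 by (simp only: det_I_plus_def e1 e2)
qed

lemma det_I_plus_mm:
  "det_I_plus N (\<lambda>i j. a i j + b i j + mm N a b i j) = det_I_plus N a * det_I_plus N b"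
proof -
  have "mm N (\<lambda>i j. kron i j + a i j) (\<lambda>i j. kron i j + b i j) i j = kron i j + (a i j + b i j + mm N a b i j)"
    if "i < N" "j < N" for i j
    using that by (simp add: mm_def algebra_simps sum.distrib kron_def if_distrib[of "\<lambda>x. _ * x"] cong: if_cong)
  then have "sec N (\<lambda>i j. kron i j + (a i j + b i j + mm N a b i j)) = sec N (mm N (\<lambda>i j. kron i j + a i j) (\<lambda>i j. kron i j + b i j))"
    by (intro sec_cong) simp
  then show ?thesis unfolding det_I_plus_def sec_mm by (simp add: det_mult[OF sec_carrier sec_carrier])
qed

lemma tendsto_det_sec:
  assumes "\<And>i j. i < N \<Longrightarrow> j < N \<Longrightarrow> ((\<lambda>n. x n i j) \<longlongrightarrow> y i j) F"
  shows "((\<lambda>n. Determinant.det (sec N (x n))) \<longlongrightarrow> Determinant.det (sec N y)) F"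
proof -
  have e: "Determinant.det (sec N z) = (\<Sum>p\<in>{p. p permutes {0..<N}}. signof p * (\<Prod>i = 0..<N. z i (p i)))" for z
    unfolding det_def'[OF sec_carrier]
    by (intro sum.cong refl arg_cong2[where f = "(*)"] prod.cong) (auto dest: permutes_in_image)
  show ?thesis unfolding e
    by (intro tendsto_sum tendsto_mult tendsto_const tendsto_prod assms) (auto dest: permutes_in_image)
qed

section \<open>The determinant of the matrix exponential\<close>

lemma mpow_upper_triangular:
  assumes b: "\<And>i j. i < N \<Longrightarrow> j < i \<Longrightarrow> b i j = 0"
  shows "i < N \<Longrightarrow> j < i \<Longrightarrow> mpow N b k i j = 0" "i < N \<Longrightarrow> mpow N b k i i = b i i ^ k"
proof (induction k arbitrary: i j)
  case 0
  { case 1 then show ?case by (simp add: kron_def) }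
  { case 2 then show ?case by (simp add: kron_def) }
next
  case (Suc k)
  { case 1
    then have "b i l * mpow N b k l j = 0" if "l < N" for l
      using b[of i l] Suc.IH(1)[of l j] that by (cases "l < i") auto
    then show ?case unfolding mpow.simps mm_def by (intro sum.neutral) auto }
  { case 2
    then have "b i l * mpow N b k l i = (if l = i then b i i ^ Suc k else 0)" if "l < N" for l
      using b[of i l] Suc.IH(1)[of l i] Suc.IH(2)[of i] that by (cases l i rule: linorder_cases) auto
    then have "mpow N b (Suc k) i i = (\<Sum>l<N. if l = i then b i i ^ Suc k else 0)"
      unfolding mpow.simps mm_def by (intro sum.cong) auto
    then show ?case using 2 by simp }
qed

text \<open>Schur form: conjugation commutes with powers and linear combinations, and the diagonal
  of a power of a triangular matrix consists of the powers of the diagonal. Each determinant is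
  therefore a product of scalar partial sums, and the limit expresses det exp a = exp tr a. Partial
  sums stay explicit because they are later matched with partial sums of the operator
  exponential.\<close>

lemma det_exp_partial_sums:
  "(\<lambda>n. Determinant.det (sec N (\<lambda>i j. \<Sum>k<n. mpow N a k i j / fact k))) \<longlonglongrightarrow> exp (tr N a)"
proof -
  obtain as where "char_poly (sec N a) = (\<Prod>a\<leftarrow>as. [:- a, 1:])"
    using char_poly_factorized[OF sec_carrier] by blast
  then obtain Bm where Bm: "Bm \<in> carrier_mat N N" "upper_triangular Bm" "similar_mat (sec N a) Bm"
    using schur_decomposition_exists[OF sec_carrier] by blast
  then obtain P Q where "similar_mat_wit (sec N a) Bm P Q" unfolding similar_mat_def by blast
  then have PQ: "P \<in> carrier_mat N N" "Q \<in> carrier_mat N N" "P * Q = 1\<^sub>m N" "Q * P = 1\<^sub>m N"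
    and AB: "sec N a = P * Bm * Q"
    by (auto simp: similar_mat_wit_def Let_def)
  define b where "b = (\<lambda>i j. Bm $$ (i,j))"
  have secb: "sec N b = Bm" using Bm(1) by (intro eq_matI) (auto simp: b_def)
  have ut: "b i j = 0" if "i < N" "j < i" for i j
    using Bm that by (auto simp: b_def)
  have conj_mult: "(P * sec N x * Q) * (P * sec N y * Q) = P * (sec N x * sec N y) * Q" for x y
  proof -
    have "(P * sec N x * Q) * (P * sec N y * Q) = P * sec N x * (Q * (P * sec N y * Q))"
      using PQ by (intro assoc_mult_mat[of _ N N _ N _ N]) auto
    also have "Q * (P * sec N y * Q) = sec N y * Q"
    proof -
      have "Q * (P * sec N y * Q) = Q * (P * sec N y) * Q"
        using PQ by (intro assoc_mult_mat[symmetric, of _ N N _ N _ N]) auto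
      also have "Q * (P * sec N y) = (Q * P) * sec N y"
        using PQ by (intro assoc_mult_mat[symmetric, of _ N N _ N _ N]) auto
      finally show ?thesis using PQ by simp
    qed
    also have "P * sec N x * (sec N y * Q) = (P * sec N x * sec N y) * Q"
      using PQ by (intro assoc_mult_mat[symmetric, of _ N N _ N _ N]) auto
    also have "P * sec N x * sec N y = P * (sec N x * sec N y)"
      using PQ by (intro assoc_mult_mat[of _ N N _ N _ N]) auto
    finally show ?thesis .
  qed
  have pw: "sec N (mpow N a k) = P * sec N (mpow N b k) * Q" for k
  proof (induction k)
    case 0
    have "sec N kron = 1\<^sub>m N" by (rule eq_matI) (auto simp: kron_def)
    then show ?case using PQ by simp
  next
    case (Suc k)
    have "sec N (mpow N a (Suc k)) = sec N a * sec N (mpow N a k)" by (simp add: sec_mm)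
    also have "\<dots> = (P * sec N b * Q) * (P * sec N (mpow N b k) * Q)" by (simp add: AB secb Suc)
    also have "\<dots> = P * (sec N b * sec N (mpow N b k)) * Q" by (rule conj_mult)
    finally show ?case by (simp add: sec_mm)
  qed
  have sm: "sec N (\<lambda>i j. \<Sum>k<n. mpow N a k i j / fact k) = P * sec N (\<lambda>i j. \<Sum>k<n. mpow N b k i j / fact k) * Q" for n
  proof (induction n)
    case 0
    have "sec N (\<lambda>i j. 0) = 0\<^sub>m N N" by (rule eq_matI) auto
    then show ?case using PQ by simp
  next
    case (Suc n)
    have add: "sec N (\<lambda>i j. \<Sum>k<Suc n. mpow N c k i j / fact k) =
        sec N (\<lambda>i j. \<Sum>k<n. mpow N c k i j / fact k) + (1 / fact n) \<cdot>\<^sub>m sec N (mpow N c n)" for c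
      by (rule eq_matI) auto
    have "P * (sec N x + e \<cdot>\<^sub>m sec N y) * Q = P * sec N x * Q + e \<cdot>\<^sub>m (P * sec N y * Q)" for x y e
    proof -
      have "P * (sec N x + e \<cdot>\<^sub>m sec N y) = P * sec N x + e \<cdot>\<^sub>m (P * sec N y)"
        using PQ by (subst mult_add_distrib_mat[of _ N N]) (auto simp: mult_smult_distrib)
      also have "\<dots> * Q = P * sec N x * Q + e \<cdot>\<^sub>m (P * sec N y) * Q"
        using PQ by (intro add_mult_distrib_mat[of _ N N]) auto
      also have "e \<cdot>\<^sub>m (P * sec N y) * Q = e \<cdot>\<^sub>m (P * sec N y * Q)"
        using PQ by (intro mult_smult_assoc_mat[of _ N N _ N]) auto
      finally show ?thesis .
    qed
    then show ?case unfolding add Suc pw[of n] by simp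
  qed
  have dPQ: "Determinant.det P * Determinant.det Q = 1"
    using det_mult[OF PQ(1,2)] PQ(3) by simp
  have "Determinant.det (sec N (\<lambda>i j. \<Sum>k<n. mpow N a k i j / fact k)) = (\<Prod>i<N. \<Sum>k<n. b i i ^ k / fact k)" for n
  proof -
    let ?E = "sec N (\<lambda>i j. \<Sum>k<n. mpow N b k i j / fact k)"
    have "Determinant.det (P * ?E * Q) = Determinant.det P * Determinant.det ?E * Determinant.det Q"
      using det_mult[of "P * ?E" N Q] det_mult[of P N ?E] PQ by simp
    also have "\<dots> = Determinant.det ?E" using dPQ by (simp add: mult_ac)
    also have "Determinant.det ?E = prod_list (diag_mat ?E)"
      by (intro det_upper_triangular[OF _ sec_carrier] upper_triangularI) (simp add: mpow_upper_triangular[OF ut])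
    also have "\<dots> = (\<Prod>i<N. ?E $$ (i,i))"
      by (simp add: diag_mat_def prod.list_conv_set_nth lessThan_atLeast0)
    also have "\<dots> = (\<Prod>i<N. \<Sum>k<n. b i i ^ k / fact k)"
      by (intro prod.cong refl) (simp add: mpow_upper_triangular[OF ut])
    finally show ?thesis unfolding sm .
  qed
  moreover have "(\<lambda>n. \<Prod>i<N. \<Sum>k<n. b i i ^ k / fact k) \<longlonglongrightarrow> (\<Prod>i<N. exp (b i i))"
  proof (intro tendsto_prod)
    fix i
    show "(\<lambda>n. \<Sum>k<n. b i i ^ k / fact k) \<longlonglongrightarrow> exp (b i i)"
      using exp_converges[of "b i i"] by (simp add: sums_def scaleR_conv_of_real divide_inverse mult.commute)
  qed
  moreover have "(\<Prod>i<N. exp (b i i)) = exp (tr N a)"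
  proof -
    have trc: "tr N (mm N x y) = tr N (mm N y x)" for x y
      unfolding tr_def mm_def by (subst sum.swap) (simp add: mult.commute)
    define p where "p = (\<lambda>i j. P $$ (i,j))"
    define q where "q = (\<lambda>i j. Q $$ (i,j))"
    have Pp: "sec N p = P" "sec N q = Q" using PQ by (auto intro!: eq_matI simp: p_def q_def)
    have trs: "tr N x = (\<Sum>i<N. sec N x $$ (i,i))" for x by (simp add: tr_def)
    have "tr N a = tr N (mm N p (mm N b q))"
      unfolding trs AB sec_mm Pp secb using PQ Bm(1) by (simp only: assoc_mult_mat[of P N N Bm N Q N])
    also have "\<dots> = tr N (mm N (mm N b q) p)" by (rule trc)
    also have "\<dots> = tr N b"
      unfolding trs sec_mm Pp secb using PQ Bm(1) by (simp add: assoc_mult_mat[of Bm N N Q N P N])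
    finally show ?thesis by (simp add: exp_sum tr_def)
  qed
  ultimately show ?thesis by simp
qed

section \<open>Powers of sections compared with sections of powers\<close>

text \<open>Padding by zeros places the \<open>N\<close>-section inside a section of size
  \<open>L\<close>, where it can be subtracted from \<open>a\<close>.\<close>

definition trunc :: "nat \<Rightarrow> (nat \<Rightarrow> nat \<Rightarrow> complex) \<Rightarrow> nat \<Rightarrow> nat \<Rightarrow> complex" where
  "trunc N a i j = (if i < N \<and> j < N then a i j else 0)"

text \<open>The padding contributes nothing to the inner sums. The restriction to the corner matters
  at exponent 0, where \<open>kron\<close> is not truncated.\<close>

lemma mpow_trunc:
  assumes "N \<le> L"
  shows "i < N \<Longrightarrow> j < N \<Longrightarrow> mpow L (trunc N a) k i j = mpow N a k i j"
proof (induction k arbitrary: i j)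
  case (Suc k)
  have "(\<Sum>l<L. trunc N a i l * mpow L (trunc N a) k l j) = (\<Sum>l<N. trunc N a i l * mpow L (trunc N a) k l j)"
    using assms by (intro sum.mono_neutral_right) (auto simp: trunc_def)
  also have "\<dots> = (\<Sum>l<N. a i l * mpow N a k l j)"
    using Suc.prems by (intro sum.cong refl arg_cong2[where f = "(*)"] Suc.IH) (auto simp: trunc_def)
  finally show ?case by (simp add: mm_def)
qed simp

lemma hs_trunc:
  assumes "N \<le> L"
  shows "hs L (trunc N a) = hs N a"
proof -
  have "hs L (trunc N a) = L2_set (\<lambda>(i,j). cmod (trunc N a i j)) ({..<N} \<times> {..<N})"
    unfolding hs_def L2_set_def using assms
    by (intro arg_cong[where f = sqrt] sum.mono_neutral_right) (auto simp: trunc_def split: if_splits)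
  also have "\<dots> = hs N a" unfolding hs_def by (intro L2_set_cong) (auto simp: trunc_def)
  finally show ?thesis .
qed

text \<open>Every entry is either kept or removed, so the squares subtract. As the squared norms of
  the sections increase to a finite limit, the difference is small uniformly in
  \<open>L\<close>.\<close>

lemma hs_diff_trunc:
  assumes "N \<le> L"
  shows "(hs L (\<lambda>i j. a i j - trunc N a i j))\<^sup>2 = (hs L a)\<^sup>2 - (hs N a)\<^sup>2"
proof -
  have "(cmod (a i j - trunc N a i j))\<^sup>2 = (cmod (a i j))\<^sup>2 - (cmod (trunc N a i j))\<^sup>2" for i j
    by (simp add: trunc_def)
  then have "(hs L (\<lambda>i j. a i j - trunc N a i j))\<^sup>2 = (hs L a)\<^sup>2 - (hs L (trunc N a))\<^sup>2"
    unfolding hs_power2 by (simp only: sum_subtractf)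
  then show ?thesis by (simp only: hs_trunc[OF assms])
qed

lemma mm_kron_right: "j < L \<Longrightarrow> mm L a kron i j = a i j"
  by (simp add: mm_def kron_def if_distrib[of "\<lambda>x. _ * x"] cong: if_cong)

lemma mm_add_diff:
  "mm L a b i j - mm L c d i j = mm L (\<lambda>i j. a i j - c i j) b i j + mm L c (\<lambda>i j. b i j - d i j) i j"
  by (simp add: mm_def algebra_simps sum_subtractf sum.distrib)

text \<open>Telescoping: a^(k+1) - t^(k+1) = (a - t) a^k + t (a^k - t^k), where t is the truncation.
  The trace estimate starts at exponent two, since Hilbert-Schmidt norms bound the trace only of a
  product of two factors.\<close>

lemma mpow_difference_bounds:
  assumes NL: "N \<le> L" and B: "hs L a \<le> B"
    and e: "hs L (\<lambda>i j. a i j - trunc N a i j) \<le> e"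
  defines "D \<equiv> \<lambda>k i j. mpow L a k i j - mpow L (trunc N a) k i j"
  shows "hs L (D (Suc k)) \<le> real (Suc k) * B ^ k * e"
    and "cmod (tr N (D (Suc (Suc k)))) \<le> real (Suc (Suc k)) * B ^ Suc k * e"
proof -
  let ?t = "trunc N a" and ?d = "\<lambda>i j. a i j - trunc N a i j"
  have B0: "0 \<le> B" using B hs_nonneg[of L a] by linarith
  have e0: "0 \<le> e" using e hs_nonneg[of L ?d] by linarith
  have tB: "hs L ?t \<le> B" using hs_trunc[OF NL, of a] hs_mono[OF NL, of a] B by linarith
  have aB: "hs L (mpow L a (Suc k)) \<le> B ^ Suc k" for k
    using hs_mpow[of L a k] power_mono[OF B, of "Suc k"] by simp
  have DS: "D (Suc k) i j = mm L ?d (mpow L a k) i j + mm L ?t (D k) i j" for k i j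
    unfolding D_def mpow.simps by (rule mm_add_diff)
  have h: "hs L (D (Suc k)) \<le> real (Suc k) * B ^ k * e" for k
  proof (induction k)
    case 0
    have "hs L (D (Suc 0)) = hs L ?d"
      by (rule hs_cong) (simp add: D_def mm_kron_right)
    then show ?case using e by simp
  next
    case (Suc k)
    have "hs L (D (Suc (Suc k))) \<le> hs L (mm L ?d (mpow L a (Suc k))) + hs L (mm L ?t (D (Suc k)))"
      unfolding DS[abs_def] by (rule hs_add)
    also have "\<dots> \<le> hs L ?d * hs L (mpow L a (Suc k)) + hs L ?t * hs L (D (Suc k))"
      by (intro add_mono hs_mm)
    also have "\<dots> \<le> e * B ^ Suc k + B * (real (Suc k) * B ^ k * e)"
      using e tB aB Suc B0 e0 by (intro add_mono mult_mono) auto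
    finally show ?case by (simp add: algebra_simps)
  qed
  then show "hs L (D (Suc k)) \<le> real (Suc k) * B ^ k * e" .
  have "cmod (tr N (D (Suc (Suc k)))) \<le> cmod (tr N (mm L ?d (mpow L a (Suc k)))) + cmod (tr N (mm L ?t (D (Suc k))))"
    unfolding DS[abs_def] tr_add by (rule norm_triangle_ineq)
  also have "\<dots> \<le> hs L ?d * hs L (mpow L a (Suc k)) + hs L ?t * hs L (D (Suc k))"
    by (intro add_mono tr_mm_bound NL)
  also have "\<dots> \<le> e * B ^ Suc k + B * (real (Suc k) * B ^ k * e)"
    using e tB aB h[of k] B0 e0 by (intro add_mono mult_mono) auto
  finally show "cmod (tr N (D (Suc (Suc k)))) \<le> real (Suc (Suc k)) * B ^ Suc k * e"
    by (simp add: algebra_simps)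
qed

text \<open>For k \<le> r, the coefficient of z^(k+2) in (1 - z) times the partial sum of exp z of
  degree r + 1. At k = r only the product with -z contributes, hence the case distinction.\<close>

definition dcoef :: "nat \<Rightarrow> nat \<Rightarrow> complex" where
  "dcoef r k = (if k < r then 1 / fact (Suc (Suc k)) else 0) - 1 / fact (Suc k)"

lemma norm_dcoef_le: "cmod (dcoef r k) \<le> 1 / fact (Suc k)"
proof -
  have "dcoef r k = complex_of_real ((if k < r then 1 / fact (Suc (Suc k)) else 0) - 1 / fact (Suc k))"
    by (simp add: dcoef_def)
  moreover have "(1::real) / fact (Suc (Suc k)) \<le> 1 / fact (Suc k)"
    by (intro divide_left_mono fact_mono) auto
  ultimately show ?thesis by (simp only: norm_of_real) (auto simp del: fact_Suc)
qed

text \<open>The Taylor coefficients of \<open>(1 - z) exp z\<close>, whose linear term vanishes.\<close>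

lemma dcoef_sum:
  fixes p :: "nat \<Rightarrow> complex"
  shows "(\<Sum>k<Suc (Suc r). (p k - p (Suc k)) / fact k) = p 0 + (\<Sum>k<Suc r. dcoef r k * p (Suc (Suc k)))"
proof -
  have "(\<Sum>k<Suc (Suc r). (p k - p (Suc k)) / fact k)
      = (\<Sum>k<Suc (Suc r). p k / fact k) - (\<Sum>k<Suc (Suc r). p (Suc k) / fact k)"
    by (simp add: diff_divide_distrib sum_subtractf)
  also have "(\<Sum>k<Suc (Suc r). p k / fact k) = p 0 + p 1 + (\<Sum>k<r. p (Suc (Suc k)) / fact (Suc (Suc k)))"
    by (simp only: sum.lessThan_Suc_shift) simp
  also have "(\<Sum>k<Suc (Suc r). p (Suc k) / fact k) = p 1 + (\<Sum>k<Suc r. p (Suc (Suc k)) / fact (Suc k))"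
    by (simp only: sum.lessThan_Suc_shift) simp
  also have "(\<Sum>k<r. p (Suc (Suc k)) / fact (Suc (Suc k)))
      = (\<Sum>k<Suc r. (if k < r then 1 / fact (Suc (Suc k)) else 0) * p (Suc (Suc k)))"
    by simp
  finally show ?thesis by (simp add: dcoef_def left_diff_distrib sum_subtractf del: sum.lessThan_Suc fact_Suc)
qed

lemma exp_partial_sum_le:
  fixes x :: real
  assumes "0 \<le> x"
  shows "(\<Sum>k<m. x ^ Suc k / fact (Suc k)) \<le> exp x"
proof -
  have "(\<Sum>k<Suc m. x ^ k / fact k) \<le> (\<Sum>k. x ^ k / fact k)"
    using assms summable_exp[of x] by (intro sum_le_suminf) (auto simp: divide_inverse mult.commute)
  also have "\<dots> = exp x" by (simp add: exp_def divide_inverse mult.commute)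
  finally show ?thesis unfolding sum.lessThan_Suc_shift by simp
qed

text \<open>For an operator A, \<open>P k\<close> is the matrix of its power A^k and
  \<open>C\<close> that of (I - A) exp A. The partial sum of order \<open>r\<close> formed in size
  \<open>L\<close> differs on the \<open>N\<close>-corner from the one formed in size
  \<open>N\<close> by an amount that is small uniformly in \<open>L\<close> and \<open>r\<close>, in
  trace and in Hilbert-Schmidt norm. Letting first \<open>L\<close> and then \<open>r\<close> tend
  to infinity turns the determinant of the former into that of the section of \<open>C\<close>, and
  that of the latter into \<open>det2 N a\<close>.\<close>

lemma det_exp_sections:
  assumes B: "\<And>N. hs N a \<le> B"
    and P: "\<And>k i j. (\<lambda>L. mpow L a k i j) \<longlonglongrightarrow> P k i j"
    and C: "\<And>i j. (\<lambda>n. \<Sum>k<n. (P k i j - P (Suc k) i j) / fact k) \<longlonglongrightarrow> C i j"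
  shows "(\<lambda>N. Determinant.det (sec N C) - det2 N a) \<longlonglongrightarrow> 0"
proof -
  have B0: "0 \<le> B" using B[of 0] hs_nonneg[of 0 a] by linarith
  define yy where "yy = (\<lambda>L r i j. \<Sum>k<Suc r. dcoef r k * mpow L a (Suc (Suc k)) i j)"
  define yP where "yP = (\<lambda>r i j. \<Sum>k<Suc r. dcoef r k * P (Suc (Suc k)) i j)"
  define s where "s = (\<lambda>N. (hs N a)\<^sup>2)"
  have "incseq s" unfolding s_def by (intro incseq_SucI power_mono hs_mono) auto
  moreover have sB: "s N \<le> B\<^sup>2" for N unfolding s_def by (intro power_mono B) auto
  ultimately obtain S where S: "s \<longlonglongrightarrow> S" and sS: "\<And>N. s N \<le> S"
    using incseq_convergent[of s "B\<^sup>2"] by blast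
  \<comment> \<open>The Hilbert-Schmidt norm of what lies outside the \<open>N\<close>-corner, in
    the limit of large sections.\<close>
  define e where "e = (\<lambda>N. sqrt (S - s N))"
  have "e \<longlonglongrightarrow> sqrt (S - S)" unfolding e_def by (intro tendsto_intros S)
  then have e_lim: "e \<longlonglongrightarrow> 0" by simp
  have e0: "e N \<ge> 0" for N by (simp add: e_def sS)
  have eL: "hs L (\<lambda>i j. a i j - trunc N a i j) \<le> e N" if "N \<le> L" for N L
    unfolding e_def by (rule real_le_rsqrt) (use sS[of L] hs_diff_trunc[OF that, of a] in \<open>simp add: s_def\<close>)
  \<comment> \<open>Absorbs the factor \<open>k + 2\<close> of \<open>mpow_difference_bounds\<close>
    into the series for \<open>exp (2 * B)\<close>.\<close>
  have two: "real (Suc (Suc k)) \<le> 2 ^ Suc k" for k by (induction k) auto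
  have yN: "yy N r i j = (\<Sum>k<Suc r. dcoef r k * mpow L (trunc N a) (Suc (Suc k)) i j)"
    if "i < N" "j < N" "N \<le> L" for N L r i j
    unfolding yy_def using mpow_trunc[OF that(3) that(1,2), of a] by (simp del: mpow.simps)
  have dy: "yy L r i j - yy N r i j = (\<Sum>k<Suc r. dcoef r k * (mpow L a (Suc (Suc k)) i j - mpow L (trunc N a) (Suc (Suc k)) i j))"
    if "i < N" "j < N" "N \<le> L" for N L r i j
    unfolding yN[OF that] by (simp add: yy_def right_diff_distrib sum_subtractf del: mpow.simps sum.lessThan_Suc)
  have est: "(\<Sum>k<Suc r. cmod (dcoef r k) * (real (Suc (Suc k)) * B ^ Suc k * e N)) \<le> e N * exp (2 * B)" for r N
  proof -
    have "(\<Sum>k<Suc r. cmod (dcoef r k) * (real (Suc (Suc k)) * B ^ Suc k * e N))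
        \<le> (\<Sum>k<Suc r. 1 / fact (Suc k) * (2 ^ Suc k * B ^ Suc k * e N))"
      using norm_dcoef_le two B0 e0 by (intro sum_mono mult_mono) auto
    also have "\<dots> = e N * (\<Sum>k<Suc r. (2 * B) ^ Suc k / fact (Suc k))"
      unfolding sum_distrib_left by (intro sum.cong refl) (simp add: power_mult_distrib del: fact_Suc)
    also have "\<dots> \<le> e N * exp (2 * B)" using B0 e0 by (intro mult_left_mono exp_partial_sum_le) auto
    finally show ?thesis .
  qed
  have dy_hs: "hs N (\<lambda>i j. yy L r i j - yy N r i j) \<le> e N * exp (2 * B)" if NL: "N \<le> L" for N L r
  proof -
    have "hs N (\<lambda>i j. yy L r i j - yy N r i j) = hs N (\<lambda>i j. \<Sum>k<Suc r. dcoef r k * (mpow L a (Suc (Suc k)) i j - mpow L (trunc N a) (Suc (Suc k)) i j))"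
      by (rule hs_cong) (simp add: dy NL del: mpow.simps sum.lessThan_Suc)
    also have "\<dots> \<le> (\<Sum>k<Suc r. cmod (dcoef r k) * hs N (\<lambda>i j. mpow L a (Suc (Suc k)) i j - mpow L (trunc N a) (Suc (Suc k)) i j))"
      by (rule order.trans[OF hs_sum]) (simp add: hs_scale del: mpow.simps sum.lessThan_Suc)
    also have "\<dots> \<le> (\<Sum>k<Suc r. cmod (dcoef r k) * (real (Suc (Suc k)) * B ^ Suc k * e N))"
      by (intro sum_mono mult_left_mono order.trans[OF hs_mono[OF NL]] mpow_difference_bounds(1)[OF NL B eL[OF NL]]) auto
    also have "\<dots> \<le> e N * exp (2 * B)" by (rule est)
    finally show ?thesis .
  qed
  have dy_tr: "cmod (tr N (\<lambda>i j. yy L r i j - yy N r i j)) \<le> e N * exp (2 * B)" if NL: "N \<le> L" for N L r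
  proof -
    have "tr N (\<lambda>i j. yy L r i j - yy N r i j) = (\<Sum>i<N. \<Sum>k<Suc r. dcoef r k * (mpow L a (Suc (Suc k)) i i - mpow L (trunc N a) (Suc (Suc k)) i i))"
      unfolding tr_def by (intro sum.cong refl) (simp add: dy NL del: mpow.simps sum.lessThan_Suc)
    also have "\<dots> = (\<Sum>k<Suc r. dcoef r k * tr N (\<lambda>i j. mpow L a (Suc (Suc k)) i j - mpow L (trunc N a) (Suc (Suc k)) i j))"
      unfolding tr_def sum_distrib_left by (rule sum.swap)
    finally have "cmod (tr N (\<lambda>i j. yy L r i j - yy N r i j))
       \<le> (\<Sum>k<Suc r. cmod (dcoef r k) * cmod (tr N (\<lambda>i j. mpow L a (Suc (Suc k)) i j - mpow L (trunc N a) (Suc (Suc k)) i j)))"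
      by (simp add: norm_mult[symmetric] sum_norm_le del: mpow.simps sum.lessThan_Suc)
    also have "\<dots> \<le> (\<Sum>k<Suc r. cmod (dcoef r k) * (real (Suc (Suc k)) * B ^ Suc k * e N))"
      by (intro sum_mono mult_left_mono mpow_difference_bounds(2)[OF NL B eL[OF NL]]) auto
    also have "\<dots> \<le> e N * exp (2 * B)" by (rule est)
    finally show ?thesis .
  qed
  have est2: "(\<Sum>k<Suc r. cmod (dcoef r k) * (B * B ^ Suc k)) \<le> B * exp B" for r
  proof -
    have "(\<Sum>k<Suc r. cmod (dcoef r k) * (B * B ^ Suc k)) \<le> (\<Sum>k<Suc r. 1 / fact (Suc k) * (B * B ^ Suc k))"
      using norm_dcoef_le B0 by (intro sum_mono mult_right_mono) auto
    also have "\<dots> = B * (\<Sum>k<Suc r. B ^ Suc k / fact (Suc k))"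
      unfolding sum_distrib_left by (intro sum.cong refl) simp
    also have "\<dots> \<le> B * exp B" using B0 by (intro mult_left_mono exp_partial_sum_le) auto
    finally show ?thesis .
  qed
  have hsp: "hs N (mpow N a (Suc k)) \<le> B ^ Suc k" for N k
    using hs_mpow[of N a k] power_mono[OF B, of N "Suc k"] by simp
  have y_hs: "hs N (yy N r) \<le> B * exp B" for N r
  proof -
    have "hs N (yy N r) \<le> (\<Sum>k<Suc r. cmod (dcoef r k) * hs N (mpow N a (Suc (Suc k))))"
      unfolding yy_def by (rule order.trans[OF hs_sum]) (simp add: hs_scale del: mpow.simps sum.lessThan_Suc)
    also have "\<dots> \<le> (\<Sum>k<Suc r. cmod (dcoef r k) * (B * B ^ Suc k))"
      by (intro sum_mono mult_left_mono) (use hsp[of N "Suc _"] in \<open>simp_all del: mpow.simps\<close>)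
    also note est2
    finally show ?thesis .
  qed
  have y_tr: "cmod (tr N (yy N r)) \<le> B * exp B" for N r
  proof -
    have "tr N (yy N r) = (\<Sum>k<Suc r. dcoef r k * tr N (mpow N a (Suc (Suc k))))"
      unfolding tr_def yy_def sum_distrib_left by (rule sum.swap)
    then have "cmod (tr N (yy N r)) \<le> (\<Sum>k<Suc r. cmod (dcoef r k) * cmod (tr N (mpow N a (Suc (Suc k)))))"
      by (simp add: norm_mult[symmetric] sum_norm_le del: mpow.simps sum.lessThan_Suc)
    also have "\<dots> \<le> (\<Sum>k<Suc r. cmod (dcoef r k) * (B * B ^ Suc k))"
    proof (intro sum_mono mult_left_mono)
      fix k
      have "cmod (tr N (mpow N a (Suc (Suc k)))) \<le> hs N a * hs N (mpow N a (Suc k))"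
        unfolding mpow.simps(2)[of N a "Suc k"] by (rule tr_mm_bound) simp
      also have "\<dots> \<le> B * B ^ Suc k" using B hsp B0 by (intro mult_mono) auto
      finally show "cmod (tr N (mpow N a (Suc (Suc k)))) \<le> B * B ^ Suc k" .
    qed auto
    also note est2
    finally show ?thesis .
  qed
  define K where "K = 2 * exp (B * exp B + 1 + (B * exp B + 1)\<^sup>2 / 2)"
  have K: "K > 0" by (simp add: K_def)
  have main: "cmod (Determinant.det (sec N C) - det2 N a) \<le> K * d"
    if d: "0 < d" "d \<le> 1/2" "e N * exp (2 * B) \<le> d" for N d
  proof -
    have 1: "cmod (det_I_plus N (yy L r) - det_I_plus N (yy N r)) \<le> K * d" if "N \<le> L" for L r
    proof -
      have "cmod (det_I_plus N (yy L r) - det_I_plus N (yy N r))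
          \<le> 2 * exp (cmod (tr N (yy N r)) + 1 + (hs N (yy N r) + 1)\<^sup>2 / 2) * d"
        using dy_hs[OF that, of r] dy_tr[OF that, of r] d by (intro det_I_plus_lipschitz) linarith+
      also have "\<dots> \<le> K * d"
        unfolding K_def using y_tr[of N r] y_hs[of N r] d
        by (intro mult_right_mono mult_left_mono) (auto intro!: add_mono divide_right_mono power_mono)
      finally show ?thesis .
    qed
    have 2: "(\<lambda>L. det_I_plus N (yy L r)) \<longlonglongrightarrow> det_I_plus N (yP r)" for r
      unfolding det_I_plus_def yy_def yP_def by (intro tendsto_det_sec tendsto_intros P)
    \<comment> \<open>The limit in \<open>L\<close> at fixed \<open>r\<close>. The limit in
      \<open>r\<close> is taken at the end of this block, with the same bound.\<close>
    have 3: "cmod (det_I_plus N (yP r) - det_I_plus N (yy N r)) \<le> K * d" for r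
      by (rule tendsto_upperbound[OF tendsto_norm[OF tendsto_diff[OF 2 tendsto_const]]])
         (use 1 in \<open>auto simp: eventually_sequentially\<close>)
    have P0: "P 0 i j = kron i j" for i j
      using P[of 0 i j] by (simp add: LIMSEQ_const_iff)
    have yPC: "kron i j + yP r i j = (\<Sum>k<Suc (Suc r). (P k i j - P (Suc k) i j) / fact k)" for i j r
      unfolding dcoef_sum[of "\<lambda>k. P k i j"] by (simp add: P0 yP_def)
    have 4: "(\<lambda>r. det_I_plus N (yP r)) \<longlonglongrightarrow> Determinant.det (sec N C)"
      unfolding det_I_plus_def yPC
      by (intro tendsto_det_sec LIMSEQ_Suc[OF LIMSEQ_Suc[OF C]])
    \<comment> \<open>Formed in size \<open>N\<close> itself, the sum is an honest product of
      matrices, so its determinant factors.\<close>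
    have 5: "det_I_plus N (yy N r) = det_I_plus N (\<lambda>i j. - a i j) *
        Determinant.det (sec N (\<lambda>i j. \<Sum>k<Suc (Suc r). mpow N a k i j / fact k))" for r
    proof -
      let ?E = "\<lambda>i j. \<Sum>k<Suc (Suc r). mpow N a k i j / fact k"
      have "kron i j + yy N r i j = mm N (\<lambda>i j. kron i j + - a i j) ?E i j" if "i < N" "j < N" for i j
      proof -
        have "mm N (\<lambda>i j. kron i j + - a i j) ?E i j = ?E i j - mm N a ?E i j"
          using that by (simp add: mm_def left_diff_distrib sum_subtractf kron_def
              if_distrib[of "\<lambda>x. x * _"] del: sum.lessThan_Suc cong: if_cong)
        also have "mm N a ?E i j = (\<Sum>k<Suc (Suc r). mpow N a (Suc k) i j / fact k)"
        proof -
          have "mm N a ?E i j = (\<Sum>l<N. \<Sum>k<Suc (Suc r). a i l * mpow N a k l j / fact k)"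
            by (simp add: mm_def sum_distrib_left del: sum.lessThan_Suc)
          also have "\<dots> = (\<Sum>k<Suc (Suc r). \<Sum>l<N. a i l * mpow N a k l j / fact k)" by (rule sum.swap)
          finally show ?thesis by (simp add: mm_def sum_divide_distrib del: sum.lessThan_Suc)
        qed
        also have "?E i j - (\<Sum>k<Suc (Suc r). mpow N a (Suc k) i j / fact k)
           = (\<Sum>k<Suc (Suc r). (mpow N a k i j - mpow N a (Suc k) i j) / fact k)"
          by (simp add: diff_divide_distrib sum_subtractf del: sum.lessThan_Suc mpow.simps)
        also have "\<dots> = kron i j + yy N r i j"
          unfolding dcoef_sum[of "\<lambda>k. mpow N a k i j"] by (simp only: yy_def mpow.simps(1))
        finally show ?thesis ..
      qed
      then have "sec N (\<lambda>i j. kron i j + yy N r i j) = sec N (\<lambda>i j. kron i j + - a i j) * sec N ?E"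
        unfolding sec_mm[symmetric] by (intro sec_cong) simp
      then show ?thesis by (simp only: det_I_plus_def det_mult[OF sec_carrier sec_carrier])
    qed
    have 6: "(\<lambda>r. det_I_plus N (yy N r)) \<longlonglongrightarrow> det2 N a"
      unfolding 5 det2_def by (intro tendsto_mult tendsto_const LIMSEQ_Suc[OF LIMSEQ_Suc[OF det_exp_partial_sums]])
    show ?thesis
      by (rule tendsto_upperbound[OF tendsto_norm[OF tendsto_diff[OF 4 6]]]) (use 3 in auto)
  qed
  show ?thesis
  proof (rule LIMSEQ_I)
    fix \<epsilon> :: real assume \<epsilon>: "0 < \<epsilon>"
    define d where "d = min (1/2) (\<epsilon> / (2 * K))"
    have d: "0 < d" "d \<le> 1/2" using \<epsilon> K by (auto simp: d_def)
    have "K * d \<le> K * (\<epsilon> / (2 * K))" using K by (intro mult_left_mono) (auto simp: d_def)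
    then have Kd: "K * d < \<epsilon>" using K \<epsilon> by simp
    have "(\<lambda>N. e N * exp (2 * B)) \<longlonglongrightarrow> 0 * exp (2 * B)" by (intro tendsto_intros e_lim)
    then have "eventually (\<lambda>N. e N * exp (2 * B) < d) sequentially"
      using d(1) by (intro order_tendstoD(2)) auto
    then obtain N0 where "\<And>N. N \<ge> N0 \<Longrightarrow> e N * exp (2 * B) < d" by (auto simp: eventually_sequentially)
    then have "cmod (Determinant.det (sec N C) - det2 N a) < \<epsilon>" if "N \<ge> N0" for N
      using le_less_trans[OF main[OF d, of N] Kd] that by (simp add: less_imp_le)
    then show "\<exists>N0. \<forall>N\<ge>N0. norm (Determinant.det (sec N C) - det2 N a - 0) < \<epsilon>" by auto
  qed
qed

lemma hs_rank_one: "hs N (\<lambda>i j. v i * w j) = L2_set (\<lambda>i. cmod (v i)) {..<N} * L2_set (\<lambda>i. cmod (w i)) {..<N}"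
proof -
  have "(hs N (\<lambda>i j. v i * w j))\<^sup>2 = (L2_set (\<lambda>i. cmod (v i)) {..<N} * L2_set (\<lambda>i. cmod (w i)) {..<N})\<^sup>2"
    unfolding hs_power2 L2_set_def power_mult_distrib
    by (simp add: norm_mult power_mult_distrib sum_nonneg sum_product)
  then show ?thesis by (rule power2_eq_imp_eq) auto
qed

section \<open>Finite rank perturbations of sections\<close>

text \<open>With b = a + VR - aVR one has I - b = (I - a)(I - VR) exactly, and this determinant
  splits by \<open>det_I_plus_mm\<close> and \<open>det_I_plus_sylvester\<close>. In a section,
  \<open>V\<close> solves (I - a) V = W only up to a residual; a + WR therefore differs from b by a
  matrix tending to zero in Hilbert-Schmidt norm, and \<open>det2_lipschitz\<close> bridges the
  gap.\<close>

lemma det2_rank_perturbation: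
  assumes bound: "\<And>N. hs N (\<lambda>i j. a i j + (\<Sum>q<c. W q i * R q j)) \<le> B"
    and r: "\<And>q. q < c \<Longrightarrow> (\<lambda>N. \<Sum>i<N. (cmod (W q i - V q i + (\<Sum>l<N. a i l * V q l)))\<^sup>2) \<longlonglongrightarrow> 0"
    and R: "\<And>q N. q < c \<Longrightarrow> (\<Sum>i<N. (cmod (R q i))\<^sup>2) \<le> \<rho>"
    and D: "(\<lambda>N. det2 N a) \<longlonglongrightarrow> D"
    and E: "\<And>p q. p < c \<Longrightarrow> q < c \<Longrightarrow> (\<lambda>N. \<Sum>i<N. R p i * V q i) \<longlonglongrightarrow> E p q"
    and \<tau>: "(\<lambda>N. \<Sum>i<N. \<Sum>q<c. W q i * R q i) \<longlonglongrightarrow> \<tau>"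
  shows "(\<lambda>N. det2 N (\<lambda>i j. a i j + (\<Sum>q<c. W q i * R q j))) \<longlonglongrightarrow> D * det_I_plus c (\<lambda>p q. - E p q) * exp \<tau>"
proof -
  define WR where "WR = (\<lambda>i j. \<Sum>q<c. W q i * R q j)"
  define VR where "VR = (\<lambda>i j. \<Sum>q<c. V q i * R q j)"
  define rr where "rr = (\<lambda>N q i. W q i - V q i + (\<Sum>l<N. a i l * V q l))"
  define rR where "rR = (\<lambda>N i j. \<Sum>q<c. rr N q i * R q j)"
  define b where "b = (\<lambda>N i j. a i j + VR i j - mm N a VR i j)"
  have WRb: "a i j + WR i j = b N i j + rR N i j" for N i j
  proof -
    have "rR N i j = WR i j - VR i j + (\<Sum>q<c. \<Sum>l<N. a i l * V q l * R q j)"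
      by (simp add: rR_def rr_def WR_def VR_def algebra_simps sum.distrib sum_subtractf sum_distrib_right sum_distrib_left)
    also have "(\<Sum>q<c. \<Sum>l<N. a i l * V q l * R q j) = mm N a VR i j"
      unfolding mm_def VR_def sum_distrib_left by (subst sum.swap) (simp add: mult_ac)
    finally show ?thesis by (simp add: b_def)
  qed
  \<comment> \<open>One null sequence that bounds both the Hilbert-Schmidt norm and the trace of
    \<open>rR N\<close>.\<close>
  define \<sigma> where "\<sigma> = (\<lambda>N. \<Sum>q<c. L2_set (\<lambda>i. cmod (rr N q i)) {..<N} * sqrt \<rho>)"
  have "\<sigma> \<longlonglongrightarrow> (\<Sum>q<c. sqrt 0 * sqrt \<rho>)"
    unfolding \<sigma>_def L2_set_def rr_def by (intro tendsto_intros r) auto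
  then have \<sigma>: "\<sigma> \<longlonglongrightarrow> 0" by simp
  have Rl: "L2_set (\<lambda>i. cmod (R q i)) {..<N} \<le> sqrt \<rho>" if "q < c" for q N
    unfolding L2_set_def by (intro real_sqrt_le_mono R that)
  have hr: "hs N (rR N) \<le> \<sigma> N" for N
    unfolding rR_def \<sigma>_def using Rl
    by (intro order.trans[OF hs_sum] sum_mono) (auto simp: hs_rank_one intro!: mult_left_mono)
  have tr_r: "cmod (tr N (rR N)) \<le> \<sigma> N" for N
  proof -
    have "tr N (rR N) = (\<Sum>q<c. \<Sum>i<N. rr N q i * R q i)" unfolding tr_def rR_def by (rule sum.swap)
    also have "cmod \<dots> \<le> (\<Sum>q<c. \<Sum>i<N. \<bar>cmod (rr N q i)\<bar> * \<bar>cmod (R q i)\<bar>)"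
      by (intro sum_norm_le) (auto simp: norm_mult)
    also have "\<dots> \<le> (\<Sum>q<c. L2_set (\<lambda>i. cmod (rr N q i)) {..<N} * L2_set (\<lambda>i. cmod (R q i)) {..<N})"
      by (intro sum_mono L2_set_mult_ineq)
    also have "\<dots> \<le> \<sigma> N" unfolding \<sigma>_def using Rl by (intro sum_mono mult_left_mono) auto
    finally show ?thesis .
  qed
  have "(\<lambda>N. tr N (rR N)) \<longlonglongrightarrow> 0"
    by (rule Lim_null_comparison[OF _ \<sigma>]) (use tr_r in auto)
  have det_b: "det2 N (b N) = det2 N a * det_I_plus c (\<lambda>p q. - (\<Sum>i<N. R p i * V q i))
     * exp (\<Sum>i<N. \<Sum>q<c. W q i * R q i) * exp (- tr N (rR N))" for N
  proof -
    have "tr N (b N) + tr N (rR N) = tr N a + tr N WR"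
      unfolding tr_add[symmetric] WRb[of _ _ N] ..
    \<comment> \<open>The first summand need not converge. It is merged with the determinant of I -
      a into \<open>det2 N a\<close>, whose limit is given.\<close>
    then have trb: "tr N (b N) = tr N a + tr N WR - tr N (rR N)" by (simp add: algebra_simps)
    have "det_I_plus N (\<lambda>i j. - b N i j) = det_I_plus N (\<lambda>i j. - a i j + - VR i j + mm N (\<lambda>i j. - a i j) (\<lambda>i j. - VR i j) i j)"
      by (simp add: b_def mm_def algebra_simps)
    also have "\<dots> = det_I_plus N (\<lambda>i j. - a i j) * det_I_plus N (\<lambda>i j. - VR i j)"
      by (rule det_I_plus_mm)
    also have "det_I_plus N (\<lambda>i j. - VR i j) = det_I_plus c (\<lambda>p q. - (\<Sum>i<N. R p i * V q i))"
      unfolding VR_def by (rule det_I_plus_sylvester)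
    finally have dI: "det_I_plus N (\<lambda>i j. - b N i j) =
        det_I_plus N (\<lambda>i j. - a i j) * det_I_plus c (\<lambda>p q. - (\<Sum>i<N. R p i * V q i))" .
    have "tr N WR = (\<Sum>i<N. \<Sum>q<c. W q i * R q i)" by (simp add: tr_def WR_def)
    then show ?thesis
      unfolding det2_def dI trb diff_conv_add_uminus exp_add by (simp only: mult_ac)
  qed
  have "(\<lambda>N. det2 N (b N)) \<longlonglongrightarrow> D * det_I_plus c (\<lambda>p q. - E p q) * exp \<tau> * exp (- 0)"
    unfolding det_b det_I_plus_def
    by (intro tendsto_mult tendsto_exp tendsto_minus D \<tau> tendsto_det_sec tendsto_add tendsto_const E) (assumption | fact)+
  moreover have "(\<lambda>N. det2 N (b N) - det2 N (\<lambda>i j. a i j + WR i j)) \<longlonglongrightarrow> 0"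
  proof (rule LIMSEQ_I)
    fix \<epsilon> :: real assume \<epsilon>: "0 < \<epsilon>"
    \<comment> \<open>The Lipschitz constant at the base point a + WR, made independent of
      \<open>N\<close> by \<open>bound\<close>.\<close>
    define K where "K = 2 * exp ((B + 1)\<^sup>2 / 2)"
    have K: "K > 0" by (simp add: K_def)
    define d where "d = min (1/2) (\<epsilon> / (2 * K))"
    have d: "0 < d" "d \<le> 1/2" using \<epsilon> K by (auto simp: d_def)
    have "K * d \<le> K * (\<epsilon> / (2 * K))" using K by (intro mult_left_mono) (auto simp: d_def)
    then have Kd: "K * d < \<epsilon>" using K \<epsilon> by simp
    have "eventually (\<lambda>N. \<sigma> N < d) sequentially"
      using d(1) \<sigma> by (intro order_tendstoD(2)) auto
    then obtain N0 where N0: "\<And>N. N \<ge> N0 \<Longrightarrow> \<sigma> N < d" by (auto simp: eventually_sequentially)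
    have "cmod (det2 N (b N) - det2 N (\<lambda>i j. a i j + WR i j)) < \<epsilon>" if "N \<ge> N0" for N
    proof -
      have "hs N (\<lambda>i j. b N i j - (a i j + WR i j)) = hs N (rR N)"
        by (rule hs_cong) (simp add: WRb[of _ _ N])
      then have "cmod (det2 N (b N) - det2 N (\<lambda>i j. a i j + WR i j)) \<le> 2 * exp ((hs N (\<lambda>i j. a i j + WR i j) + 1)\<^sup>2 / 2) * d"
        using hr[of N] N0[OF that] d by (intro det2_lipschitz) auto
      also have "\<dots> \<le> K * d"
        unfolding K_def using bound[of N] d
        by (intro mult_right_mono mult_left_mono) (auto simp: WR_def intro!: divide_right_mono power_mono)
      finally show ?thesis using Kd by simp
    qed
    then show "\<exists>N0. \<forall>N\<ge>N0. norm (det2 N (b N) - det2 N (\<lambda>i j. a i j + WR i j) - 0) < \<epsilon>" by auto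
  qed
  ultimately have "(\<lambda>N. det2 N (b N) - (det2 N (b N) - det2 N (\<lambda>i j. a i j + WR i j))) \<longlonglongrightarrow> D * det_I_plus c (\<lambda>p q. - E p q) * exp \<tau> * exp (- 0) - 0"
    by (intro tendsto_diff)
  then show ?thesis by (simp add: WR_def)
qed

section \<open>Square-integrable functions\<close>

definition cdot :: "complex^'m \<Rightarrow> complex^'m \<Rightarrow> complex" where
  "cdot u v = (\<Sum>i\<in>UNIV. u $ i * cnj (v $ i))"

lemma norm_smult_vec: "norm (c *s (v :: complex^'m)) = cmod c * norm v"
  by (simp add: norm_vec_def norm_mult L2_set_right_distrib)

lemma bounded_bilinear_smult_vec: "bounded_bilinear ((*s) :: complex \<Rightarrow> complex^'m \<Rightarrow> complex^'m)"
  by standard (auto simp: vec_eq_iff algebra_simps norm_smult_vec intro!: exI[of _ 1])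

lemma cdot_self: "cdot u u = complex_of_real ((norm u)\<^sup>2)"
  by (simp only: cdot_def complex_norm_square[symmetric] of_real_sum[symmetric] norm_vec_def L2_set_def)
     (simp add: sum_nonneg)

lemma norm_cdot_le: "cmod (cdot u v) \<le> norm u * norm v"
proof -
  have "cmod (cdot u v) \<le> (\<Sum>i\<in>UNIV. \<bar>cmod (u $ i)\<bar> * \<bar>cmod (v $ i)\<bar>)"
    unfolding cdot_def by (intro sum_norm_le) (simp add: norm_mult)
  also have "\<dots> \<le> norm u * norm v" unfolding norm_vec_def by (rule L2_set_mult_ineq)
  finally show ?thesis .
qed

lemma cdot_add_left: "cdot (u + v) w = cdot u w + cdot v w"
  by (simp add: cdot_def algebra_simps sum.distrib)

lemma cdot_smult_left: "cdot (c *s u) w = c * cdot u w"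
  by (simp add: cdot_def sum_distrib_left mult_ac)

lemma cdot_cnj: "cdot v u = cnj (cdot u v)"
  by (simp add: cdot_def mult.commute)

lemma measurable_smult_vec [measurable (raw)]:
  assumes "c \<in> borel_measurable M" "f \<in> borel_measurable M"
  shows "(\<lambda>x. c x *s (f x :: complex^'m)) \<in> borel_measurable M"
proof (rule borel_measurable_continuous_Pair[OF assms])
  show "continuous_on UNIV (\<lambda>p. fst p *s (snd p :: complex^'m))"
    by (intro bounded_bilinear.continuous_on[OF bounded_bilinear_smult_vec] continuous_intros)
qed

lemma measurable_vec_nth [measurable (raw)]:
  assumes "f \<in> borel_measurable M"
  shows "(\<lambda>x. (f x :: 'a::real_normed_vector^'m) $ i) \<in> borel_measurable M"
  using borel_measurable_continuous_on[OF _ assms, of "\<lambda>v. v $ i"]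
  by (auto intro: linear_continuous_on bounded_linear_vec_nth)

lemma measurable_cnj [measurable (raw)]:
  "f \<in> borel_measurable M \<Longrightarrow> (\<lambda>x. cnj (f x)) \<in> borel_measurable M"
  by (rule borel_measurable_continuous_on) (intro continuous_intros)

lemma measurable_cdot [measurable (raw)]:
  "f \<in> borel_measurable M \<Longrightarrow> g \<in> borel_measurable M \<Longrightarrow> (\<lambda>x. cdot (f x) (g x)) \<in> borel_measurable M"
  unfolding cdot_def by (intro borel_measurable_sum borel_measurable_times measurable_cnj measurable_vec_nth)

lemma L2_inner_cdot: "L2_inner M f g = (LINT x|M. cdot (f x) (g x))"
  by (simp add: L2_inner_def cdot_def)

lemma L2_measurable: "f \<in> L2 M \<Longrightarrow> f \<in> borel_measurable M"
  by (simp add: L2_def)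

lemma L2_integrable_power2: "f \<in> L2 M \<Longrightarrow> integrable M (\<lambda>x. (norm (f x))\<^sup>2)"
  by (simp add: L2_def)

lemma L2_norm_nonneg [simp]: "0 \<le> L2_norm M f"
  by (simp add: L2_norm_def)

lemma L2_norm_power2: "(L2_norm M f)\<^sup>2 = (LINT x|M. (norm (f x))\<^sup>2)"
  by (simp add: L2_norm_def)

lemma L2_dominated:
  assumes g: "g \<in> L2 M" and f: "f \<in> borel_measurable M" and le: "AE x in M. norm (f x) \<le> norm (g x)"
  shows "f \<in> L2 M" "L2_norm M f \<le> L2_norm M g"
proof -
  have i: "integrable M (\<lambda>x. (norm (f x))\<^sup>2)"
    by (rule Bochner_Integration.integrable_bound[OF L2_integrable_power2[OF g]])
       (use f le in \<open>auto intro!: power_mono borel_measurable_power borel_measurable_norm\<close>)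
  then show "f \<in> L2 M" using f by (simp add: L2_def)
  have "(LINT x|M. (norm (f x))\<^sup>2) \<le> (LINT x|M. (norm (g x))\<^sup>2)"
    using le by (intro integral_mono_AE i L2_integrable_power2[OF g]) (auto intro: power_mono)
  then show "L2_norm M f \<le> L2_norm M g" unfolding L2_norm_def by (rule real_sqrt_le_mono)
qed

lemma L2_norm_cong_AE:
  assumes "AE x in M. norm (f x) = norm (g x)" "f \<in> borel_measurable M" "g \<in> borel_measurable M"
  shows "L2_norm M f = L2_norm M g"
  unfolding L2_norm_def using assms
  by (intro arg_cong[where f = sqrt] integral_cong_AE) (auto intro!: borel_measurable_power borel_measurable_norm)

lemma L2_mult_integrable:
  assumes "f \<in> L2 M" "g \<in> L2 M"
  shows "integrable M (\<lambda>x. norm (f x) * norm (g x))"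
proof (rule Bochner_Integration.integrable_bound)
  show "integrable M (\<lambda>x. (norm (f x))\<^sup>2 + (norm (g x))\<^sup>2)"
    using assms by (intro Bochner_Integration.integrable_add L2_integrable_power2)
  have "norm (f x) * norm (g x) \<le> (norm (f x))\<^sup>2 + (norm (g x))\<^sup>2" for x
    using sum_squares_bound[of "norm (f x)" "norm (g x)"] mult_nonneg_nonneg[OF norm_ge_zero[of "f x"] norm_ge_zero[of "g x"]]
    by linarith
  then show "AE x in M. norm (norm (f x) * norm (g x)) \<le> norm ((norm (f x))\<^sup>2 + (norm (g x))\<^sup>2)" by simp
qed (use L2_measurable[OF assms(1)] L2_measurable[OF assms(2)] in auto)

lemma L2_norm_zero_AE:
  assumes f: "f \<in> L2 M" and z: "L2_norm M f = 0"
  shows "AE x in M. f x = 0"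
proof -
  have "(LINT x|M. (norm (f x))\<^sup>2) = 0" using z by (simp add: L2_norm_def)
  then show ?thesis by (subst (asm) integral_nonneg_eq_0_iff_AE[OF L2_integrable_power2[OF f]]) auto
qed

lemma L2_Cauchy_Schwarz:
  assumes f: "f \<in> L2 M" and g: "g \<in> L2 M"
  shows "(LINT x|M. norm (f x) * norm (g x)) \<le> L2_norm M f * L2_norm M g"
proof (cases "L2_norm M f = 0 \<or> L2_norm M g = 0")
  case True
  then have "AE x in M. norm (f x) * norm (g x) = 0"
    using L2_norm_zero_AE[OF f] L2_norm_zero_AE[OF g] by (auto elim: eventually_mono)
  then have "(LINT x|M. norm (f x) * norm (g x)) = 0" by (rule integral_eq_zero_AE)
  then show ?thesis by simp
next
  case False
  define A where "A = L2_norm M f"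
  define B where "B = L2_norm M g"
  have AB: "A > 0" "B > 0" using False L2_norm_nonneg[of M f] L2_norm_nonneg[of M g] by (auto simp: A_def B_def less_le)
  \<comment> \<open>The weight that balances the two terms of the weighted arithmetic-geometric
    inequality: after integration both equal \<open>A * B\<close>.\<close>
  define t where "t = B / A"
  have t: "t > 0" using AB by (simp add: t_def)
  have "norm (f x) * norm (g x) \<le> (t * (norm (f x))\<^sup>2 + (norm (g x))\<^sup>2 / t) / 2" for x
  proof -
    have "0 \<le> (t * norm (f x) - norm (g x))\<^sup>2 / t" using t by simp
    also have "\<dots> = t * (norm (f x))\<^sup>2 + (norm (g x))\<^sup>2 / t - 2 * (norm (f x) * norm (g x))"
      using t by (simp add: field_simps power2_eq_square)
    finally show ?thesis by simp
  qed
  then have "(LINT x|M. norm (f x) * norm (g x)) \<le> (LINT x|M. (t * (norm (f x))\<^sup>2 + (norm (g x))\<^sup>2 / t) / 2)"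
    using L2_integrable_power2[OF f] L2_integrable_power2[OF g]
    by (intro integral_mono L2_mult_integrable f g) auto
  also have "\<dots> = (t * A\<^sup>2 + B\<^sup>2 / t) / 2"
    using L2_integrable_power2[OF f] L2_integrable_power2[OF g] by (simp add: A_def B_def L2_norm_power2)
  also have "\<dots> = A * B" using AB by (simp add: t_def power2_eq_square)
  finally show ?thesis by (simp add: A_def B_def)
qed

lemma L2_add:
  fixes f g :: "real \<Rightarrow> 'a::{real_normed_vector, second_countable_topology}"
  assumes f: "f \<in> L2 M" and g: "g \<in> L2 M"
  shows "(\<lambda>x. f x + g x) \<in> L2 M" "L2_norm M (\<lambda>x. f x + g x) \<le> L2_norm M f + L2_norm M g"
proof -
  note [measurable] = L2_measurable[OF f] L2_measurable[OF g]
  note i = L2_integrable_power2[OF f] L2_integrable_power2[OF g] L2_mult_integrable[OF f g]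
  have le: "(norm (f x + g x))\<^sup>2 \<le> (norm (f x))\<^sup>2 + (norm (g x))\<^sup>2 + 2 * (norm (f x) * norm (g x))" for x
    using power_mono[OF norm_triangle_ineq[of "f x" "g x"], of 2] by (simp add: power2_sum)
  have iF: "integrable M (\<lambda>x. (norm (f x))\<^sup>2 + (norm (g x))\<^sup>2 + 2 * (norm (f x) * norm (g x)))"
    using i by auto
  have int: "integrable M (\<lambda>x. (norm (f x + g x))\<^sup>2)"
    by (rule Bochner_Integration.integrable_bound[OF iF]) (use le in auto)
  then show "(\<lambda>x. f x + g x) \<in> L2 M" by (simp add: L2_def)
  have "(L2_norm M (\<lambda>x. f x + g x))\<^sup>2 \<le> (LINT x|M. (norm (f x))\<^sup>2 + (norm (g x))\<^sup>2 + 2 * (norm (f x) * norm (g x)))"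
    unfolding L2_norm_power2 using int iF by (intro integral_mono le) auto
  also have "\<dots> = (L2_norm M f)\<^sup>2 + (L2_norm M g)\<^sup>2 + 2 * (LINT x|M. norm (f x) * norm (g x))"
    using i by (simp add: L2_norm_power2)
  also have "\<dots> \<le> (L2_norm M f + L2_norm M g)\<^sup>2"
    using L2_Cauchy_Schwarz[OF f g] by (simp add: power2_sum)
  finally show "L2_norm M (\<lambda>x. f x + g x) \<le> L2_norm M f + L2_norm M g"
    by (rule power2_le_imp_le) simp
qed

lemma L2_zero [simp]: "(\<lambda>x. 0) \<in> L2 M" "L2_norm M (\<lambda>x. 0) = 0"
  by (simp_all add: L2_def L2_norm_def)

lemma L2_smult:
  fixes f :: "real \<Rightarrow> complex^'m"
  assumes f: "f \<in> L2 M"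
  shows "(\<lambda>x. c *s f x) \<in> L2 M" "L2_norm M (\<lambda>x. c *s f x) = cmod c * L2_norm M f"
proof -
  note [measurable] = L2_measurable[OF f]
  show "(\<lambda>x. c *s f x) \<in> L2 M"
    using L2_integrable_power2[OF f] by (simp add: L2_def norm_smult_vec power_mult_distrib)
  show "L2_norm M (\<lambda>x. c *s f x) = cmod c * L2_norm M f"
    by (simp add: L2_norm_def norm_smult_vec power_mult_distrib real_sqrt_mult)
qed

lemma L2_diff:
  fixes f g :: "real \<Rightarrow> complex^'m"
  assumes f: "f \<in> L2 M" and g: "g \<in> L2 M"
  shows "(\<lambda>x. f x - g x) \<in> L2 M" "L2_norm M (\<lambda>x. f x - g x) \<le> L2_norm M f + L2_norm M g"
  using L2_add[OF f L2_smult(1)[OF g, of "-1"]] L2_smult(2)[OF g, of "-1"] by simp_all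

lemma L2_norm_minus_commute: "L2_norm M (\<lambda>x. f x - g x) = L2_norm M (\<lambda>x. g x - f x)"
  by (simp add: L2_norm_def norm_minus_commute)

lemma L2_norm_triangle3:
  fixes f g h :: "real \<Rightarrow> complex^'m"
  assumes "f \<in> L2 M" "g \<in> L2 M" "h \<in> L2 M"
  shows "L2_norm M (\<lambda>x. f x - h x) \<le> L2_norm M (\<lambda>x. f x - g x) + L2_norm M (\<lambda>x. g x - h x)"
  using L2_add(2)[OF L2_diff(1)[OF assms(1,2)] L2_diff(1)[OF assms(2,3)]] by simp

lemma L2_sum:
  fixes f :: "'i \<Rightarrow> real \<Rightarrow> complex^'m"
  assumes "\<And>i. i \<in> I \<Longrightarrow> f i \<in> L2 M"
  shows "(\<lambda>x. \<Sum>i\<in>I. f i x) \<in> L2 M" "L2_norm M (\<lambda>x. \<Sum>i\<in>I. f i x) \<le> (\<Sum>i\<in>I. L2_norm M (f i))"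
proof -
  have "(\<lambda>x. \<Sum>i\<in>I. f i x) \<in> L2 M \<and> L2_norm M (\<lambda>x. \<Sum>i\<in>I. f i x) \<le> (\<Sum>i\<in>I. L2_norm M (f i))"
    using assms
  proof (induction I rule: infinite_finite_induct)
    case (insert i I)
    then show ?case
      using L2_add(1)[of "f i" M "\<lambda>x. \<Sum>i\<in>I. f i x"] L2_add(2)[of "f i" M "\<lambda>x. \<Sum>i\<in>I. f i x"] by fastforce
  qed auto
  then show "(\<lambda>x. \<Sum>i\<in>I. f i x) \<in> L2 M" "L2_norm M (\<lambda>x. \<Sum>i\<in>I. f i x) \<le> (\<Sum>i\<in>I. L2_norm M (f i))"
    by auto
qed

lemma integrable_cdot:
  assumes f: "f \<in> L2 M" and g: "g \<in> L2 M"
  shows "integrable M (\<lambda>x. cdot (f x) (g x))"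
  by (rule Bochner_Integration.integrable_bound[OF L2_mult_integrable[OF f g]])
     (use L2_measurable[OF f] L2_measurable[OF g] norm_cdot_le in auto)

lemma L2_inner_bound:
  assumes f: "f \<in> L2 M" and g: "g \<in> L2 M"
  shows "cmod (L2_inner M f g) \<le> L2_norm M f * L2_norm M g"
proof -
  have "cmod (L2_inner M f g) \<le> (LINT x|M. cmod (cdot (f x) (g x)))"
    unfolding L2_inner_cdot by (rule integral_norm_bound)
  also have "\<dots> \<le> (LINT x|M. norm (f x) * norm (g x))"
    by (intro integral_mono L2_mult_integrable integrable_norm integrable_cdot f g norm_cdot_le)
  also have "\<dots> \<le> L2_norm M f * L2_norm M g" by (rule L2_Cauchy_Schwarz[OF f g])
  finally show ?thesis .
qed

lemma L2_inner_add_left: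
  assumes "f \<in> L2 M" "g \<in> L2 M" "h \<in> L2 M"
  shows "L2_inner M (\<lambda>x. f x + g x) h = L2_inner M f h + L2_inner M g h"
  using integrable_cdot[OF assms(1,3)] integrable_cdot[OF assms(2,3)]
  by (simp add: L2_inner_cdot cdot_add_left)

lemma L2_inner_smult_left: "L2_inner M (\<lambda>x. c *s f x) h = c * L2_inner M f h"
  by (simp add: L2_inner_cdot cdot_smult_left)

lemma L2_inner_cnj: "L2_inner M g f = cnj (L2_inner M f g)"
  unfolding L2_inner_cdot cdot_cnj[of "g _"] by simp

lemma L2_inner_zero_left [simp]: "L2_inner M (\<lambda>x. 0) h = 0"
  by (simp add: L2_inner_def)

lemma L2_inner_diff_left:
  assumes "f \<in> L2 M" "g \<in> L2 M" "h \<in> L2 M"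
  shows "L2_inner M (\<lambda>x. f x - g x) h = L2_inner M f h - L2_inner M g h"
  using L2_inner_add_left[OF assms(1) L2_smult(1)[OF assms(2), of "-1"] assms(3)]
    L2_inner_smult_left[of M "-1" g h] by simp

lemma L2_inner_sum_left:
  assumes "\<And>i. i \<in> I \<Longrightarrow> f i \<in> L2 M" "h \<in> L2 M"
  shows "L2_inner M (\<lambda>x. \<Sum>i\<in>I. f i x) h = (\<Sum>i\<in>I. L2_inner M (f i) h)"
  using assms
proof (induction I rule: infinite_finite_induct)
  case (insert i I)
  then show ?case
    using L2_inner_add_left[of "f i" M "\<lambda>x. \<Sum>i\<in>I. f i x" h] L2_sum(1)[of I f M] by simp
qed auto

lemma L2_inner_self: "L2_inner M f f = complex_of_real ((L2_norm M f)\<^sup>2)"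
  unfolding L2_inner_cdot cdot_self L2_norm_power2 by (rule integral_complex_of_real)

lemma L2_inner_cong_AE:
  assumes "AE x in M. f x = f' x" "f \<in> borel_measurable M" "f' \<in> borel_measurable M" "h \<in> borel_measurable M"
  shows "L2_inner M f h = L2_inner M f' h"
  unfolding L2_inner_cdot using assms by (intro integral_cong_AE) auto

text \<open>The index type is left open: finite index sets serve Bessel's inequality, and sets of
  functions indexed by themselves serve the maximality argument for bases.\<close>

definition orthonormal_on :: "real measure \<Rightarrow> 'i set \<Rightarrow> ('i \<Rightarrow> real \<Rightarrow> complex^'m) \<Rightarrow> bool" where
  "orthonormal_on M I e \<longleftrightarrow> (\<forall>i\<in>I. e i \<in> L2 M) \<and>
     (\<forall>i\<in>I. \<forall>j\<in>I. L2_inner M (e i) (e j) = (if i = j then 1 else 0))"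

lemma orthonormal_basis_imp_on: "orthonormal_basis M e \<Longrightarrow> orthonormal_on M I e"
  by (simp add: orthonormal_basis_def orthonormal_on_def)

lemma orthonormal_coeff:
  assumes e: "orthonormal_on M I e" and I: "finite I" and j: "j \<in> I"
  shows "L2_inner M (\<lambda>x. \<Sum>i\<in>I. c i *s e i x) (e j) = c j"
proof -
  have "L2_inner M (\<lambda>x. \<Sum>i\<in>I. c i *s e i x) (e j) = (\<Sum>i\<in>I. c i * L2_inner M (e i) (e j))"
    using e j by (subst L2_inner_sum_left) (auto simp: orthonormal_on_def L2_smult L2_inner_smult_left)
  also have "\<dots> = (\<Sum>i\<in>I. if i = j then c i else 0)"
    using e j by (intro sum.cong refl) (auto simp: orthonormal_on_def)
  finally show ?thesis using I j by simp
qed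

lemma orthonormal_sum_L2:
  assumes e: "orthonormal_on M I e"
  shows "(\<lambda>x. \<Sum>i\<in>I. c i *s e i x) \<in> L2 M"
  using e by (intro L2_sum) (auto simp: orthonormal_on_def L2_smult)

lemma orthonormal_pythagoras:
  assumes e: "orthonormal_on M I e" and I: "finite I"
  shows "(L2_norm M (\<lambda>x. \<Sum>i\<in>I. c i *s e i x))\<^sup>2 = (\<Sum>i\<in>I. (cmod (c i))\<^sup>2)"
proof -
  let ?s = "\<lambda>x. \<Sum>i\<in>I. c i *s e i x"
  have "complex_of_real ((L2_norm M ?s)\<^sup>2) = L2_inner M ?s ?s" by (rule L2_inner_self[symmetric])
  also have "\<dots> = (\<Sum>i\<in>I. c i * L2_inner M (e i) ?s)"
    using e orthonormal_sum_L2[OF e]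
    by (subst L2_inner_sum_left) (auto simp: orthonormal_on_def L2_smult L2_inner_smult_left)
  also have "\<dots> = (\<Sum>i\<in>I. c i * cnj (c i))"
    using L2_inner_cnj[of M "e _" ?s] orthonormal_coeff[OF e I, of _ c] by (intro sum.cong refl) simp
  also have "\<dots> = complex_of_real (\<Sum>i\<in>I. (cmod (c i))\<^sup>2)"
    by (simp only: of_real_sum complex_norm_square)
  finally show ?thesis by (simp only: of_real_eq_iff)
qed

text \<open>The residual is orthogonal to every \<open>e i\<close>, hence to the projection.
  Nonnegativity of the left side is Bessel's inequality.\<close>

lemma orthonormal_residual:
  assumes e: "orthonormal_on M I e" and I: "finite I" and f: "f \<in> L2 M"
  shows "(L2_norm M (\<lambda>x. f x - (\<Sum>i\<in>I. L2_inner M f (e i) *s e i x)))\<^sup>2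
       = (L2_norm M f)\<^sup>2 - (\<Sum>i\<in>I. (cmod (L2_inner M f (e i)))\<^sup>2)"
proof -
  let ?c = "\<lambda>i. L2_inner M f (e i)"
  let ?s = "\<lambda>x. \<Sum>i\<in>I. ?c i *s e i x"
  have s: "?s \<in> L2 M" by (rule orthonormal_sum_L2[OF e])
  let ?g = "\<lambda>x. f x - ?s x"
  have g: "?g \<in> L2 M" by (rule L2_diff(1)[OF f s])
  have e2: "e i \<in> L2 M" if "i \<in> I" for i using e that by (simp add: orthonormal_on_def)
  have gi: "L2_inner M ?g (e i) = 0" if "i \<in> I" for i
    by (simp add: L2_inner_diff_left[OF f s e2[OF that]] orthonormal_coeff[OF e I that])
  have "L2_inner M ?s ?g = (\<Sum>i\<in>I. ?c i * L2_inner M (e i) ?g)"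
    using e g by (subst L2_inner_sum_left) (auto simp: orthonormal_on_def L2_smult L2_inner_smult_left)
  also have "\<dots> = 0"
    using gi L2_inner_cnj[of M "e _" ?g] by (intro sum.neutral ballI) simp
  finally have sg: "L2_inner M ?s ?g = 0" .
  have "L2_inner M ?g ?g = L2_inner M f ?g" using L2_inner_diff_left[OF f s g] sg by simp
  also have "\<dots> = cnj (L2_inner M ?g f)" by (rule L2_inner_cnj)
  also have "\<dots> = cnj (L2_inner M f f - L2_inner M ?s f)" by (simp only: L2_inner_diff_left[OF f s f])
  also have "L2_inner M ?s f = (\<Sum>i\<in>I. ?c i * L2_inner M (e i) f)"
    using e f by (subst L2_inner_sum_left) (auto simp: orthonormal_on_def L2_smult L2_inner_smult_left)
  also have "\<dots> = (\<Sum>i\<in>I. ?c i * cnj (?c i))"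
    by (simp only: L2_inner_cnj[of M "e _" f])
  also have "\<dots> = complex_of_real (\<Sum>i\<in>I. (cmod (?c i))\<^sup>2)"
    by (simp only: of_real_sum complex_norm_square)
  finally have "complex_of_real ((L2_norm M ?g)\<^sup>2) = complex_of_real ((L2_norm M f)\<^sup>2 - (\<Sum>i\<in>I. (cmod (?c i))\<^sup>2))"
    by (simp only: L2_inner_self of_real_diff[symmetric] complex_cnj_complex_of_real)
  then show ?thesis by (simp only: of_real_eq_iff)
qed

lemma bessel_inequality:
  assumes "orthonormal_on M I e" "finite I" "f \<in> L2 M"
  shows "(\<Sum>i\<in>I. (cmod (L2_inner M f (e i)))\<^sup>2) \<le> (L2_norm M f)\<^sup>2"
  using orthonormal_residual[OF assms] zero_le_power2[of "L2_norm M (\<lambda>x. f x - (\<Sum>i\<in>I. L2_inner M f (e i) *s e i x))"]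
  by linarith

section \<open>Completeness and orthonormal bases\<close>

text \<open>A subsequence converging almost everywhere is extracted in L1. On a space of infinite
  measure an L2 Cauchy sequence need not be Cauchy in L1, but it becomes so after multiplication by
  a strictly positive \<open>w\<close> in L2, which sigma-finiteness provides. Dividing by
  \<open>w\<close> recovers a pointwise limit.\<close>

lemma L2_complete:
  fixes s :: "nat \<Rightarrow> real \<Rightarrow> complex^'m"
  assumes M: "sigma_finite_measure M" and s: "\<And>n. s n \<in> L2 M"
    and C: "\<And>e. 0 < e \<Longrightarrow> \<exists>N. \<forall>i\<ge>N. \<forall>j\<ge>N. L2_norm M (\<lambda>x. s i x - s j x) < e"
  obtains u where "u \<in> L2 M" "(\<lambda>n. L2_norm M (\<lambda>x. s n x - u x)) \<longlonglongrightarrow> 0"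
proof -
  interpret sigma_finite_measure M by fact
  note [measurable] = L2_measurable[OF s]
  obtain h where h [measurable]: "h \<in> borel_measurable M" and hi: "integral\<^sup>N M h \<noteq> \<infinity>"
    and hp: "\<And>x. x \<in> space M \<Longrightarrow> 0 < h x \<and> h x < \<infinity>"
    using Ex_finite_integrable_function by blast
  define w where "w = (\<lambda>x. sqrt (enn2real (h x)))"
  have [measurable]: "w \<in> borel_measurable M" unfolding w_def by measurable
  have wp: "0 < w x" if "x \<in> space M" for x
    using hp[OF that] by (simp add: w_def enn2real_positive_iff)
  have w: "w \<in> L2 M"
  proof -
    have "integrable M (\<lambda>x. enn2real (h x))"
    proof (rule integrableI_nonneg)
      have "(\<integral>\<^sup>+x. ennreal (enn2real (h x)) \<partial>M) = integral\<^sup>N M h"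
        using hp by (intro nn_integral_cong) (auto simp: less_top[symmetric] ennreal_enn2real)
      then show "(\<integral>\<^sup>+x. ennreal (enn2real (h x)) \<partial>M) < \<infinity>" using hi by (simp add: less_top[symmetric])
    qed auto
    then show ?thesis by (simp add: L2_def w_def)
  qed
  define t where "t = (\<lambda>n x. w x *\<^sub>R s n x)"
  have it: "integrable M (t n)" for n
    by (rule Bochner_Integration.integrable_bound[OF L2_mult_integrable[OF w s[of n]]]) (auto simp: t_def)
  have L1C: "\<exists>N. \<forall>i\<ge>N. \<forall>j\<ge>N. LINT x|M. norm (t i x - t j x) < e" if e: "0 < e" for e
  proof -
    have w1: "L2_norm M w + 1 \<noteq> 0" using L2_norm_nonneg[of M w] by linarith
    have "0 < e / (L2_norm M w + 1)" using e by (intro divide_pos_pos add_nonneg_pos) auto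
    then obtain N where N: "\<And>i j. i \<ge> N \<Longrightarrow> j \<ge> N \<Longrightarrow> L2_norm M (\<lambda>x. s i x - s j x) < e / (L2_norm M w + 1)"
      using C by blast
    have "LINT x|M. norm (t i x - t j x) < e" if "i \<ge> N" "j \<ge> N" for i j
    proof -
      have "(LINT x|M. norm (t i x - t j x)) = (LINT x|M. norm (w x) * norm (s i x - s j x))"
        by (simp add: t_def scaleR_diff_right[symmetric])
      also have "\<dots> \<le> L2_norm M w * L2_norm M (\<lambda>x. s i x - s j x)"
        by (rule L2_Cauchy_Schwarz[OF w L2_diff(1)[OF s s]])
      also have "\<dots> \<le> (L2_norm M w + 1) * L2_norm M (\<lambda>x. s i x - s j x)"
        by (intro mult_right_mono) auto
      also have "\<dots> < (L2_norm M w + 1) * (e / (L2_norm M w + 1))"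
        by (intro mult_strict_left_mono N that) (simp add: add_nonneg_pos)
      also have "\<dots> = e" using w1 by simp
      finally show ?thesis .
    qed
    then show ?thesis by blast
  qed
  obtain r where r: "strict_mono r" and Cau: "AE x in M. Cauchy (\<lambda>i. t (r i) x)"
    using cauchy_L1_AE_cauchy_subseq[OF it L1C] by blast
  define u where "u = (\<lambda>x. lim (\<lambda>i. s (r i) x))"
  have um [measurable]: "u \<in> borel_measurable M" unfolding u_def by (rule borel_measurable_lim_metric) measurable
  have su: "AE x in M. (\<lambda>i. s (r i) x) \<longlonglongrightarrow> u x"
    using Cau AE_space
  proof eventually_elim
    case (elim x)
    then have "convergent (\<lambda>i. t (r i) x)" by (simp add: Cauchy_convergent_iff)
    then obtain l where "(\<lambda>i. t (r i) x) \<longlonglongrightarrow> l" by (auto simp: convergent_def)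
    then have "(\<lambda>i. (1 / w x) *\<^sub>R t (r i) x) \<longlonglongrightarrow> (1 / w x) *\<^sub>R l" by (intro tendsto_intros)
    moreover have "(1 / w x) *\<^sub>R t (r i) x = s (r i) x" for i using wp elim by (force simp: t_def)
    ultimately have "convergent (\<lambda>i. s (r i) x)" by (auto simp: convergent_def)
    then show ?case unfolding u_def by (simp add: convergent_LIMSEQ_iff)
  qed
  have nnL2: "(\<integral>\<^sup>+x. ennreal ((norm (f x))\<^sup>2) \<partial>M) = ennreal ((L2_norm M f)\<^sup>2)" if "f \<in> L2 M" for f :: "real \<Rightarrow> complex^'m"
    unfolding L2_norm_power2 using that by (intro nn_integral_eq_integral L2_integrable_power2) auto
  \<comment> \<open>Fatou's lemma along the subsequence carries the bound on the distance of two
    terms over to the distance from the pointwise limit.\<close>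
  have main: "(\<lambda>x. s n x - u x) \<in> L2 M \<and> L2_norm M (\<lambda>x. s n x - u x) \<le> e"
    if e: "0 < e" and N: "\<And>i j. i \<ge> N \<Longrightarrow> j \<ge> N \<Longrightarrow> L2_norm M (\<lambda>x. s i x - s j x) < e" and n: "n \<ge> N" for e N n
  proof -
    have "(\<integral>\<^sup>+x. ennreal ((norm (s n x - u x))\<^sup>2) \<partial>M)
        \<le> (\<integral>\<^sup>+x. liminf (\<lambda>i. ennreal ((norm (s n x - s (r i) x))\<^sup>2)) \<partial>M)"
    proof (intro nn_integral_mono_AE, use su in eventually_elim)
      case (elim x)
      then have "(\<lambda>i. ennreal ((norm (s n x - s (r i) x))\<^sup>2)) \<longlonglongrightarrow> ennreal ((norm (s n x - u x))\<^sup>2)"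
        by (intro tendsto_intros)
      then have "liminf (\<lambda>i. ennreal ((norm (s n x - s (r i) x))\<^sup>2)) = ennreal ((norm (s n x - u x))\<^sup>2)"
        by (intro lim_imp_Liminf) auto
      then show ?case by simp
    qed
    also have "\<dots> \<le> liminf (\<lambda>i. \<integral>\<^sup>+x. ennreal ((norm (s n x - s (r i) x))\<^sup>2) \<partial>M)"
      by (rule nn_integral_liminf) measurable
    also have "\<dots> \<le> ennreal (e\<^sup>2)"
    proof (intro Liminf_le eventually_sequentiallyI[of N])
      fix i assume "N \<le> i"
      then have "N \<le> r i" using seq_suble[OF r, of i] by linarith
      then have "L2_norm M (\<lambda>x. s n x - s (r i) x) < e" using N n by blast
      then have "(L2_norm M (\<lambda>x. s n x - s (r i) x))\<^sup>2 \<le> e\<^sup>2" by (intro power_mono) auto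
      then show "(\<integral>\<^sup>+x. ennreal ((norm (s n x - s (r i) x))\<^sup>2) \<partial>M) \<le> ennreal (e\<^sup>2)"
        unfolding nnL2[OF L2_diff(1)[OF s s]] by (rule ennreal_leI)
    qed simp
    finally have le: "(\<integral>\<^sup>+x. ennreal ((norm (s n x - u x))\<^sup>2) \<partial>M) \<le> ennreal (e\<^sup>2)" .
    have "integrable M (\<lambda>x. (norm (s n x - u x))\<^sup>2)"
      by (rule integrableI_nonneg) (use le in \<open>auto simp: order_le_less_trans[OF _ ennreal_less_top]\<close>)
    then have mem: "(\<lambda>x. s n x - u x) \<in> L2 M" by (simp add: L2_def)
    have "(L2_norm M (\<lambda>x. s n x - u x))\<^sup>2 \<le> e\<^sup>2" using le unfolding nnL2[OF mem] by (simp add: ennreal_le_iff)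
    then have "L2_norm M (\<lambda>x. s n x - u x) \<le> e" by (rule power2_le_imp_le) (use e in auto)
    with mem show ?thesis by blast
  qed
  show ?thesis
  proof (rule that)
    obtain N where "\<And>i j. i \<ge> N \<Longrightarrow> j \<ge> N \<Longrightarrow> L2_norm M (\<lambda>x. s i x - s j x) < 1" using C[of 1] by auto
    then have "(\<lambda>x. s N x - u x) \<in> L2 M" using main[of 1 N N] by auto
    from L2_diff(1)[OF s[of N] this] show "u \<in> L2 M" by simp
    show "(\<lambda>n. L2_norm M (\<lambda>x. s n x - u x)) \<longlonglongrightarrow> 0"
    proof (rule LIMSEQ_I)
      fix e :: real assume e: "0 < e"
      then obtain N where N: "\<And>i j. i \<ge> N \<Longrightarrow> j \<ge> N \<Longrightarrow> L2_norm M (\<lambda>x. s i x - s j x) < e / 2" using C[of "e / 2"] by auto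
      have "L2_norm M (\<lambda>x. s n x - u x) \<le> e / 2" if "n \<ge> N" for n
        using main[of "e / 2" N n, OF _ N that] e by simp
      then show "\<exists>N. \<forall>n\<ge>N. norm (L2_norm M (\<lambda>x. s n x - u x) - 0) < e" using e by (intro exI[of _ N]) force
    qed
  qed
qed

lemma L2_inner_tendsto:
  fixes s :: "nat \<Rightarrow> real \<Rightarrow> complex^'m"
  assumes s: "\<And>n. s n \<in> L2 M" and u: "u \<in> L2 M" and g: "g \<in> L2 M"
    and lim: "(\<lambda>n. L2_norm M (\<lambda>x. s n x - u x)) \<longlonglongrightarrow> 0"
  shows "(\<lambda>n. L2_inner M (s n) g) \<longlonglongrightarrow> L2_inner M u g"
proof -
  have le: "norm (L2_inner M (s n) g - L2_inner M u g) \<le> L2_norm M (\<lambda>x. s n x - u x) * L2_norm M g" for n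
    using L2_inner_bound[OF L2_diff(1)[OF s u] g] by (simp add: L2_inner_diff_left[OF s u g])
  have "(\<lambda>n. L2_norm M (\<lambda>x. s n x - u x) * L2_norm M g) \<longlonglongrightarrow> 0" using tendsto_mult_right[OF lim] by simp
  then have "(\<lambda>n. L2_inner M (s n) g - L2_inner M u g) \<longlonglongrightarrow> 0"
    by (rule Lim_null_comparison[OF always_eventually[OF allI[OF le]]])
  then show ?thesis by (rule LIM_zero_cancel)
qed

text \<open>The partial sums are Cauchy by Bessel's inequality, and their limit has the same
  coefficients as \<open>f\<close>; the totality clause of \<open>orthonormal_basis\<close>
  identifies the two.\<close>

lemma parseval_expansion:
  fixes f :: "real \<Rightarrow> complex^'m"
  assumes M: "sigma_finite_measure M" and e: "orthonormal_basis M e" and f: "f \<in> L2 M"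
  shows "(\<lambda>N. L2_norm M (\<lambda>x. (\<Sum>i<N. L2_inner M f (e i) *s e i x) - f x)) \<longlonglongrightarrow> 0"
proof -
  let ?c = "\<lambda>i. L2_inner M f (e i)"
  define s where "s = (\<lambda>N x. \<Sum>i<N. ?c i *s e i x)"
  have on: "orthonormal_on M I e" for I by (rule orthonormal_basis_imp_on[OF e])
  have eL2: "e i \<in> L2 M" for i using e by (simp add: orthonormal_basis_def)
  have s: "s N \<in> L2 M" for N unfolding s_def by (rule orthonormal_sum_L2[OF on])
  have "summable (\<lambda>i. (cmod (?c i))\<^sup>2)"
    using bessel_inequality[OF on _ f] by (intro bounded_imp_summable[where B = "(L2_norm M f)\<^sup>2"]) (auto simp: lessThan_Suc_atMost[symmetric] simp del: sum.lessThan_Suc)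
  then have cau: "Cauchy (\<lambda>N. \<Sum>i<N. (cmod (?c i))\<^sup>2)"
    by (simp add: summable_iff_convergent convergent_Cauchy)
  have sd: "(L2_norm M (\<lambda>x. s j x - s i x))\<^sup>2 = (\<Sum>k<j. (cmod (?c k))\<^sup>2) - (\<Sum>k<i. (cmod (?c k))\<^sup>2)" if "i \<le> j" for i j
  proof -
    have "s j x - s i x = (\<Sum>k\<in>{i..<j}. ?c k *s e k x)" for x
      unfolding s_def using sum_diff_nat_ivl[of 0 i j "\<lambda>k. ?c k *s e k x"] that by (simp add: atLeast0LessThan)
    moreover have "(\<Sum>k\<in>{i..<j}. (cmod (?c k))\<^sup>2) = (\<Sum>k<j. (cmod (?c k))\<^sup>2) - (\<Sum>k<i. (cmod (?c k))\<^sup>2)"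
      using sum_diff_nat_ivl[of 0 i j "\<lambda>k. (cmod (?c k))\<^sup>2"] that by (simp add: atLeast0LessThan)
    ultimately show ?thesis using orthonormal_pythagoras[OF on, of "{i..<j}" ?c] by simp
  qed
  have C: "\<exists>N. \<forall>i\<ge>N. \<forall>j\<ge>N. L2_norm M (\<lambda>x. s i x - s j x) < d" if d: "0 < d" for d
  proof -
    from cau d obtain N where N: "\<And>i j. i \<ge> N \<Longrightarrow> j \<ge> N \<Longrightarrow> \<bar>(\<Sum>k<j. (cmod (?c k))\<^sup>2) - (\<Sum>k<i. (cmod (?c k))\<^sup>2)\<bar> < d\<^sup>2"
      unfolding Cauchy_def dist_real_def by (meson zero_less_power)
    have "L2_norm M (\<lambda>x. s i x - s j x) < d" if ij: "i \<ge> N" "j \<ge> N" for i j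
    proof (rule power2_less_imp_less)
      show "(L2_norm M (\<lambda>x. s i x - s j x))\<^sup>2 < d\<^sup>2"
      proof (cases "i \<le> j")
        case True
        then show ?thesis using sd[OF True] N[OF ij] L2_norm_minus_commute[of M "s i" "s j"] by simp
      next
        case False
        then show ?thesis using sd[of j i] N[OF ij(2,1)] by simp
      qed
    qed (use d in auto)
    then show ?thesis by blast
  qed
  obtain u where u: "u \<in> L2 M" and lim: "(\<lambda>n. L2_norm M (\<lambda>x. s n x - u x)) \<longlonglongrightarrow> 0"
    using L2_complete[OF M s C] by blast
  have "L2_inner M (\<lambda>x. f x - u x) (e i) = 0" for i
  proof -
    have "eventually (\<lambda>N. L2_inner M (s N) (e i) = ?c i) sequentially"
      unfolding s_def using orthonormal_coeff[OF on, of "{..<_}" i ?c] by (intro eventually_sequentiallyI[of "Suc i"]) auto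
    then have "(\<lambda>N. L2_inner M (s N) (e i)) \<longlonglongrightarrow> ?c i" by (rule tendsto_eventually)
    then have "L2_inner M u (e i) = ?c i"
      using L2_inner_tendsto[OF s u eL2 lim] LIMSEQ_unique by blast
    then show ?thesis by (simp add: L2_inner_diff_left f u eL2)
  qed
  then have "AE x in M. f x - u x = 0"
    using e L2_diff(1)[OF f u] unfolding orthonormal_basis_def by blast
  then have "L2_norm M (\<lambda>x. s N x - f x) = L2_norm M (\<lambda>x. s N x - u x)" for N
    using L2_measurable[OF f] L2_measurable[OF u] L2_measurable[OF s] by (intro L2_norm_cong_AE) auto
  then show ?thesis using lim by (simp add: s_def)
qed

lemma parseval_sums:
  fixes f g :: "real \<Rightarrow> complex^'m"
  assumes M: "sigma_finite_measure M" and e: "orthonormal_basis M e" and f: "f \<in> L2 M" and g: "g \<in> L2 M"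
  shows "(\<lambda>i. L2_inner M f (e i) * L2_inner M (e i) g) sums L2_inner M f g"
proof -
  have eL2: "e i \<in> L2 M" for i using e by (simp add: orthonormal_basis_def)
  have "(\<lambda>N. L2_inner M (\<lambda>x. \<Sum>i<N. L2_inner M f (e i) *s e i x) g) \<longlonglongrightarrow> L2_inner M f g"
    by (intro L2_inner_tendsto[OF _ f g parseval_expansion[OF M e f]] L2_sum L2_smult eL2)
  moreover have "L2_inner M (\<lambda>x. \<Sum>i<N. L2_inner M f (e i) *s e i x) g = (\<Sum>i<N. L2_inner M f (e i) * L2_inner M (e i) g)" for N
    by (subst L2_inner_sum_left) (auto simp: L2_smult eL2 g L2_inner_smult_left)
  ultimately show ?thesis by (simp add: sums_def)
qed

section \<open>Separability, infinite dimension and existence of an orthonormal basis\<close>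

text \<open>Continuity of the indefinite integral extends the hypothesis to all intervals, and
  Lebesgue differentiation recovers \<open>F\<close> almost everywhere. Rational endpoints keep the
  set of test functions countable.\<close>

lemma zero_AE_if_rational_integrals_zero:
  fixes F :: "real \<Rightarrow> complex"
  assumes F: "\<And>c d. F integrable_on {c..d}"
    and z: "\<And>c d. c \<in> \<rat> \<Longrightarrow> d \<in> \<rat> \<Longrightarrow> integral {c..d} F = 0"
  shows "negligible {x. F x \<noteq> 0}"
proof -
  have half: "integral {c..d} F = 0" if c: "c \<in> \<rat>" and cd: "c \<le> d" for c d
  proof -
    have "\<exists>q\<in>\<rat>. d < q \<and> q < d + 1 / real (Suc n)" for n by (rule Rats_dense_in_real) simp
    then obtain q where q: "\<And>n. q n \<in> \<rat>" "\<And>n. d < q n" "\<And>n. q n < d + 1 / real (Suc n)" by metis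
    have "(\<lambda>n. d + 1 / real (Suc n)) \<longlonglongrightarrow> d + 0" by (intro tendsto_intros LIMSEQ_inverse_real_of_nat[unfolded inverse_eq_divide])
    then have ql: "q \<longlonglongrightarrow> d"
      using q(2,3) by (intro real_tendsto_sandwich[of "\<lambda>_. d" q _ "\<lambda>n. d + 1 / real (Suc n)"])
        (simp_all add: less_imp_le del: of_nat_Suc)
    have "continuous_on {c..d+1} (\<lambda>t. integral {c..t} F)" by (rule indefinite_integral_continuous_1[OF F])
    moreover have "q n \<in> {c..d+1}" for n
    proof -
      have "1 / real (Suc n) \<le> 1" by simp
      then have "q n \<le> d + 1" using q(3)[of n] by linarith
      then show ?thesis using q(2)[of n] cd by simp
    qed
    ultimately have "(\<lambda>n. integral {c..q n} F) \<longlonglongrightarrow> integral {c..d} F"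
      using ql cd by (intro continuous_on_tendsto_compose[where f = "\<lambda>t. integral {c..t} F"]) auto
    then show ?thesis using z[OF c q(1)] by (simp add: LIMSEQ_const_iff)
  qed
  \<comment> \<open>The left endpoint is freed by additivity, starting from a rational point further
    to the left.\<close>
  have all: "integral {c..d} F = 0" if "c \<le> d" for c d
  proof -
    obtain q where q: "q \<in> \<rat>" "q < c" using Rats_dense_in_real[of "c - 1" c] by auto
    have "integral {q..c} F + integral {c..d} F = integral {q..d} F"
      using q that F by (intro Henstock_Kurzweil_Integration.integral_combine) auto
    then show ?thesis using half[OF q(1), of c] half[OF q(1), of d] q that by simp
  qed
  have "\<And>a b. F integrable_on cbox a b" using F by simp
  then obtain N where N: "negligible N"
    and lim: "\<And>x e. x \<notin> N \<Longrightarrow> 0 < e \<Longrightarrow> \<exists>d>0. \<forall>h. 0 < h \<and> h < d \<longrightarrow>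
       norm (integral (cbox x (x + h *\<^sub>R One)) F /\<^sub>R h ^ DIM(real) - F x) < e"
    using integrable_ccontinuous_explicit by metis
  have "F x = 0" if xN: "x \<notin> N" for x
  proof (rule ccontr)
    assume "F x \<noteq> 0"
    then have "0 < cmod (F x)" by simp
    from lim[OF xN this] obtain d where d: "d > 0"
      "\<And>h. 0 < h \<and> h < d \<Longrightarrow> norm (integral (cbox x (x + h *\<^sub>R One)) F /\<^sub>R h ^ DIM(real) - F x) < cmod (F x)"
      by blast
    have "integral (cbox x (x + (d/2) *\<^sub>R One)) F = 0" using all[of x "x + d / 2"] d by simp
    then show False using d(2)[of "d/2"] d(1) by simp
  qed
  then have "{x. F x \<noteq> 0} \<subseteq> N" by blast
  then show ?thesis using N negligible_subset by blast
qed

lemma cdot_axis_right: "cdot u (axis k c) = u $ k * cnj c"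
  by (simp add: cdot_def axis_def if_distrib[of cnj] if_distrib[of "\<lambda>x. _ * x"] cong: if_cong)

lemma norm_axis_vec: "norm (axis k c :: complex^'m) = cmod c"
proof -
  have "(norm (axis k c :: complex^'m))\<^sup>2 = (cmod c)\<^sup>2"
    using cdot_self[of "axis k c :: complex^'m"] unfolding cdot_axis_right
    by (simp add: complex_norm_square[symmetric] flip: of_real_power)
  then show ?thesis by (rule power2_eq_imp_eq) auto
qed

lemma measurable_axis [measurable (raw)]:
  assumes "f \<in> borel_measurable M"
  shows "(\<lambda>x. axis k (f x) :: complex^'m) \<in> borel_measurable M"
proof -
  have "axis k (f x) = f x *s (axis k 1 :: complex^'m)" for x by (simp add: vec_eq_iff axis_def)
  then show ?thesis using assms by simp
qed

text \<open>Test functions: with rational endpoints they are countably many and still detect every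
  nonzero element of L2, which limits the size of orthonormal sets.\<close>

definition bump :: "'m \<Rightarrow> real \<Rightarrow> real \<Rightarrow> real \<Rightarrow> complex^'m" where
  "bump k c d x = axis k (indicator {c..d} x)"

lemma interval_sets_lebesgue [simp]: "{c..d::real} \<in> sets lebesgue"
  by (metis cbox_interval fmeasurableD lmeasurable_cbox)

lemma finite_emeasure_lebesgue_on_interval:
  fixes S :: "real set"
  assumes "S \<in> sets lebesgue"
  shows "emeasure (lebesgue_on S) (space (lebesgue_on S) \<inter> {c..d}) < \<infinity>"
proof -
  have "emeasure (lebesgue_on S) (space (lebesgue_on S) \<inter> {c..d}) = emeasure lebesgue (S \<inter> {c..d})"
    using assms by (subst emeasure_restrict_space) (auto simp: Int_absorb)
  also have "\<dots> \<le> emeasure lebesgue {c..d}"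
    by (intro emeasure_mono) auto
  also have "\<dots> < \<infinity>" by (cases "c \<le> d") auto
  finally show ?thesis .
qed

lemma bump_L2:
  assumes S: "S \<in> sets lebesgue"
  shows "bump k c d \<in> L2 (lebesgue_on S)"
proof -
  have "{c..d} \<inter> S \<in> sets (lebesgue_on S)" using S by (auto simp: sets_restrict_space)
  then have [measurable]: "indicator {c..d} \<in> borel_measurable (lebesgue_on S)"
    by (intro measurable_restrict_space1 borel_measurable_indicator) simp
  have "integrable (lebesgue_on S) (indicator {c..d} :: real \<Rightarrow> real)"
    using finite_emeasure_lebesgue_on_interval[OF S, of c d] \<open>{c..d} \<inter> S \<in> _\<close>
    by (subst integrable_indicator_iff) (auto simp: Int_commute)
  moreover have "(norm (bump k c d x :: complex^'a))\<^sup>2 = indicator {c..d} x" for x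
    by (simp add: bump_def norm_axis_vec indicator_def)
  ultimately have "integrable (lebesgue_on S) (\<lambda>x. (norm (bump k c d x :: complex^'a))\<^sup>2)" by simp
  moreover have "bump k c d \<in> borel_measurable (lebesgue_on S)"
  proof -
    have "(\<lambda>x. complex_of_real (indicator {c..d} x)) \<in> borel_measurable (lebesgue_on S)" by measurable
    then have "(\<lambda>x. axis k (complex_of_real (indicator {c..d} x)) :: complex^'a) \<in> borel_measurable (lebesgue_on S)"
      by (rule measurable_axis)
    moreover have "bump k c d = (\<lambda>x. axis k (complex_of_real (indicator {c..d} x)) :: complex^'a)"
      by (auto simp: bump_def indicator_def)
    ultimately show ?thesis by simp
  qed
  ultimately show ?thesis by (simp add: L2_def)
qed

text \<open>Each component, extended by zero outside \<open>S\<close>, is a function on the line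
  whose integrals over rational intervals are these inner products.\<close>

lemma L2_zero_if_orthogonal_to_bumps:
  fixes f :: "real \<Rightarrow> complex^'m"
  assumes S: "S \<in> sets lebesgue" and f: "f \<in> L2 (lebesgue_on S)"
    and orth: "\<And>k c d. c \<in> \<rat> \<Longrightarrow> d \<in> \<rat> \<Longrightarrow> L2_inner (lebesgue_on S) f (bump k c d) = 0"
  shows "AE x in lebesgue_on S. f x = 0"
proof -
  let ?M = "lebesgue_on S"
  have comp: "AE x in ?M. f x $ k = 0" for k
  proof -
    define F where "F = (\<lambda>x. if x \<in> S then f x $ k else 0)"
    have S': "S \<inter> space lebesgue \<in> sets lebesgue" using S by simp
    have iF: "integrable (lebesgue_on {c..d}) F" and eF: "integral\<^sup>L (lebesgue_on {c..d}) F = L2_inner ?M f (bump k c d)" for c d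
    proof -
      have cd: "{c..d} \<inter> space lebesgue \<in> sets lebesgue" by simp
      have eq: "indicator {c..d} x *\<^sub>R F x = indicator S x *\<^sub>R cdot (f x) (bump k c d x)" for x
        by (auto simp: F_def bump_def cdot_axis_right indicator_def)
      have "integrable ?M (\<lambda>x. cdot (f x) (bump k c d x))" by (intro integrable_cdot f bump_L2 S)
      then show "integrable (lebesgue_on {c..d}) F"
        unfolding integrable_restrict_space[OF S'] integrable_restrict_space[OF cd] eq .
      show "integral\<^sup>L (lebesgue_on {c..d}) F = L2_inner ?M f (bump k c d)"
        unfolding L2_inner_cdot integral_restrict_space[OF S'] integral_restrict_space[OF cd] eq ..
    qed
    have "negligible {x. F x \<noteq> 0}"
    proof (rule zero_AE_if_rational_integrals_zero)
      show "F integrable_on {c..d}" for c d by (rule integrable_on_lebesgue_on[OF iF]) simp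
      show "integral {c..d} F = 0" if "c \<in> \<rat>" "d \<in> \<rat>" for c d
        using lebesgue_integral_eq_integral[OF iF[of c d]] eF[of c d] orth[OF that] by simp
    qed
    then have "{x. F x \<noteq> 0} \<in> null_sets lebesgue" by (simp add: negligible_iff_null_sets)
    then have "AE x in lebesgue. F x = 0" by (auto dest: AE_not_in)
    then show ?thesis
      using S by (subst AE_restrict_space_iff) (auto simp: F_def elim!: eventually_mono)
  qed
  have "AE x in ?M. \<forall>k\<in>UNIV. f x $ k = 0" using comp by (subst AE_finite_all) auto
  then show ?thesis by (auto simp: vec_eq_iff)
qed

text \<open>Normalized indicators of \<open>n\<close> consecutive intervals of equal length;
  neighbours share one endpoint, a null set. Since \<open>n\<close> is arbitrary, the space has
  infinite dimension.\<close>

lemma orthonormal_families_exist: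
  assumes S: "S \<in> sets lebesgue" and cd: "c < d" "{c..d} \<subseteq> S"
  obtains v :: "nat \<Rightarrow> real \<Rightarrow> complex^'m" where "orthonormal_on (lebesgue_on S) {..<n} v"
proof (cases "n = 0")
  case True
  then show ?thesis by (intro that[of "\<lambda>_ _. 0"]) (simp add: orthonormal_on_def)
next
  case False
  define \<delta> where "\<delta> = (d - c) / n"
  have \<delta>: "\<delta> > 0" using False cd by (simp add: \<delta>_def)
  define k0 where "k0 = (SOME i :: 'm. True)"
  define p where "p = (\<lambda>k::nat. c + k * \<delta>)"
  define v where "v = (\<lambda>k x. complex_of_real (1 / sqrt \<delta>) *s (bump k0 (p k) (p (Suc k)) x :: complex^'m))"
  have v: "v k \<in> L2 (lebesgue_on S)" for k unfolding v_def by (intro L2_smult bump_L2 S)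
  have S': "S \<inter> space lebesgue \<in> sets lebesgue" using S by simp
  have inner: "L2_inner (lebesgue_on S) (v j) (v k) = (if j = k then 1 else 0)" if jk: "j < n" "k < n" for j k
  proof -
    have sub: "{p k..p (Suc k)} \<subseteq> S" if "k < n" for k
    proof -
      have "real (Suc k) * \<delta> \<le> n * \<delta>" using \<delta> that by (intro mult_right_mono) auto
      then have "p (Suc k) \<le> d" using False by (simp add: p_def \<delta>_def)
      moreover have "c \<le> p k" using \<delta> by (simp add: p_def)
      ultimately show ?thesis using cd(2) by auto
    qed
    have pp: "p (Suc k) = p k + \<delta>" for k by (simp add: p_def algebra_simps)
    have "L2_inner (lebesgue_on S) (v j) (v k) =
        (LINT x|lebesgue. complex_of_real (1 / \<delta> * (indicator {p j..p (Suc j)} x * indicator {p k..p (Suc k)} x)))"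
      unfolding L2_inner_cdot integral_restrict_space[OF S']
    proof (intro Bochner_Integration.integral_cong refl)
      fix x
      have "complex_of_real (1 / sqrt \<delta>) * cnj (complex_of_real (1 / sqrt \<delta>)) = complex_of_real (1 / \<delta>)"
        using \<delta> by (simp flip: of_real_mult)
      moreover have "cdot (v j x) (v k x) = complex_of_real (1 / sqrt \<delta>) * cnj (complex_of_real (1 / sqrt \<delta>)) * (indicator {p j..p (Suc j)} x * indicator {p k..p (Suc k)} x)"
        unfolding v_def cdot_smult_left cdot_cnj[of "bump _ _ _ _" "_ *s _"]
        unfolding cdot_smult_left by (simp only: bump_def cdot_axis_right) (auto simp: axis_def indicator_def)
      ultimately have "cdot (v j x) (v k x) = complex_of_real (1 / \<delta> * (indicator {p j..p (Suc j)} x * indicator {p k..p (Suc k)} x))"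
        by (auto simp: indicator_def)
      then show "indicator S x *\<^sub>R cdot (v j x) (v k x) = complex_of_real (1 / \<delta> * (indicator {p j..p (Suc j)} x * indicator {p k..p (Suc k)} x))"
        using sub[OF jk(1)] by (auto simp: indicator_def)
    qed
    also have "\<dots> = complex_of_real (1 / \<delta> * (LINT x|lebesgue. indicator ({p j..p (Suc j)} \<inter> {p k..p (Suc k)}) x))"
      by (simp only: integral_complex_of_real indicator_inter_arith[symmetric]) simp
    also have "(LINT x|lebesgue. indicator ({p j..p (Suc j)} \<inter> {p k..p (Suc k)}) x :: real) = measure lebesgue ({p j..p (Suc j)} \<inter> {p k..p (Suc k)})"
      by simp
    also have "\<dots> = (if j = k then \<delta> else 0)"
    proof -
      have step: "p (Suc i) \<le> p l" if "i < l" for i l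
      proof -
        have "real (Suc i) * \<delta> \<le> real l * \<delta>" using that \<delta> by (intro mult_right_mono) auto
        then show ?thesis by (simp add: p_def)
      qed
      have ne: "measure lebesgue ({p i..p (Suc i)} \<inter> {p l..p (Suc l)}) = 0" if "i < l" for i l
      proof -
        have "{p i..p (Suc i)} \<inter> {p l..p (Suc l)} \<subseteq> {p l}" using step[OF that] by auto
        then have "{p i..p (Suc i)} \<inter> {p l..p (Suc l)} \<in> {{}, {p l}}" by blast
        then show ?thesis by auto
      qed
      show ?thesis
        using ne[of j k] ne[of k j] \<delta> by (cases j k rule: linorder_cases) (auto simp: Int_commute pp)
    qed
    finally show ?thesis using \<delta> by simp
  qed
  show ?thesis by (rule that[of v]) (auto simp: orthonormal_on_def v inner)
qed

text \<open>The descriptions that define determinant and trace range over bases indexed by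
  \<open>nat\<close>; if there were none, every value would satisfy them. Zorn's lemma gives a
  maximal orthonormal set \<open>B\<close>, which is total. What remains is to see that it is
  countably infinite.\<close>

lemma orthonormal_basis_exists:
  assumes S: "S \<in> sets lebesgue" and cd: "c < d" "{c..d} \<subseteq> S"
  obtains e :: "nat \<Rightarrow> real \<Rightarrow> complex^'m" where "orthonormal_basis (lebesgue_on S) e"
proof -
  let ?M = "lebesgue_on S"
  define \<A> where "\<A> = {B :: (real \<Rightarrow> complex^'m) set. orthonormal_on ?M B (\<lambda>b. b)}"
  have "\<exists>B\<in>\<A>. \<forall>X\<in>\<A>. B \<subseteq> X \<longrightarrow> X = B"
  proof (rule subset_Zorn')
    fix C assume C: "subset.chain \<A> C"
    show "\<Union>C \<in> \<A>"
      unfolding \<A>_def orthonormal_on_def mem_Collect_eq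
    proof (intro conjI ballI)
      fix f assume "f \<in> \<Union>C"
      then show "f \<in> L2 ?M" using C by (auto simp: subset.chain_def \<A>_def orthonormal_on_def)
    next
      fix f g assume "f \<in> \<Union>C" "g \<in> \<Union>C"
      then obtain X Y where XY: "X \<in> C" "Y \<in> C" "f \<in> X" "g \<in> Y" by blast
      then have "X \<subseteq> Y \<or> Y \<subseteq> X" using C by (auto simp: subset.chain_def)
      then obtain Z where "Z \<in> C" "f \<in> Z" "g \<in> Z" using XY by blast
      then show "L2_inner ?M f g = (if f = g then 1 else 0)"
        using C by (auto simp: subset.chain_def \<A>_def orthonormal_on_def)
    qed
  qed
  then obtain B where "B \<in> \<A>" and "\<forall>X\<in>\<A>. B \<subseteq> X \<longrightarrow> X = B" by blast
  then have B: "orthonormal_on ?M B (\<lambda>b. b)"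
    and max: "\<And>X. orthonormal_on ?M X (\<lambda>b. b) \<Longrightarrow> B \<subseteq> X \<Longrightarrow> X = B"
    by (simp_all add: \<A>_def)
  have BL2: "b \<in> L2 ?M" if "b \<in> B" for b using B that by (simp add: orthonormal_on_def)
  have Bsub: "orthonormal_on ?M I (\<lambda>b. b)" if "I \<subseteq> B" for I
    using B that by (auto simp: orthonormal_on_def subset_iff)
  \<comment> \<open>A nonzero function orthogonal to \<open>B\<close> could be normalized and added
    to \<open>B\<close>.\<close>
  have total: "AE x in ?M. f x = 0" if f: "f \<in> L2 ?M" and orth: "\<And>b. b \<in> B \<Longrightarrow> L2_inner ?M f b = 0" for f
  proof (rule L2_norm_zero_AE[OF f], rule ccontr)
    assume n: "L2_norm ?M f \<noteq> 0"
    define g where "g = (\<lambda>x. complex_of_real (1 / L2_norm ?M f) *s f x)"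
    have g: "g \<in> L2 ?M" unfolding g_def by (rule L2_smult(1)[OF f])
    have "L2_norm ?M g = 1" unfolding g_def L2_smult(2)[OF f] using n by (simp add: norm_divide)
    then have gg: "L2_inner ?M g g = 1" by (simp add: L2_inner_self)
    have gb: "L2_inner ?M g b = 0" if "b \<in> B" for b
      unfolding g_def L2_inner_smult_left using orth[OF that] by simp
    have bg: "L2_inner ?M b g = 0" if "b \<in> B" for b
      using L2_inner_cnj[of ?M b g] gb[OF that] by simp
    have gB: "g \<notin> B" using gg gb by force
    have "orthonormal_on ?M (insert g B) (\<lambda>b. b)"
      unfolding orthonormal_on_def
    proof (intro conjI ballI)
      fix h assume "h \<in> insert g B" then show "h \<in> L2 ?M" using g BL2 by blast
    next
      fix h h' assume "h \<in> insert g B" "h' \<in> insert g B"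
      then show "L2_inner ?M h h' = (if h = h' then 1 else 0)"
        using gg gb bg gB B unfolding orthonormal_on_def by auto
    qed
    then show False using max gB by blast
  qed
  \<comment> \<open>By Bessel's inequality each bump has nonzero coefficients at only countably many
    members of \<open>B\<close>, and each member has a nonzero coefficient at some bump.\<close>
  have "countable B"
  proof -
    define V :: "(real \<Rightarrow> complex^'m) set" where "V = (\<lambda>(k,c,d). bump k c d) ` (UNIV \<times> \<rat> \<times> \<rat>)"
    have V: "countable V" unfolding V_def by (intro countable_image countable_SIGMA countable_rat) auto
    have VL2: "v \<in> L2 ?M" if "v \<in> V" for v using that bump_L2[OF S] by (auto simp: V_def)
    have cv: "countable {b\<in>B. (cmod (L2_inner ?M v b))\<^sup>2 \<noteq> 0}" if v: "v \<in> V" for v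
    proof (rule summable_countable_real, rule nonneg_bdd_above_summable_on)
      show "bdd_above (sum (\<lambda>b. (cmod (L2_inner ?M v b))\<^sup>2) ` {F. F \<subseteq> B \<and> finite F})"
        using bessel_inequality[OF Bsub _ VL2[OF v]] by (intro bdd_aboveI[of _ "(L2_norm ?M v)\<^sup>2"]) auto
    qed auto
    have "B \<subseteq> (\<Union>v\<in>V. {b\<in>B. (cmod (L2_inner ?M v b))\<^sup>2 \<noteq> 0})"
    proof
      fix b assume b: "b \<in> B"
      have "\<exists>v\<in>V. L2_inner ?M b v \<noteq> 0"
      proof (rule ccontr)
        assume "\<not> ?thesis"
        then have "AE x in ?M. b x = 0"
          by (intro L2_zero_if_orthogonal_to_bumps S BL2 b) (force simp: V_def)
        then have "L2_inner ?M b b = L2_inner ?M (\<lambda>x. 0) b"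
          using L2_measurable[OF BL2[OF b]] by (intro L2_inner_cong_AE) auto
        then show False using B b by (simp add: orthonormal_on_def)
      qed
      then obtain v where "v \<in> V" "L2_inner ?M v b \<noteq> 0" using L2_inner_cnj[of ?M _ b] by fastforce
      then show "b \<in> (\<Union>v\<in>V. {b\<in>B. (cmod (L2_inner ?M v b))\<^sup>2 \<noteq> 0})" using b by auto
    qed
    moreover have "countable (\<Union>v\<in>V. {b\<in>B. (cmod (L2_inner ?M v b))\<^sup>2 \<noteq> 0})"
      by (intro countable_UN V cv)
    ultimately show ?thesis by (rule countable_subset)
  qed
  have "infinite B"
  proof
    assume fin: "finite B"
    obtain v :: "nat \<Rightarrow> real \<Rightarrow> complex^'m" where v: "orthonormal_on ?M {..<Suc (card B)} v"
      using orthonormal_families_exist[OF S cd] .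
    have vL2: "v k \<in> L2 ?M" if "k < Suc (card B)" for k using v that by (simp add: orthonormal_on_def)
    have one: "(\<Sum>b\<in>B. (cmod (L2_inner ?M (v k) b))\<^sup>2) = 1" if k: "k < Suc (card B)" for k
    proof -
      let ?s = "\<lambda>x. \<Sum>b\<in>B. L2_inner ?M (v k) b *s b x"
      have s: "?s \<in> L2 ?M" by (rule orthonormal_sum_L2[OF B])
      have "AE x in ?M. v k x - ?s x = 0"
      proof (rule total[OF L2_diff(1)[OF vL2[OF k] s]])
        fix b assume b: "b \<in> B"
        show "L2_inner ?M (\<lambda>x. v k x - ?s x) b = 0"
          by (simp add: L2_inner_diff_left[OF vL2[OF k] s BL2[OF b]] orthonormal_coeff[OF B fin b])
      qed
      then have "L2_norm ?M (\<lambda>x. v k x - ?s x) = L2_norm ?M (\<lambda>x. 0 :: complex^'m)"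
        using L2_measurable[OF L2_diff(1)[OF vL2[OF k] s]] by (intro L2_norm_cong_AE) auto
      then have "(L2_norm ?M (v k))\<^sup>2 = (\<Sum>b\<in>B. (cmod (L2_inner ?M (v k) b))\<^sup>2)"
        using orthonormal_residual[OF B fin vL2[OF k]] by simp
      moreover have "complex_of_real ((L2_norm ?M (v k))\<^sup>2) = 1"
        using v k by (simp only: L2_inner_self[symmetric]) (simp add: orthonormal_on_def)
      ultimately show ?thesis by (metis of_real_eq_1_iff)
    qed
    \<comment> \<open>The double sum of squared coefficients is \<open>card B + 1\<close> because
      \<open>B\<close> is total, and at most \<open>card B\<close> by Bessel's inequality for the
      family \<open>v\<close>.\<close>
    have "real (Suc (card B)) = (\<Sum>k<Suc (card B). \<Sum>b\<in>B. (cmod (L2_inner ?M (v k) b))\<^sup>2)"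
      by (simp add: one del: sum.lessThan_Suc)
    also have "\<dots> = (\<Sum>b\<in>B. \<Sum>k<Suc (card B). (cmod (L2_inner ?M b (v k)))\<^sup>2)"
      by (subst sum.swap) (simp only: L2_inner_cnj[of ?M "v _"] complex_mod_cnj)
    also have "\<dots> \<le> (\<Sum>b\<in>B. (L2_norm ?M b)\<^sup>2)"
      by (intro sum_mono bessel_inequality[OF v] BL2) auto
    also have "\<dots> = (\<Sum>b\<in>B. 1)"
    proof (intro sum.cong refl)
      fix b assume "b \<in> B"
      then have "complex_of_real ((L2_norm ?M b)\<^sup>2) = 1"
        using B by (simp only: L2_inner_self[symmetric]) (simp add: orthonormal_on_def)
      then show "(L2_norm ?M b)\<^sup>2 = 1" by (metis of_real_eq_1_iff)
    qed
    finally show False by simp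
  qed
  with \<open>countable B\<close> have bij: "bij_betw (from_nat_into B) UNIV B" by (rule bij_betw_from_nat_into)
  show ?thesis
  proof (rule that[of "from_nat_into B"])
    have "from_nat_into B i \<in> B" for i using bij by (auto simp: bij_betw_def)
    moreover have "from_nat_into B i = from_nat_into B j \<longleftrightarrow> i = j" for i j
      using bij by (auto simp: bij_betw_def inj_on_def)
    moreover have "b \<in> range (from_nat_into B)" if "b \<in> B" for b using bij that by (auto simp: bij_betw_def)
    ultimately show "orthonormal_basis ?M (from_nat_into B)"
      using B total unfolding orthonormal_basis_def orthonormal_on_def by (metis (no_types, lifting) rangeE)
  qed
qed

section \<open>Operators with a pointwise bound\<close>

text \<open>For an integral operator, \<open>h x\<close> bounds the L2 norm of the kernel in its
  second variable. Linearity and the bound are required at every point of the space and not merely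
  almost everywhere, so that evaluation at a fixed point is a bounded linear functional; the
  Hilbert-Schmidt property follows from this alone.\<close>

definition dominated_op :: "real measure \<Rightarrow> 'm::finite operator \<Rightarrow> (real \<Rightarrow> real) \<Rightarrow> bool" where
  "dominated_op M A h \<longleftrightarrow> h \<in> L2 M \<and>
     (\<forall>f\<in>L2 M. A f \<in> borel_measurable M) \<and>
     (\<forall>f\<in>L2 M. \<forall>g\<in>L2 M. \<forall>x\<in>space M. A (\<lambda>y. f y + g y) x = A f x + A g x) \<and>
     (\<forall>c. \<forall>f\<in>L2 M. \<forall>x\<in>space M. A (\<lambda>y. c *s f y) x = c *s A f x) \<and>
     (\<forall>f\<in>L2 M. \<forall>x\<in>space M. norm (A f x) \<le> h x * L2_norm M f)"

lemma dominated_opD: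
  assumes "dominated_op M A h"
  shows "h \<in> L2 M" "f \<in> L2 M \<Longrightarrow> A f \<in> borel_measurable M"
    "f \<in> L2 M \<Longrightarrow> g \<in> L2 M \<Longrightarrow> x \<in> space M \<Longrightarrow> A (\<lambda>y. f y + g y) x = A f x + A g x"
    "f \<in> L2 M \<Longrightarrow> x \<in> space M \<Longrightarrow> A (\<lambda>y. c *s f y) x = c *s A f x"
    "f \<in> L2 M \<Longrightarrow> x \<in> space M \<Longrightarrow> norm (A f x) \<le> h x * L2_norm M f"
  using assms by (auto simp: dominated_op_def)

lemma dominated_op_L2:
  assumes A: "dominated_op M A h" and f: "f \<in> L2 M"
  shows "A f \<in> L2 M" "L2_norm M (A f) \<le> L2_norm M h * L2_norm M f"
proof -
  note h = dominated_opD(1)[OF A]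
  have g: "(\<lambda>x. h x * L2_norm M f) \<in> L2 M"
    using L2_integrable_power2[OF h] L2_measurable[OF h] by (simp add: L2_def power_mult_distrib)
  have n: "L2_norm M (\<lambda>x. h x * L2_norm M f) = L2_norm M h * L2_norm M f"
    by (simp add: L2_norm_def power_mult_distrib real_sqrt_mult)
  have le: "AE x in M. norm (A f x) \<le> norm (h x * L2_norm M f)"
    using dominated_opD(5)[OF A f] by (intro AE_I2) (force intro: order_trans)
  show "A f \<in> L2 M" "L2_norm M (A f) \<le> L2_norm M h * L2_norm M f"
    using L2_dominated[OF g dominated_opD(2)[OF A f] le] by (simp_all add: n)
qed

lemma dominated_op_bounded:
  assumes A: "dominated_op M A h"
  shows "bounded_operator M A"
  unfolding bounded_operator_def
  using dominated_op_L2[OF A] dominated_opD(3,4)[OF A] by (auto intro!: AE_I2)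

lemma dominated_op_sum:
  assumes A: "dominated_op M A h" and f: "\<And>i. i \<in> I \<Longrightarrow> f i \<in> L2 M" and x: "x \<in> space M" and I: "finite I"
  shows "A (\<lambda>y. \<Sum>i\<in>I. c i *s f i y) x = (\<Sum>i\<in>I. c i *s A (f i) x)"
  using I f
proof (induction I)
  case empty
  have "A (\<lambda>y. 0 *s (0::complex^'a)) x = 0 *s A (\<lambda>y. 0) x"
    by (rule dominated_opD(4)[OF A _ x]) simp
  then show ?case by simp
next
  case (insert i I)
  have "A (\<lambda>y. c i *s f i y + (\<Sum>i\<in>I. c i *s f i y)) x = A (\<lambda>y. c i *s f i y) x + A (\<lambda>y. \<Sum>i\<in>I. c i *s f i y) x"
    using insert by (intro dominated_opD(3)[OF A _ _ x] L2_smult L2_sum) auto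
  then show ?case using insert dominated_opD(4)[OF A _ x, of "f i" "c i"] by simp
qed

lemma dominated_op_diff:
  assumes A: "dominated_op M A h" and f: "f \<in> L2 M" and g: "g \<in> L2 M" and x: "x \<in> space M"
  shows "A (\<lambda>y. f y - g y) x = A f x - A g x"
  using dominated_opD(3)[OF A f L2_smult(1)[OF g, of "-1"] x] dominated_opD(4)[OF A g x, of "-1"] by simp

lemma dominated_op_add:
  fixes A B :: "'m::finite operator"
  assumes A: "dominated_op M A h" and B: "dominated_op M B k"
  shows "dominated_op M (\<lambda>f x. A f x + B f x) (\<lambda>x. h x + k x)"
  unfolding dominated_op_def
proof (intro conjI ballI allI)
  show "(\<lambda>x. h x + k x) \<in> L2 M" by (rule L2_add(1)[OF dominated_opD(1)[OF A] dominated_opD(1)[OF B]])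
  fix f :: "real \<Rightarrow> complex^'m" assume f: "f \<in> L2 M"
  show "(\<lambda>x. A f x + B f x) \<in> borel_measurable M" using dominated_opD(2)[OF A f] dominated_opD(2)[OF B f] by measurable
  fix x assume x: "x \<in> space M"
  show "norm (A f x + B f x) \<le> (h x + k x) * L2_norm M f"
    using norm_triangle_ineq[of "A f x" "B f x"] dominated_opD(5)[OF A f x] dominated_opD(5)[OF B f x]
    by (simp add: distrib_right)
  show "A (\<lambda>y. d *s f y) x + B (\<lambda>y. d *s f y) x = d *s (A f x + B f x)" for d
    by (simp add: dominated_opD(4)[OF A f x] dominated_opD(4)[OF B f x] vector_add_ldistrib)
  fix g :: "real \<Rightarrow> complex^'m" assume "g \<in> L2 M"
  then show "A (\<lambda>y. f y + g y) x + B (\<lambda>y. f y + g y) x = A f x + B f x + (A g x + B g x)"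
    by (simp add: dominated_opD(3)[OF A f _ x] dominated_opD(3)[OF B f _ x])
qed

text \<open>For fixed \<open>x\<close>, each component of \<open>f \<mapsto> A f x\<close> is a functional of norm at most \<open>h x\<close>; testing it
  on \<open>\<Sum>i\<in>I. cnj (c i) *s e i\<close> bounds the sum of the \<open>(cmod (c i))\<^sup>2\<close>, \<open>c i\<close> being its value at \<open>e i\<close>.\<close>

lemma dominated_op_hs_bound:
  fixes A :: "'m::finite operator"
  assumes A: "dominated_op M A h" and e: "orthonormal_on M I e" and I: "finite I"
  shows "(\<Sum>i\<in>I. (L2_norm M (A (e i)))\<^sup>2) \<le> real CARD('m) * (L2_norm M h)\<^sup>2"
proof -
  note h = dominated_opD(1)[OF A]
  have eL2: "e i \<in> L2 M" if "i \<in> I" for i using e that by (simp add: orthonormal_on_def)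
  have comp: "(\<Sum>i\<in>I. (cmod (A (e i) x $ p))\<^sup>2) \<le> (h x)\<^sup>2" if x: "x \<in> space M" for x p
  proof -
    define c where "c = (\<lambda>i. A (e i) x $ p)"
    define s where "s = (\<Sum>i\<in>I. (cmod (c i))\<^sup>2)"
    have s0: "0 \<le> s" unfolding s_def by (intro sum_nonneg) auto
    let ?f = "\<lambda>y. \<Sum>i\<in>I. cnj (c i) *s e i y"
    have f: "?f \<in> L2 M" by (rule orthonormal_sum_L2[OF e])
    have "A ?f x = (\<Sum>i\<in>I. cnj (c i) *s A (e i) x)" by (rule dominated_op_sum[OF A eL2 x I])
    then have "A ?f x $ p = (\<Sum>i\<in>I. c i * cnj (c i))" by (simp add: c_def mult.commute)
    also have "\<dots> = complex_of_real s" by (simp only: s_def of_real_sum complex_norm_square)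
    finally have "cmod (A ?f x $ p) = s" using s0 by simp
    moreover have "cmod (A ?f x $ p) \<le> norm (A ?f x)" by (rule Finite_Cartesian_Product.norm_nth_le)
    ultimately have "s \<le> norm (A ?f x)" by simp
    also have "\<dots> \<le> h x * L2_norm M ?f" by (rule dominated_opD(5)[OF A f x])
    also have "L2_norm M ?f = sqrt s"
      using orthonormal_pythagoras[OF e I, of "\<lambda>i. cnj (c i)"] by (simp add: s_def real_sqrt_unique)
    finally have le: "s \<le> h x * sqrt s" .
    have "s\<^sup>2 \<le> (h x * sqrt s)\<^sup>2" by (intro power_mono le s0)
    moreover have "(h x * sqrt s)\<^sup>2 = (h x)\<^sup>2 * s" using s0 by (simp add: power_mult_distrib)
    ultimately have "s * s \<le> (h x)\<^sup>2 * s" by (simp only: power2_eq_square[of s])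
    then have "s \<le> (h x)\<^sup>2" using s0 by (cases "s = 0") (auto simp: mult_le_cancel_right)
    then show ?thesis by (simp add: s_def c_def)
  qed
  have pt: "(\<Sum>i\<in>I. (norm (A (e i) x))\<^sup>2) \<le> real CARD('m) * (h x)\<^sup>2" if x: "x \<in> space M" for x
  proof -
    have "(\<Sum>i\<in>I. (norm (A (e i) x))\<^sup>2) = (\<Sum>p\<in>UNIV. \<Sum>i\<in>I. (cmod (A (e i) x $ p))\<^sup>2)"
      by (subst sum.swap) (simp add: norm_vec_def L2_set_def sum_nonneg)
    also have "\<dots> \<le> (\<Sum>p\<in>(UNIV::'m set). (h x)\<^sup>2)" by (intro sum_mono comp x)
    finally show ?thesis by simp
  qed
  have "(\<Sum>i\<in>I. (L2_norm M (A (e i)))\<^sup>2) = (LINT x|M. (\<Sum>i\<in>I. (norm (A (e i) x))\<^sup>2))"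
    unfolding L2_norm_power2 using dominated_op_L2(1)[OF A eL2]
    by (intro Bochner_Integration.integral_sum[symmetric] L2_integrable_power2)
  also have "\<dots> \<le> (LINT x|M. real CARD('m) * (h x)\<^sup>2)"
  proof (intro integral_mono Bochner_Integration.integrable_sum L2_integrable_power2 pt)
    show "integrable M (\<lambda>x. real CARD('m) * (h x)\<^sup>2)" using L2_integrable_power2[OF h] by simp
  qed (use dominated_op_L2(1)[OF A eL2] in auto)
  also have "\<dots> = real CARD('m) * (L2_norm M h)\<^sup>2" by (simp add: L2_norm_power2)
  finally show ?thesis .
qed

lemma dominated_op_hilbert_schmidt:
  fixes A :: "'m::finite operator"
  assumes A: "dominated_op M A h"
  shows "hilbert_schmidt M A"
  unfolding hilbert_schmidt_def
proof (intro conjI allI impI dominated_op_bounded[OF A])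
  fix e :: "nat \<Rightarrow> real \<Rightarrow> complex^'m" assume "orthonormal_basis M e"
  then have "orthonormal_on M I e" for I by (rule orthonormal_basis_imp_on)
  from dominated_op_hs_bound[OF A this]
  show "summable (\<lambda>i. (L2_norm M (A (e i)))\<^sup>2)"
    by (intro bounded_imp_summable) auto
qed

definition op_matrix :: "real measure \<Rightarrow> 'm::finite operator \<Rightarrow> (nat \<Rightarrow> real \<Rightarrow> complex^'m) \<Rightarrow> nat \<Rightarrow> nat \<Rightarrow> complex" where
  "op_matrix M A e i j = L2_inner M (A (e j)) (e i)"

lemma orthonormal_basis_L2: "orthonormal_basis M e \<Longrightarrow> e i \<in> L2 M"
  by (simp add: orthonormal_basis_def)

text \<open>Bessel's inequality column by column. The bound is linear in the norm of
  \<open>h\<close>: operators whose difference has a small dominating function are close in all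
  sections at once.\<close>

lemma hs_op_matrix_le:
  fixes A :: "'m::finite operator"
  assumes A: "dominated_op M A h" and e: "orthonormal_basis M e"
  shows "hs N (op_matrix M A e) \<le> sqrt (real CARD('m)) * L2_norm M h"
proof (rule power2_le_imp_le)
  note on = orthonormal_basis_imp_on[OF e]
  have "(hs N (op_matrix M A e))\<^sup>2 = (\<Sum>j<N. \<Sum>i<N. (cmod (L2_inner M (A (e j)) (e i)))\<^sup>2)"
    unfolding hs_power2 op_matrix_def by (rule sum.swap)
  also have "\<dots> \<le> (\<Sum>j<N. (L2_norm M (A (e j)))\<^sup>2)"
    by (intro sum_mono bessel_inequality[OF on] dominated_op_L2[OF A] orthonormal_basis_L2[OF e]) auto
  also have "\<dots> \<le> real CARD('m) * (L2_norm M h)\<^sup>2" by (rule dominated_op_hs_bound[OF A on]) simp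
  finally show "(hs N (op_matrix M A e))\<^sup>2 \<le> (sqrt (real CARD('m)) * L2_norm M h)\<^sup>2"
    by (simp add: power_mult_distrib)
qed simp

lemma dominated_op_power_L2:
  assumes A: "dominated_op M A h" and f: "f \<in> L2 M"
  shows "(A ^^ k) f \<in> L2 M" "L2_norm M ((A ^^ k) f) \<le> L2_norm M h ^ k * L2_norm M f"
proof -
  have "(A ^^ k) f \<in> L2 M \<and> L2_norm M ((A ^^ k) f) \<le> L2_norm M h ^ k * L2_norm M f"
  proof (induction k)
    case (Suc k)
    then have "L2_norm M (A ((A ^^ k) f)) \<le> L2_norm M h * L2_norm M ((A ^^ k) f)"
      by (intro dominated_op_L2[OF A]) auto
    also have "\<dots> \<le> L2_norm M h * (L2_norm M h ^ k * L2_norm M f)" using Suc by (intro mult_left_mono) auto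
    finally show ?case using Suc dominated_op_L2(1)[OF A] by (simp add: mult_ac)
  qed (simp add: f)
  then show "(A ^^ k) f \<in> L2 M" "L2_norm M ((A ^^ k) f) \<le> L2_norm M h ^ k * L2_norm M f" by auto
qed

lemma L2_op_tendsto:
  fixes A :: "'m::finite operator"
  assumes A: "dominated_op M A h" and s: "\<And>n. s n \<in> L2 M" and u: "u \<in> L2 M"
    and lim: "(\<lambda>n. L2_norm M (\<lambda>x. s n x - u x)) \<longlonglongrightarrow> 0"
  shows "(\<lambda>n. L2_norm M (\<lambda>x. A (s n) x - A u x)) \<longlonglongrightarrow> 0"
proof -
  have le: "norm (L2_norm M (\<lambda>x. A (s n) x - A u x)) \<le> L2_norm M h * L2_norm M (\<lambda>x. s n x - u x)" for n
  proof -
    have "L2_norm M (\<lambda>x. A (s n) x - A u x) = L2_norm M (A (\<lambda>x. s n x - u x))"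
      using dominated_op_diff[OF A s u]
      by (intro L2_norm_cong_AE AE_I2 L2_measurable) (auto intro!: L2_diff(1) dominated_op_L2(1)[OF A] s u)
    then show ?thesis using dominated_op_L2(2)[OF A L2_diff(1)[OF s[of n] u]] by simp
  qed
  have "(\<lambda>n. L2_norm M h * L2_norm M (\<lambda>x. s n x - u x)) \<longlonglongrightarrow> 0" using tendsto_mult_left[OF lim] by simp
  then show ?thesis by (rule Lim_null_comparison[OF always_eventually[OF allI[OF le]]])
qed

text \<open>Let P_L be the projection onto the first L basis vectors. The function
  \<open>u k L\<close> whose coordinates are column \<open>j\<close> of the power of the section
  satisfies u (k+1) L = P_L A (u k L). As the P_L are contractions converging strongly to the
  identity, u k L tends to A^k e_j in norm.\<close>

lemma mpow_op_matrix_tendsto: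
  fixes A :: "'m::finite operator"
  assumes M: "sigma_finite_measure M" and A: "dominated_op M A h" and e: "orthonormal_basis M e"
  shows "(\<lambda>L. mpow L (op_matrix M A e) k i j) \<longlonglongrightarrow> L2_inner M ((A ^^ k) (e j)) (e i)"
proof -
  note on = orthonormal_basis_imp_on[OF e]
  note eL2 = orthonormal_basis_L2[OF e]
  define u where "u = (\<lambda>k L x. \<Sum>l<L. mpow L (op_matrix M A e) k l j *s e l x)"
  have uL2: "u k L \<in> L2 M" for k L unfolding u_def by (rule orthonormal_sum_L2[OF on])
  have lim: "(\<lambda>L. L2_norm M (\<lambda>x. u k L x - (A ^^ k) (e j) x)) \<longlonglongrightarrow> 0" for k
  proof (induction k)
    case 0
    have "u 0 L x = e j x" if "j < L" for L x
    proof -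
      have "u 0 L x = (\<Sum>l<L. if l = j then e j x else 0)"
        unfolding u_def by (intro sum.cong) (auto simp: kron_def)
      then show ?thesis using that by simp
    qed
    then have "eventually (\<lambda>L. L2_norm M (\<lambda>x. u 0 L x - (A ^^ 0) (e j) x) = 0) sequentially"
      by (intro eventually_sequentiallyI[of "Suc j"]) simp
    then show ?case by (rule tendsto_eventually)
  next
    case (Suc k)
    define g where "g = (A ^^ k) (e j)"
    have g: "g \<in> L2 M" unfolding g_def by (rule dominated_op_power_L2[OF A eL2])
    have Ag: "A g \<in> L2 M" and Au: "A (u k L) \<in> L2 M" for L
      by (rule dominated_op_L2[OF A] g uL2)+
    define P where "P = (\<lambda>L (f :: real \<Rightarrow> complex^'m) x. \<Sum>i<L. L2_inner M f (e i) *s e i x)"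
    have PL2: "P L f \<in> L2 M" for L f unfolding P_def by (rule orthonormal_sum_L2[OF on])
    have uS: "u (Suc k) L = P L (A (u k L))" for L
    proof -
      have "mpow L (op_matrix M A e) (Suc k) i j = L2_inner M (A (u k L)) (e i)" for i
      proof -
        have "L2_inner M (A (u k L)) (e i) = L2_inner M (\<lambda>x. \<Sum>l<L. mpow L (op_matrix M A e) k l j *s A (e l) x) (e i)"
          unfolding u_def using dominated_op_sum[OF A eL2 _ finite_lessThan] dominated_op_L2(1)[OF A eL2] eL2
            dominated_op_L2(1)[OF A orthonormal_sum_L2[OF on]]
          by (intro L2_inner_cong_AE AE_I2 L2_measurable L2_sum L2_smult) auto
        also have "\<dots> = (\<Sum>l<L. mpow L (op_matrix M A e) k l j * L2_inner M (A (e l)) (e i))"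
          using dominated_op_L2(1)[OF A eL2] eL2
          by (subst L2_inner_sum_left) (auto simp: L2_smult L2_inner_smult_left)
        finally show ?thesis by (simp add: mm_def op_matrix_def mult.commute)
      qed
      then show ?thesis unfolding P_def u_def by simp
    qed
    have Pd: "L2_norm M (\<lambda>x. P L (A (u k L)) x - P L (A g) x) \<le> L2_norm M (\<lambda>x. A (u k L) x - A g x)" for L
    proof (rule power2_le_imp_le)
      have "P L (A (u k L)) x - P L (A g) x = (\<Sum>i<L. L2_inner M (\<lambda>x. A (u k L) x - A g x) (e i) *s e i x)" for x
        by (simp add: P_def L2_inner_diff_left[OF Au Ag eL2] vec_eq_iff sum_subtractf left_diff_distrib)
      then have "(L2_norm M (\<lambda>x. P L (A (u k L)) x - P L (A g) x))\<^sup>2 = (\<Sum>i<L. (cmod (L2_inner M (\<lambda>x. A (u k L) x - A g x) (e i)))\<^sup>2)"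
        using orthonormal_pythagoras[OF on, of "{..<L}"] by simp
      also have "\<dots> \<le> (L2_norm M (\<lambda>x. A (u k L) x - A g x))\<^sup>2"
        by (intro bessel_inequality[OF on] L2_diff Au Ag) auto
      finally show "(L2_norm M (\<lambda>x. P L (A (u k L)) x - P L (A g) x))\<^sup>2 \<le> (L2_norm M (\<lambda>x. A (u k L) x - A g x))\<^sup>2" .
    qed simp
    have bd: "norm (L2_norm M (\<lambda>x. u (Suc k) L x - A g x)) \<le>
        L2_norm M (\<lambda>x. A (u k L) x - A g x) + L2_norm M (\<lambda>x. P L (A g) x - A g x)" for L
      using L2_norm_triangle3[OF PL2[of L "A (u k L)"] PL2[of L "A g"] Ag] Pd[of L] by (simp add: uS)
    have "(\<lambda>L. L2_norm M (\<lambda>x. A (u k L) x - A g x) + L2_norm M (\<lambda>x. P L (A g) x - A g x)) \<longlonglongrightarrow> 0 + 0"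
      unfolding P_def using Suc by (intro tendsto_add L2_op_tendsto[OF A uL2 g] parseval_expansion[OF M e Ag]) (simp add: g_def)
    then have "(\<lambda>L. L2_norm M (\<lambda>x. u (Suc k) L x - A g x)) \<longlonglongrightarrow> 0"
      by (intro Lim_null_comparison[OF always_eventually[OF allI[OF bd]]]) simp
    then show ?case by (simp add: g_def)
  qed
  have "(\<lambda>L. L2_inner M (u k L) (e i)) \<longlonglongrightarrow> L2_inner M ((A ^^ k) (e j)) (e i)"
    by (intro L2_inner_tendsto[OF uL2 _ eL2 lim] dominated_op_power_L2[OF A eL2])
  moreover have "eventually (\<lambda>L. L2_inner M (u k L) (e i) = mpow L (op_matrix M A e) k i j) sequentially"
    unfolding u_def
    using orthonormal_coeff[OF on finite_lessThan] by (intro eventually_sequentiallyI[of "Suc i"]) simp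
  ultimately show ?thesis by (rule Lim_transform_eventually)
qed

text \<open>The choice in \<open>op_exp\<close> is meaningful once a limit exists. The series is
  dominated term by term by the scalar series of \<open>exp C\<close>, \<open>C\<close> being the
  norm of the dominating function, and L2 is complete.\<close>

lemma op_exp_properties:
  fixes A :: "'m::finite operator"
  assumes M: "sigma_finite_measure M" and A: "dominated_op M A h" and f: "f \<in> L2 M"
  shows "op_exp M A f \<in> L2 M"
    and "(\<lambda>N. L2_norm M (\<lambda>x. op_exp M A f x - (\<Sum>k<N. (1 / fact k) *s (A ^^ k) f x))) \<longlonglongrightarrow> 0"
proof -
  define s where "s = (\<lambda>N x. \<Sum>k<N. (1 / fact k) *s (A ^^ k) f x)"
  define C where "C = L2_norm M h"
  note pL2 = dominated_op_power_L2[OF A f]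
  have s: "s N \<in> L2 M" for N unfolding s_def by (intro L2_sum L2_smult pL2)
  have sd: "L2_norm M (\<lambda>x. s j x - s i x) \<le> L2_norm M f * ((\<Sum>k<j. C ^ k / fact k) - (\<Sum>k<i. C ^ k / fact k))" if "i \<le> j" for i j
  proof -
    have "s j x - s i x = (\<Sum>k\<in>{i..<j}. (1 / fact k) *s (A ^^ k) f x)" for x
      unfolding s_def using sum_diff_nat_ivl[of 0 i j "\<lambda>k. (1 / fact k) *s (A ^^ k) f x"] that by (simp add: atLeast0LessThan)
    then have "L2_norm M (\<lambda>x. s j x - s i x) \<le> (\<Sum>k\<in>{i..<j}. L2_norm M (\<lambda>x. (1 / fact k) *s (A ^^ k) f x))"
      by (simp only:) (intro L2_sum L2_smult pL2)
    also have "\<dots> \<le> (\<Sum>k\<in>{i..<j}. L2_norm M f * (C ^ k / fact k))"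
    proof (intro sum_mono)
      fix k
      have "L2_norm M (\<lambda>x. (1 / fact k) *s (A ^^ k) f x) = L2_norm M ((A ^^ k) f) / fact k"
        by (simp add: L2_smult(2)[OF pL2(1)] norm_divide)
      also have "\<dots> \<le> C ^ k * L2_norm M f / fact k" using pL2(2) by (intro divide_right_mono) (auto simp: C_def)
      finally show "L2_norm M (\<lambda>x. (1 / fact k) *s (A ^^ k) f x) \<le> L2_norm M f * (C ^ k / fact k)" by (simp add: mult.commute)
    qed
    also have "\<dots> = L2_norm M f * ((\<Sum>k<j. C ^ k / fact k) - (\<Sum>k<i. C ^ k / fact k))"
      using sum_diff_nat_ivl[of 0 i j "\<lambda>k. C ^ k / fact k"] that by (simp add: atLeast0LessThan sum_distrib_left)
    finally show ?thesis .
  qed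
  have "summable (\<lambda>k. C ^ k / fact k)" using summable_exp[of C] by (simp add: divide_inverse mult.commute)
  then have "Cauchy (\<lambda>N. L2_norm M f * (\<Sum>k<N. C ^ k / fact k))"
    by (intro convergent_Cauchy convergent_mult convergent_const) (simp add: summable_iff_convergent)
  then have cau: "\<exists>N. \<forall>i\<ge>N. \<forall>j\<ge>N. L2_norm M (\<lambda>x. s i x - s j x) < d" if d: "0 < d" for d
  proof -
    from \<open>Cauchy _\<close> d obtain N where N: "\<And>i j. i \<ge> N \<Longrightarrow> j \<ge> N \<Longrightarrow>
        \<bar>L2_norm M f * (\<Sum>k<j. C ^ k / fact k) - L2_norm M f * (\<Sum>k<i. C ^ k / fact k)\<bar> < d"
      unfolding Cauchy_def dist_real_def by blast
    have "L2_norm M (\<lambda>x. s i x - s j x) < d" if ij: "i \<ge> N" "j \<ge> N" for i j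
    proof (cases "i \<le> j")
      case True
      then show ?thesis using sd[OF True] N[OF ij] L2_norm_minus_commute[of M "s i" "s j"] by (simp add: right_diff_distrib)
    next
      case False
      then show ?thesis using sd[of j i] N[OF ij(2,1)] by (simp add: right_diff_distrib)
    qed
    then show ?thesis by blast
  qed
  obtain u where "u \<in> L2 M" "(\<lambda>n. L2_norm M (\<lambda>x. s n x - u x)) \<longlonglongrightarrow> 0"
    using L2_complete[OF M s cau] by blast
  then have "\<exists>u. u \<in> L2 M \<and> (\<lambda>N. L2_norm M (\<lambda>x. u x - (\<Sum>k<N. (1 / fact k) *s (A ^^ k) f x))) \<longlonglongrightarrow> 0"
    by (auto simp: s_def L2_norm_minus_commute[of M u])
  from someI_ex[OF this]
  show "op_exp M A f \<in> L2 M"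
    and "(\<lambda>N. L2_norm M (\<lambda>x. op_exp M A f x - (\<Sum>k<N. (1 / fact k) *s (A ^^ k) f x))) \<longlonglongrightarrow> 0"
    unfolding op_exp_def by auto
qed

text \<open>The abstract \<open>P\<close> and \<open>C\<close> of \<open>det_exp_sections\<close>
  become matrix elements of the powers and of (I - A) exp A. Continuity of A and of the inner
  product turns norm convergence of the exponential series into convergence of each entry.\<close>

lemma det_sections_exp:
  fixes A :: "'m::finite operator"
  assumes M: "sigma_finite_measure M" and A: "dominated_op M A h" and e: "orthonormal_basis M e"
  shows "(\<lambda>N. Determinant.det (Matrix.mat N N (\<lambda>(i,j). L2_inner M ((op_I_minus 1 A \<circ> op_exp M A) (e j)) (e i)))
             - det2 N (op_matrix M A e)) \<longlonglongrightarrow> 0"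
proof -
  note eL2 = orthonormal_basis_L2[OF e]
  define P where "P = (\<lambda>k i j. L2_inner M ((A ^^ k) (e j)) (e i))"
  define C where "C = (\<lambda>i j. L2_inner M ((op_I_minus 1 A \<circ> op_exp M A) (e j)) (e i))"
  have "(\<lambda>n. \<Sum>k<n. (P k i j - P (Suc k) i j) / fact k) \<longlonglongrightarrow> C i j" for i j
  proof -
    define u where "u = op_exp M A (e j)"
    define s where "s = (\<lambda>N x. \<Sum>k<N. (1 / fact k) *s (A ^^ k) (e j) x)"
    note pL2 = dominated_op_power_L2(1)[OF A eL2[of j]]
    have s: "s N \<in> L2 M" for N unfolding s_def by (intro L2_sum L2_smult pL2)
    have u: "u \<in> L2 M" unfolding u_def by (rule op_exp_properties[OF M A eL2])
    have lim: "(\<lambda>N. L2_norm M (\<lambda>x. s N x - u x)) \<longlonglongrightarrow> 0"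
      using op_exp_properties(2)[OF M A eL2[of j]] by (simp add: s_def u_def L2_norm_minus_commute[of M "op_exp M A (e j)"])
    have As: "A (s n) \<in> L2 M" "A u \<in> L2 M" for n by (rule dominated_op_L2[OF A] s u)+
    have "(\<lambda>n. L2_inner M (s n) (e i) - L2_inner M (A (s n)) (e i)) \<longlonglongrightarrow> L2_inner M u (e i) - L2_inner M (A u) (e i)"
      by (intro tendsto_diff L2_inner_tendsto[OF s u eL2 lim] L2_inner_tendsto[OF As eL2] L2_op_tendsto[OF A s u lim])
    moreover have "L2_inner M (s n) (e i) = (\<Sum>k<n. P k i j / fact k)" for n
      unfolding s_def P_def by (subst L2_inner_sum_left) (auto simp: L2_smult pL2 eL2 L2_inner_smult_left)
    moreover have "L2_inner M (A (s n)) (e i) = (\<Sum>k<n. P (Suc k) i j / fact k)" for n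
    proof -
      have "L2_inner M (A (s n)) (e i) = L2_inner M (\<lambda>x. \<Sum>k<n. (1 / fact k) *s A ((A ^^ k) (e j)) x) (e i)"
        unfolding s_def using dominated_op_sum[OF A pL2 _ finite_lessThan] As(1)[of n] dominated_op_L2(1)[OF A pL2] eL2
        by (intro L2_inner_cong_AE AE_I2 L2_measurable L2_sum L2_smult) (auto simp: s_def)
      also have "\<dots> = (\<Sum>k<n. P (Suc k) i j / fact k)"
        unfolding P_def using dominated_op_L2(1)[OF A pL2]
        by (subst L2_inner_sum_left) (auto simp: L2_smult eL2 L2_inner_smult_left)
      finally show ?thesis .
    qed
    moreover have "L2_inner M u (e i) - L2_inner M (A u) (e i) = C i j"
      unfolding C_def by (simp add: op_I_minus_def u_def[symmetric] L2_inner_diff_left[OF u As(2) eL2])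
    ultimately show ?thesis by (simp add: sum_subtractf diff_divide_distrib)
  qed
  moreover have "(\<lambda>L. mpow L (op_matrix M A e) k i j) \<longlonglongrightarrow> P k i j" for k i j
    unfolding P_def by (rule mpow_op_matrix_tendsto[OF M A e])
  ultimately have "(\<lambda>N. Determinant.det (sec N C) - det2 N (op_matrix M A e)) \<longlonglongrightarrow> 0"
    by (intro det_exp_sections[OF hs_op_matrix_le[OF A e]])
  then
  show ?thesis by (simp add: C_def sec_def case_prod_unfold)
qed

text \<open>\<open>fredholm_det\<close> describes a limit common to all bases: \<open>lim\<close>
  shows that \<open>d\<close> qualifies, and the basis given by \<open>ex\<close> excludes any other
  value.\<close>

lemma det2_I_minus_eqI:
  fixes A :: "'m::finite operator"
  assumes M: "sigma_finite_measure M" and A: "dominated_op M A h"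
    and ex: "\<exists>e :: nat \<Rightarrow> real \<Rightarrow> complex^'m. orthonormal_basis M e"
    and lim: "\<And>e. orthonormal_basis M e \<Longrightarrow> (\<lambda>N. det2 N (op_matrix M A e)) \<longlonglongrightarrow> d"
  shows "det2_I_minus M A = d"
proof -
  let ?D = "\<lambda>e N. Determinant.det (Matrix.mat N N (\<lambda>(i,j). L2_inner M ((op_I_minus 1 A \<circ> op_exp M A) (e j)) (e i)))"
  have L: "?D e \<longlonglongrightarrow> d" if e: "orthonormal_basis M e" for e
    using tendsto_add[OF det_sections_exp[OF M A e] lim[OF e]] by simp
  obtain e0 :: "nat \<Rightarrow> real \<Rightarrow> complex^'m" where e0: "orthonormal_basis M e0" using ex by blast
  have "fredholm_det M (op_I_minus 1 A \<circ> op_exp M A) = d"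
    unfolding fredholm_det_def
  proof (rule the_equality)
    fix d' assume "\<forall>e. orthonormal_basis M e \<longrightarrow> ?D e \<longlonglongrightarrow> d'"
    then show "d' = d" using L[OF e0] e0 LIMSEQ_unique by blast
  qed (use L in blast)
  then show ?thesis
    using dominated_op_hilbert_schmidt[OF A] by (simp add: det2_I_minus_def)
qed

text \<open>The inverse of I - A enters through a solution \<open>V\<close> of (I - A) V = W, so
  that explicit solutions of the integral equations can be inserted.\<close>

lemma det2_finite_rank_perturbation:
  fixes A B :: "'m::finite operator"
  assumes M: "sigma_finite_measure M" and A: "dominated_op M A h" and B: "dominated_op M B k"
    and e: "orthonormal_basis M e"
    and L2: "\<And>q. q < c \<Longrightarrow> V q \<in> L2 M" "\<And>q. q < c \<Longrightarrow> W q \<in> L2 M" "\<And>q. q < c \<Longrightarrow> \<rho> q \<in> L2 M"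
    and VW: "\<And>q. q < c \<Longrightarrow> AE x in M. W q x = V q x - A (V q) x"
    and BA: "\<And>f x. f \<in> L2 M \<Longrightarrow> x \<in> space M \<Longrightarrow> B f x = A f x + (\<Sum>q<c. L2_inner M f (\<rho> q) *s W q x)"
    and D: "(\<lambda>N. det2 N (op_matrix M A e)) \<longlonglongrightarrow> D"
  shows "(\<lambda>N. det2 N (op_matrix M B e)) \<longlonglongrightarrow>
     D * det_I_plus c (\<lambda>p q. - L2_inner M (V q) (\<rho> p)) * exp (\<Sum>q<c. L2_inner M (W q) (\<rho> q))"
proof -
  note eL2 = orthonormal_basis_L2[OF e]
  note on = orthonormal_basis_imp_on[OF e]
  define w where "w = (\<lambda>q i. L2_inner M (W q) (e i))"
  define v where "v = (\<lambda>q i. L2_inner M (V q) (e i))"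
  define r where "r = (\<lambda>q i. L2_inner M (e i) (\<rho> q))"
  have Bm: "op_matrix M B e i j = op_matrix M A e i j + (\<Sum>q<c. w q i * r q j)" for i j
  proof -
    have AL: "A (e j) \<in> L2 M" by (rule dominated_op_L2[OF A eL2])
    have SL: "(\<lambda>x. \<Sum>q<c. r q j *s W q x) \<in> L2 M" using L2 by (intro L2_sum L2_smult) auto
    have "op_matrix M B e i j = L2_inner M (\<lambda>x. A (e j) x + (\<Sum>q<c. r q j *s W q x)) (e i)"
      unfolding op_matrix_def r_def using BA[OF eL2] dominated_op_L2(1)[OF B eL2] L2_add(1)[OF AL SL] eL2
      by (intro L2_inner_cong_AE AE_I2 L2_measurable) (auto simp: r_def)
    also have "\<dots> = op_matrix M A e i j + L2_inner M (\<lambda>x. \<Sum>q<c. r q j *s W q x) (e i)"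
      unfolding op_matrix_def by (rule L2_inner_add_left[OF AL SL eL2])
    also have "L2_inner M (\<lambda>x. \<Sum>q<c. r q j *s W q x) (e i) = (\<Sum>q<c. w q i * r q j)"
      unfolding w_def using L2 by (subst L2_inner_sum_left) (auto simp: L2_smult eL2 L2_inner_smult_left mult.commute)
    finally show ?thesis .
  qed
  have "(\<lambda>N. det2 N (\<lambda>i j. op_matrix M A e i j + (\<Sum>q<c. w q i * r q j))) \<longlonglongrightarrow>
     D * det_I_plus c (\<lambda>p q. - L2_inner M (V q) (\<rho> p)) * exp (\<Sum>q<c. L2_inner M (W q) (\<rho> q))"
  proof (rule det2_rank_perturbation[OF _ _ _ D])
    show "hs N (\<lambda>i j. op_matrix M A e i j + (\<Sum>q<c. w q i * r q j)) \<le> sqrt (real CARD('m)) * L2_norm M k" for N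
      using hs_op_matrix_le[OF B e, of N] by (simp add: Bm[abs_def])
    show "(\<lambda>N. \<Sum>i<N. (cmod (w q i - v q i + (\<Sum>l<N. op_matrix M A e i l * v q l)))\<^sup>2) \<longlonglongrightarrow> 0" if q: "q < c" for q
    proof -
      note Vq = L2(1)[OF q] and Wq = L2(2)[OF q]
      define p where "p = (\<lambda>N x. \<Sum>l<N. v q l *s e l x)"
      have p: "p N \<in> L2 M" for N unfolding p_def by (rule orthonormal_sum_L2[OF on])
      have Ap: "A (p N) \<in> L2 M" and AV: "A (V q) \<in> L2 M" for N by (rule dominated_op_L2[OF A] p Vq)+
      \<comment> \<open>The residual of the section consists of the coefficients of
        \<open>A (p N) - A (V q)\<close>, where \<open>p N\<close> is the projection of
        \<open>V q\<close>. Bessel's inequality and continuity of \<open>A\<close> make it tend to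
        zero.\<close>
      have coeff: "w q i - v q i + (\<Sum>l<N. op_matrix M A e i l * v q l) = L2_inner M (\<lambda>x. A (p N) x - A (V q) x) (e i)" for N i
      proof -
        have "w q i = L2_inner M (\<lambda>x. V q x - A (V q) x) (e i)"
          unfolding w_def using VW[OF q] Wq L2_diff(1)[OF Vq AV] eL2 by (intro L2_inner_cong_AE L2_measurable)
        then have 1: "w q i = v q i - L2_inner M (A (V q)) (e i)"
          by (simp add: v_def L2_inner_diff_left[OF Vq AV eL2])
        have "L2_inner M (A (p N)) (e i) = L2_inner M (\<lambda>x. \<Sum>l<N. v q l *s A (e l) x) (e i)"
          unfolding p_def using dominated_op_sum[OF A eL2 _ finite_lessThan] Ap[of N] dominated_op_L2(1)[OF A eL2] eL2
          by (intro L2_inner_cong_AE AE_I2 L2_measurable L2_sum L2_smult) (auto simp: p_def)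
        also have "\<dots> = (\<Sum>l<N. op_matrix M A e i l * v q l)"
          using dominated_op_L2(1)[OF A eL2]
          by (subst L2_inner_sum_left) (auto simp: L2_smult eL2 L2_inner_smult_left op_matrix_def mult.commute)
        finally show ?thesis using 1 by (simp add: L2_inner_diff_left[OF Ap AV eL2])
      qed
      have le: "norm (\<Sum>i<N. (cmod (w q i - v q i + (\<Sum>l<N. op_matrix M A e i l * v q l)))\<^sup>2) \<le> (L2_norm M (\<lambda>x. A (p N) x - A (V q) x))\<^sup>2" for N
        unfolding coeff using bessel_inequality[OF on finite_lessThan L2_diff(1)[OF Ap AV]]
        by (simp add: sum_nonneg)
      have "(\<lambda>N. L2_norm M (\<lambda>x. A (p N) x - A (V q) x)) \<longlonglongrightarrow> 0"
        unfolding p_def v_def by (intro L2_op_tendsto[OF A _ Vq] orthonormal_sum_L2[OF on] parseval_expansion[OF M e Vq])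
      then have "(\<lambda>N. (L2_norm M (\<lambda>x. A (p N) x - A (V q) x))\<^sup>2) \<longlonglongrightarrow> 0\<^sup>2" by (rule tendsto_power)
      then show ?thesis by (intro Lim_null_comparison[OF always_eventually[OF allI[OF le]]]) simp
    qed
    show "(\<Sum>i<N. (cmod (r q i))\<^sup>2) \<le> (\<Sum>q<c. (L2_norm M (\<rho> q))\<^sup>2)" if q: "q < c" for q N
    proof -
      have "(\<Sum>i<N. (cmod (r q i))\<^sup>2) = (\<Sum>i<N. (cmod (L2_inner M (\<rho> q) (e i)))\<^sup>2)"
        unfolding r_def by (simp only: L2_inner_cnj[of M "e _" "\<rho> q"] complex_mod_cnj)
      also have "\<dots> \<le> (L2_norm M (\<rho> q))\<^sup>2" by (intro bessel_inequality[OF on] L2 q) auto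
      also have "\<dots> \<le> (\<Sum>q<c. (L2_norm M (\<rho> q))\<^sup>2)" using q by (intro member_le_sum) auto
      finally show ?thesis .
    qed
    show "(\<lambda>N. \<Sum>i<N. r p i * v q i) \<longlonglongrightarrow> L2_inner M (V q) (\<rho> p)" if "p < c" "q < c" for p q
      using parseval_sums[OF M e L2(1)[OF that(2)] L2(3)[OF that(1)]]
      by (simp add: sums_def r_def v_def mult.commute)
    show "(\<lambda>N. \<Sum>i<N. \<Sum>q<c. w q i * r q i) \<longlonglongrightarrow> (\<Sum>q<c. L2_inner M (W q) (\<rho> q))"
    proof -
      have "(\<lambda>N. \<Sum>q<c. \<Sum>i<N. w q i * r q i) \<longlonglongrightarrow> (\<Sum>q<c. L2_inner M (W q) (\<rho> q))"
        using parseval_sums[OF M e L2(2) L2(3)] by (intro tendsto_sum) (simp add: sums_def w_def r_def)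
      then show ?thesis by (subst sum.swap)
    qed
  qed
  then show ?thesis by (simp add: Bm[abs_def])
qed

section \<open>Volterra operators\<close>

text \<open>The region is a parameter so that the triangle, the staircase, the leftover near the
  diagonal and the whole square are instances of one construction.\<close>

definition kop :: "real measure \<Rightarrow> (real \<Rightarrow> real \<Rightarrow> bool) \<Rightarrow> nat \<Rightarrow> (nat \<Rightarrow> real \<Rightarrow> complex^'m) \<Rightarrow>
    (nat \<Rightarrow> real \<Rightarrow> complex^'m) \<Rightarrow> 'm::finite operator" where
  "kop M \<kappa> c \<phi> \<psi> u x = (\<Sum>q<c. (LINT y|M. (if \<kappa> x y then cdot (u y) (\<psi> q y) else 0)) *s \<phi> q x)"

text \<open>Cauchy-Schwarz in \<open>y\<close> for fixed \<open>x\<close>. Keeping the region inside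
  the norm lets the bound shrink with the region.\<close>

definition kop_bound :: "real measure \<Rightarrow> (real \<Rightarrow> real \<Rightarrow> bool) \<Rightarrow> nat \<Rightarrow> (nat \<Rightarrow> real \<Rightarrow> complex^'m) \<Rightarrow>
    (nat \<Rightarrow> real \<Rightarrow> complex^'m) \<Rightarrow> real \<Rightarrow> real" where
  "kop_bound M \<kappa> c \<phi> \<psi> x = (\<Sum>q<c. norm (\<phi> q x) * L2_norm M (\<lambda>y. if \<kappa> x y then \<psi> q y else 0))"

text \<open>Measurability of the identity makes the order regions measurable; sigma-finiteness gives
  completeness of L2 and measurability of integrals depending on a parameter.\<close>

locale line_measure = sigma_finite_measure M for M :: "real measure" +
  assumes id_measurable: "(\<lambda>x. x) \<in> borel_measurable M"
begin

definition region :: "(real \<Rightarrow> real \<Rightarrow> bool) \<Rightarrow> bool" where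
  "region \<kappa> \<longleftrightarrow> Measurable.pred (M \<Otimes>\<^sub>M M) (\<lambda>p. \<kappa> (fst p) (snd p))"

lemma region_section: "region \<kappa> \<Longrightarrow> x \<in> space M \<Longrightarrow> Measurable.pred M (\<kappa> x)"
  unfolding region_def using measurable_compose[OF measurable_Pair1'[of x M M], of "\<lambda>p. \<kappa> (fst p) (snd p)" "count_space UNIV"] by simp

lemma L2_restrict:
  fixes f :: "real \<Rightarrow> complex^'m"
  assumes f: "f \<in> L2 M" and \<kappa>: "region \<kappa>" and x: "x \<in> space M"
  shows "(\<lambda>y. if \<kappa> x y then f y else 0) \<in> L2 M"
    "L2_norm M (\<lambda>y. if \<kappa> x y then f y else 0) \<le> L2_norm M f"
proof -
  note [measurable] = region_section[OF \<kappa> x] L2_measurable[OF f]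
  have m: "(\<lambda>y. if \<kappa> x y then f y else 0) \<in> borel_measurable M" by measurable
  show "(\<lambda>y. if \<kappa> x y then f y else 0) \<in> L2 M" "L2_norm M (\<lambda>y. if \<kappa> x y then f y else 0) \<le> L2_norm M f"
    by (rule L2_dominated[OF f m]; simp)+
qed

lemma restricted_inner:
  "(LINT y|M. (if \<kappa> x y then cdot (u y) (\<psi> y) else 0)) = L2_inner M u (\<lambda>y. if \<kappa> x y then \<psi> y else 0)"
  unfolding L2_inner_cdot by (intro Bochner_Integration.integral_cong refl) (simp add: cdot_def)

lemma kop_inner:
  "kop M \<kappa> c \<phi> \<psi> u x = (\<Sum>q<c. L2_inner M u (\<lambda>y. if \<kappa> x y then \<psi> q y else 0) *s \<phi> q x)"
  unfolding kop_def by (simp only: restricted_inner)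

lemma measurable_restricted_integral:
  fixes F :: "real \<Rightarrow> 'b::{banach, second_countable_topology}"
  assumes F: "F \<in> borel_measurable M" and \<kappa>: "region \<kappa>"
  shows "(\<lambda>x. LINT y|M. (if \<kappa> x y then F y else 0)) \<in> borel_measurable M"
proof -
  have "(\<lambda>p. F (snd p)) \<in> borel_measurable (M \<Otimes>\<^sub>M M)" using F by measurable
  then have "(\<lambda>p. if \<kappa> (fst p) (snd p) then F (snd p) else 0) \<in> borel_measurable (M \<Otimes>\<^sub>M M)"
    using \<kappa> unfolding region_def by measurable
  then show ?thesis
    by (intro borel_measurable_lebesgue_integral) (simp add: case_prod_unfold)
qed

text \<open>The majorant \<open>?g\<close> does not see the region, so it can serve as a common
  dominating function while the region varies.\<close>

lemma kop_bound_L2: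
  assumes \<phi>: "\<And>q. q < c \<Longrightarrow> \<phi> q \<in> L2 M" and \<psi>: "\<And>q. q < c \<Longrightarrow> \<psi> q \<in> L2 M" and \<kappa>: "region \<kappa>"
  shows "(\<lambda>x. \<Sum>q<c. norm (\<phi> q x) * L2_norm M (\<psi> q)) \<in> L2 M" (is "?g \<in> _")
    and "x \<in> space M \<Longrightarrow> kop_bound M \<kappa> c \<phi> \<psi> x \<le> (\<Sum>q<c. norm (\<phi> q x) * L2_norm M (\<psi> q))"
    and "0 \<le> kop_bound M \<kappa> c \<phi> \<psi> x"
    and "kop_bound M \<kappa> c \<phi> \<psi> \<in> L2 M"
proof -
  have "(\<lambda>x. \<Sum>q\<in>I. norm (\<phi> q x) * L2_norm M (\<psi> q)) \<in> L2 M" if "I \<subseteq> {..<c}" "finite I" for I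
    using that(2,1)
  proof (induction I)
    case (insert q I)
    have "(\<lambda>x. norm (\<phi> q x) * L2_norm M (\<psi> q)) \<in> L2 M"
      using L2_integrable_power2[OF \<phi>[of q]] L2_measurable[OF \<phi>[of q]] insert by (simp add: L2_def power_mult_distrib)
    then show ?case using insert L2_add(1)[of _ M "\<lambda>x. \<Sum>q\<in>I. norm (\<phi> q x) * L2_norm M (\<psi> q)"] by simp
  qed simp
  then show g: "?g \<in> L2 M" by simp
  show le: "kop_bound M \<kappa> c \<phi> \<psi> x \<le> ?g x" if "x \<in> space M" for x
    unfolding kop_bound_def by (intro sum_mono mult_left_mono L2_restrict \<psi> \<kappa> that) auto
  show nn: "0 \<le> kop_bound M \<kappa> c \<phi> \<psi> x" for x
    unfolding kop_bound_def by (intro sum_nonneg mult_nonneg_nonneg) auto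
  have "(\<lambda>x. L2_norm M (\<lambda>y. if \<kappa> x y then \<psi> q y else 0)) \<in> borel_measurable M" if "q < c" for q
  proof -
    have "(\<lambda>y. (norm (\<psi> q y))\<^sup>2) \<in> borel_measurable M" using L2_measurable[OF \<psi>[OF that]] by measurable
    then have "(\<lambda>x. LINT y|M. (if \<kappa> x y then (norm (\<psi> q y))\<^sup>2 else 0)) \<in> borel_measurable M"
      using \<kappa> by (rule measurable_restricted_integral)
    moreover have "L2_norm M (\<lambda>y. if \<kappa> x y then \<psi> q y else 0) = sqrt (LINT y|M. (if \<kappa> x y then (norm (\<psi> q y))\<^sup>2 else 0))" for x
      unfolding L2_norm_def by (intro arg_cong[where f = sqrt] Bochner_Integration.integral_cong refl) auto
    ultimately show ?thesis by simp
  qed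
  then have m: "kop_bound M \<kappa> c \<phi> \<psi> \<in> borel_measurable M"
    unfolding kop_bound_def[abs_def] using L2_measurable[OF \<phi>]
    by (intro borel_measurable_sum borel_measurable_times borel_measurable_norm) auto
  have "AE x in M. norm (kop_bound M \<kappa> c \<phi> \<psi> x) \<le> norm (?g x)"
    using le nn by (intro AE_I2) (force intro: order_trans)
  then show "kop_bound M \<kappa> c \<phi> \<psi> \<in> L2 M" by (rule L2_dominated(1)[OF g m])
qed

lemma kop_dominated:
  fixes \<phi> \<psi> :: "nat \<Rightarrow> real \<Rightarrow> complex^'m::finite"
  assumes \<phi>: "\<And>q. q < c \<Longrightarrow> \<phi> q \<in> L2 M" and \<psi>: "\<And>q. q < c \<Longrightarrow> \<psi> q \<in> L2 M" and \<kappa>: "region \<kappa>"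
  shows "dominated_op M (kop M \<kappa> c \<phi> \<psi>) (kop_bound M \<kappa> c \<phi> \<psi>)"
  unfolding dominated_op_def
proof (intro conjI ballI allI)
  show "kop_bound M \<kappa> c \<phi> \<psi> \<in> L2 M" by (rule kop_bound_L2[OF \<phi> \<psi> \<kappa>])
  fix f :: "real \<Rightarrow> complex^'m" assume f: "f \<in> L2 M"
  show "kop M \<kappa> c \<phi> \<psi> f \<in> borel_measurable M"
    unfolding kop_def[abs_def] using L2_measurable[OF \<phi>] L2_measurable[OF \<psi>] L2_measurable[OF f]
    by (intro borel_measurable_sum measurable_smult_vec measurable_restricted_integral \<kappa> measurable_cdot) auto
  fix x assume x: "x \<in> space M"
  show "kop M \<kappa> c \<phi> \<psi> (\<lambda>y. d *s f y) x = d *s kop M \<kappa> c \<phi> \<psi> f x" for d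
    unfolding kop_inner L2_inner_smult_left by (simp add: vec_eq_iff sum_distrib_left mult_ac)
  show "norm (kop M \<kappa> c \<phi> \<psi> f x) \<le> kop_bound M \<kappa> c \<phi> \<psi> x * L2_norm M f"
    unfolding kop_inner kop_bound_def sum_distrib_right
  proof (intro sum_norm_le)
    fix q assume "q \<in> {..<c}"
    then have "cmod (L2_inner M f (\<lambda>y. if \<kappa> x y then \<psi> q y else 0)) * norm (\<phi> q x)
        \<le> (L2_norm M f * L2_norm M (\<lambda>y. if \<kappa> x y then \<psi> q y else 0)) * norm (\<phi> q x)"
      by (intro mult_right_mono L2_inner_bound f L2_restrict \<psi> \<kappa> x) auto
    then show "norm (L2_inner M f (\<lambda>y. if \<kappa> x y then \<psi> q y else 0) *s \<phi> q x)
        \<le> norm (\<phi> q x) * L2_norm M (\<lambda>y. if \<kappa> x y then \<psi> q y else 0) * L2_norm M f"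
      by (simp add: norm_smult_vec mult_ac)
  qed
  fix g :: "real \<Rightarrow> complex^'m" assume g: "g \<in> L2 M"
  have "L2_inner M (\<lambda>y. f y + g y) (\<lambda>y. if \<kappa> x y then \<psi> q y else 0) =
      L2_inner M f (\<lambda>y. if \<kappa> x y then \<psi> q y else 0) + L2_inner M g (\<lambda>y. if \<kappa> x y then \<psi> q y else 0)" if "q < c" for q
    by (rule L2_inner_add_left[OF f g L2_restrict(1)[OF \<psi>[OF that] \<kappa> x]])
  then show "kop M \<kappa> c \<phi> \<psi> (\<lambda>y. f y + g y) x = kop M \<kappa> c \<phi> \<psi> f x + kop M \<kappa> c \<phi> \<psi> g x"
    unfolding kop_inner sum.distrib[symmetric] by (intro sum.cong refl) simp
qed

lemma region_compare:
  assumes "F \<in> borel_measurable M" "G \<in> borel_measurable M"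
  shows "region (\<lambda>x y. (F y :: real) < G x)"
proof -
  have [measurable]: "(\<lambda>p. F (snd p)) \<in> borel_measurable (M \<Otimes>\<^sub>M M)" "(\<lambda>p. G (fst p)) \<in> borel_measurable (M \<Otimes>\<^sub>M M)"
    using assms by measurable
  show ?thesis unfolding region_def by measurable
qed

lemma region_conj: "region \<kappa> \<Longrightarrow> region \<kappa>' \<Longrightarrow> region (\<lambda>x y. \<kappa> x y \<and> \<kappa>' x y)"
  unfolding region_def by measurable

lemma region_not: "region \<kappa> \<Longrightarrow> region (\<lambda>x y. \<not> \<kappa> x y)"
  unfolding region_def by measurable

section \<open>Discretization of the line into ordered cells\<close>

text \<open>Clamping to [-p, p] leaves finitely many cells even on an unbounded interval, and
  rounding to multiples of 1/p makes them finer as \<open>p\<close> grows. Adding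
  \<open>p * p\<close> makes the smallest value 0, so that cells are numbered by naturals.\<close>

definition cell :: "nat \<Rightarrow> real \<Rightarrow> int" where
  "cell p t = \<lfloor>real p * max (- real p) (min (real p) t)\<rfloor> + int (p * p)"

lemma cell_mono: "s \<le> t \<Longrightarrow> cell p s \<le> cell p t"
  unfolding cell_def by (intro add_right_mono floor_mono mult_left_mono) auto

lemma cell_bounds: "0 \<le> cell p t" "cell p t \<le> 2 * int (p * p)"
proof -
  have "- real (p * p) \<le> real p * max (- real p) (min (real p) t)"
    using mult_left_mono[of "- real p" "max (- real p) (min (real p) t)" "real p"] by simp
  then have "- int (p * p) \<le> \<lfloor>real p * max (- real p) (min (real p) t)\<rfloor>" by (subst le_floor_iff) simp
  then show "0 \<le> cell p t" by (simp add: cell_def)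
  have "real p * max (- real p) (min (real p) t) \<le> real p * real p"
    by (intro mult_left_mono) auto
  then have "\<lfloor>real p * max (- real p) (min (real p) t)\<rfloor> \<le> \<lfloor>real (p * p)\<rfloor>" by (intro floor_mono) simp
  then have "\<lfloor>real p * max (- real p) (min (real p) t)\<rfloor> \<le> int (p * p)" by (simp only: floor_of_nat)
  then show "cell p t \<le> 2 * int (p * p)" by (simp add: cell_def)
qed

lemma cell_separates:
  assumes "s < t"
  shows "eventually (\<lambda>p. cell p s < cell p t) sequentially"
proof -
  \<comment> \<open>Beyond this bound neither point is clamped and cells are no wider than the gap
    \<open>t - s\<close>.\<close>
  obtain N where N: "real N > \<bar>s\<bar> + \<bar>t\<bar> + 1 / (t - s)" using reals_Archimedean2 by blast
  have pos: "0 < 1 / (t - s)" using assms by simp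
  show ?thesis
  proof (intro eventually_sequentiallyI[of N])
    fix p assume "N \<le> p"
    then have p: "real p > \<bar>s\<bar> + \<bar>t\<bar> + 1 / (t - s)" using N by (meson less_le_trans of_nat_le_iff)
    have abs_p: "\<bar>s\<bar> < real p" "\<bar>t\<bar> < real p" using p pos by linarith+
    have s: "max (- real p) (min (real p) s) = s" and t: "max (- real p) (min (real p) t) = t"
      using abs_p by (auto simp: max_def min_def)
    have "1 / (t - s) \<le> real p" using p by linarith
    then have "1 \<le> real p * (t - s)" using assms by (simp add: divide_le_eq)
    then have "real p * s + 1 \<le> real p * t" by (simp add: algebra_simps)
    then have "\<lfloor>real p * s + 1\<rfloor> \<le> \<lfloor>real p * t\<rfloor>" by (rule floor_mono)
    then show "cell p s < cell p t" unfolding cell_def s t by simp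
  qed
qed

lemma measurable_cell: "(\<lambda>x. real_of_int (cell p (\<sigma> * x))) \<in> borel_measurable M"
proof -
  note [measurable] = id_measurable
  have "(\<lambda>x. real p * max (- real p) (min (real p) (\<sigma> * x))) \<in> borel_measurable M"
    by measurable
  from measurable_compose[OF this borel_measurable_real_floor]
  have "(\<lambda>x. real_of_int \<lfloor>real p * max (- real p) (min (real p) (\<sigma> * x))\<rfloor>) \<in> borel_measurable M" .
  then show ?thesis by (simp add: cell_def)
qed

lemma det2_zero_op: "det2 N (op_matrix M (\<lambda>f x. 0) e) = 1"
proof -
  have "sec N kron = 1\<^sub>m N" by (rule eq_matI) (auto simp: kron_def)
  then show ?thesis by (simp add: det2_def det_I_plus_def op_matrix_def tr_def)
qed

text \<open>Replacing the region \<open>\<sigma> * y < \<sigma> * x\<close> by pairs of points in strictly ordered cells gives a finite rank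
  operator whose matrix, indexed by (cell, column) pairs, is strictly lower triangular.\<close>

lemma det2_staircase:
  fixes \<phi> \<psi> :: "nat \<Rightarrow> real \<Rightarrow> complex^'m::finite"
  assumes \<phi>: "\<And>q. q < c \<Longrightarrow> \<phi> q \<in> L2 M" and \<psi>: "\<And>q. q < c \<Longrightarrow> \<psi> q \<in> L2 M"
    and e: "orthonormal_basis M e"
  shows "(\<lambda>N. det2 N (op_matrix M (kop M (\<lambda>x y. cell p (\<sigma> * y) < cell p (\<sigma> * x)) c \<phi> \<psi>) e)) \<longlonglongrightarrow> 1"
proof -
  define \<kappa> where "\<kappa> = (\<lambda>x y. cell p (\<sigma> * y) < cell p (\<sigma> * x))"
  have \<kappa>: "region \<kappa>"
    using region_compare[OF measurable_cell[of p \<sigma>] measurable_cell[of p \<sigma>]] by (simp add: \<kappa>_def)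
  define n where "n = Suc (2 * (p * p))"
  \<comment> \<open>The index \<open>t\<close> encodes the cell \<open>t div c\<close> and the term
    \<open>t mod c\<close> of the kernel: \<open>W t\<close> lives on that cell,
    \<open>\<rho> t\<close> on all earlier cells.\<close>
  define W where "W = (\<lambda>t x. if cell p (\<sigma> * x) = int (t div c) then \<phi> (t mod c) x else 0)"
  define \<rho> where "\<rho> = (\<lambda>t y. if cell p (\<sigma> * y) < int (t div c) then \<psi> (t mod c) y else 0)"
  have c0: "c > 0" "t mod c < c" if "t < n * c" for t using that by (cases c; simp)+
  have m1: "Measurable.pred M (\<lambda>x. cell p (\<sigma> * x) = k)" for k
  proof -
    note [measurable] = measurable_cell[of p \<sigma>]
    have "Measurable.pred M (\<lambda>x. real_of_int (cell p (\<sigma> * x)) = real_of_int k)" by measurable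
    then show ?thesis by simp
  qed
  have m2: "Measurable.pred M (\<lambda>x. cell p (\<sigma> * x) < k)" for k
  proof -
    note [measurable] = measurable_cell[of p \<sigma>]
    have "Measurable.pred M (\<lambda>x. real_of_int (cell p (\<sigma> * x)) < real_of_int k)" by measurable
    then show ?thesis by simp
  qed
  have W: "W t \<in> L2 M" if "t < n * c" for t
  proof (rule L2_dominated(1)[OF \<phi>[OF c0(2)[OF that]]])
    show "W t \<in> borel_measurable M"
      unfolding W_def using m1 L2_measurable[OF \<phi>[OF c0(2)[OF that]]] by measurable
  qed (simp add: W_def)
  have \<rho>: "\<rho> t \<in> L2 M" if "t < n * c" for t
  proof (rule L2_dominated(1)[OF \<psi>[OF c0(2)[OF that]]])
    show "\<rho> t \<in> borel_measurable M"
      unfolding \<rho>_def using m2 L2_measurable[OF \<psi>[OF c0(2)[OF that]]] by measurable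
  qed (simp add: \<rho>_def)
  have zero: "dominated_op M (\<lambda>f x. 0 :: complex^'m) (\<lambda>x. 0)" by (simp add: dominated_op_def)
  have rank: "kop M \<kappa> c \<phi> \<psi> f x = 0 + (\<Sum>t<n * c. L2_inner M f (\<rho> t) *s W t x)" for f x
  proof -
    define F where "F = (\<lambda>i q. L2_inner M f (\<lambda>y. if cell p (\<sigma> * y) < int i then \<psi> q y else 0) *s
        (if cell p (\<sigma> * x) = int i then \<phi> q x else 0))"
    have "(\<Sum>t<n * c. L2_inner M f (\<rho> t) *s W t x) = (\<Sum>t<n * c. F (t div c) (t mod c))"
      by (simp add: F_def \<rho>_def W_def)
    also have "\<dots> = (\<Sum>i<n. \<Sum>t\<in>{i * c..<i * c + c}. F (t div c) (t mod c))"
      by (rule sum.nat_group[symmetric])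
    also have "\<dots> = (\<Sum>i<n. \<Sum>q<c. F i q)"
    proof (rule sum.cong[OF refl])
      fix i
      show "(\<Sum>t\<in>{i * c..<i * c + c}. F (t div c) (t mod c)) = (\<Sum>q<c. F i q)"
        using sum.shift_bounds_nat_ivl[of "\<lambda>t. F (t div c) (t mod c)" 0 "i * c" c]
        by (simp add: add.commute lessThan_atLeast0)
    qed
    also have "\<dots> = (\<Sum>q<c. \<Sum>i<n. F i q)" by (rule sum.swap)
    also have "\<dots> = kop M \<kappa> c \<phi> \<psi> f x"
      unfolding kop_inner
    proof (rule sum.cong[OF refl])
      fix q
      define i0 where "i0 = nat (cell p (\<sigma> * x))"
      have i0: "int i0 = cell p (\<sigma> * x)" "i0 < n"
      proof -
        show i: "int i0 = cell p (\<sigma> * x)" using cell_bounds(1)[of p "\<sigma> * x"] by (simp add: i0_def)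
        have "int i0 < int n" using cell_bounds(2)[of p "\<sigma> * x"] unfolding i n_def by simp
        then show "i0 < n" by simp
      qed
      have "(\<Sum>i<n. F i q) = (\<Sum>i<n. if i = i0 then F i0 q else 0)"
        by (intro sum.cong refl) (auto simp: F_def i0(1)[symmetric])
      also have "\<dots> = F i0 q" using i0 by simp
      finally show "(\<Sum>i<n. F i q) = L2_inner M f (\<lambda>y. if \<kappa> x y then \<psi> q y else 0) *s \<phi> q x"
        by (simp add: F_def i0 \<kappa>_def)
    qed
    finally show ?thesis by simp
  qed
  \<comment> \<open>The supports are disjoint. The case \<open>s = t\<close> supplies both the unit
    diagonal of the matrix and the vanishing exponent.\<close>
  have tri: "L2_inner M (W s) (\<rho> t) = 0" if "t \<le> s" for s t
  proof -
    have "t div c \<le> s div c" using that by (rule div_le_mono)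
    then have "cdot (W s x) (\<rho> t x) = 0" for x by (auto simp: W_def \<rho>_def cdot_def)
    then show ?thesis by (simp add: L2_inner_cdot)
  qed
  \<comment> \<open>The staircase operator as a perturbation of the zero operator, for which
    \<open>V = W\<close>.\<close>
  have "(\<lambda>N. det2 N (op_matrix M (kop M \<kappa> c \<phi> \<psi>) e)) \<longlonglongrightarrow>
     1 * det_I_plus (n * c) (\<lambda>p q. - L2_inner M (W q) (\<rho> p)) * exp (\<Sum>q<n * c. L2_inner M (W q) (\<rho> q))"
    by (rule det2_finite_rank_perturbation[OF sigma_finite_measure_axioms zero kop_dominated[OF \<phi> \<psi> \<kappa>] e W W \<rho>])
       (use rank in \<open>auto simp: det2_zero_op\<close>)
  moreover have "det_I_plus (n * c) (\<lambda>p q. - L2_inner M (W q) (\<rho> p)) = 1"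
  proof -
    let ?E = "sec (n * c) (\<lambda>p q. kron p q + - L2_inner M (W q) (\<rho> p))"
    have "Determinant.det ?E = prod_list (diag_mat ?E)"
      by (rule det_lower_triangular[OF _ sec_carrier]) (simp add: kron_def tri)
    also have "diag_mat ?E = map (\<lambda>i. 1) [0..<n * c]" by (simp add: diag_mat_def kron_def tri)
    also have "prod_list \<dots> = 1" by (simp add: map_replicate_const)
    finally show ?thesis by (simp add: det_I_plus_def)
  qed
  ultimately show ?thesis by (simp add: \<kappa>_def tri)
qed

text \<open>Dominated convergence twice: in \<open>y\<close> for fixed \<open>x\<close>, below the
  square of the norm of \<open>\<psi> q\<close>, then in \<open>x\<close>, below the square of the
  region-free majorant of \<open>kop_bound_L2\<close>.\<close>

lemma kop_bound_diagonal_cells_tendsto: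
  fixes \<phi> \<psi> :: "nat \<Rightarrow> real \<Rightarrow> complex^'m::finite"
  assumes \<phi>: "\<And>q. q < c \<Longrightarrow> \<phi> q \<in> L2 M" and \<psi>: "\<And>q. q < c \<Longrightarrow> \<psi> q \<in> L2 M"
    and \<kappa>: "\<And>p. region (\<kappa> p)" and lim: "\<And>x y. eventually (\<lambda>p. \<not> \<kappa> p x y) sequentially"
  shows "(\<lambda>p. L2_norm M (kop_bound M (\<kappa> p) c \<phi> \<psi>)) \<longlonglongrightarrow> 0"
proof -
  note kb = kop_bound_L2[OF \<phi> \<psi> \<kappa>]
  define g where "g = (\<lambda>x. \<Sum>q<c. norm (\<phi> q x) * L2_norm M (\<psi> q))"
  have g: "g \<in> L2 M" unfolding g_def by (rule kb)
  have inner: "(\<lambda>p. L2_norm M (\<lambda>y. if \<kappa> p x y then \<psi> q y else 0)) \<longlonglongrightarrow> 0" if q: "q < c" and x: "x \<in> space M" for q x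
  proof -
    have "(\<lambda>p. LINT y|M. (norm (if \<kappa> p x y then \<psi> q y else 0))\<^sup>2) \<longlonglongrightarrow> (LINT y|M. 0)"
    proof (rule integral_dominated_convergence)
      show "integrable M (\<lambda>y. (norm (\<psi> q y))\<^sup>2)" by (rule L2_integrable_power2[OF \<psi>[OF q]])
      show "AE y in M. (\<lambda>p. (norm (if \<kappa> p x y then \<psi> q y else 0))\<^sup>2) \<longlonglongrightarrow> 0"
      proof (intro AE_I2 tendsto_eventually)
        fix y
        show "eventually (\<lambda>p. (norm (if \<kappa> p x y then \<psi> q y else 0))\<^sup>2 = 0) sequentially"
          using lim[of x y] by (rule eventually_mono) simp
      qed
      show "(\<lambda>y. (norm (if \<kappa> p x y then \<psi> q y else 0))\<^sup>2) \<in> borel_measurable M" for p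
        using L2_measurable[OF L2_restrict(1)[OF \<psi>[OF q] \<kappa> x]] by measurable
    qed auto
    then have "(\<lambda>p. sqrt (LINT y|M. (norm (if \<kappa> p x y then \<psi> q y else 0))\<^sup>2)) \<longlonglongrightarrow> sqrt 0"
      by (intro tendsto_real_sqrt) simp
    then show ?thesis by (simp add: L2_norm_def)
  qed
  have "(\<lambda>p. LINT x|M. (norm (kop_bound M (\<kappa> p) c \<phi> \<psi> x))\<^sup>2) \<longlonglongrightarrow> (LINT x|M. 0)"
  proof (rule integral_dominated_convergence)
    show "integrable M (\<lambda>x. (norm (g x))\<^sup>2)" by (rule L2_integrable_power2[OF g])
    show "(\<lambda>x. (norm (kop_bound M (\<kappa> p) c \<phi> \<psi> x))\<^sup>2) \<in> borel_measurable M" for p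
      using L2_measurable[OF kb(4)] by measurable
    show "AE x in M. norm ((norm (kop_bound M (\<kappa> p) c \<phi> \<psi> x))\<^sup>2) \<le> (norm (g x))\<^sup>2" for p
    proof (rule AE_I2)
      fix x assume "x \<in> space M"
      have kop_nonneg: "0 \<le> kop_bound M (\<kappa> p) c \<phi> \<psi> x" by (intro kop_bound_L2(3) \<phi> \<psi> \<kappa>)
      from \<open>x \<in> space M\<close> have "kop_bound M (\<kappa> p) c \<phi> \<psi> x \<le> g x" unfolding g_def by (intro kop_bound_L2(2) \<phi> \<psi> \<kappa>)
      then show "norm ((norm (kop_bound M (\<kappa> p) c \<phi> \<psi> x))\<^sup>2) \<le> (norm (g x))\<^sup>2"
        using kop_nonneg by (simp add: power_mono)
    qed
    show "AE x in M. (\<lambda>p. (norm (kop_bound M (\<kappa> p) c \<phi> \<psi> x))\<^sup>2) \<longlonglongrightarrow> 0"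
    proof (rule AE_I2)
      fix x assume x: "x \<in> space M"
      have "(\<lambda>p. (norm (kop_bound M (\<kappa> p) c \<phi> \<psi> x))\<^sup>2) \<longlonglongrightarrow> (norm (\<Sum>q<c. norm (\<phi> q x) * 0))\<^sup>2"
        unfolding kop_bound_def by (intro tendsto_power tendsto_norm tendsto_sum tendsto_mult tendsto_const inner x) auto
      then show "(\<lambda>p. (norm (kop_bound M (\<kappa> p) c \<phi> \<psi> x))\<^sup>2) \<longlonglongrightarrow> 0" by simp
    qed
  qed auto
  then have "(\<lambda>p. sqrt (LINT x|M. (norm (kop_bound M (\<kappa> p) c \<phi> \<psi> x))\<^sup>2)) \<longlonglongrightarrow> sqrt 0"
    by (intro tendsto_real_sqrt) simp
  then show ?thesis by (simp add: L2_norm_def)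
qed

lemma region_volterra: "region (\<lambda>x y. \<sigma> * y < \<sigma> * x)"
  by (intro region_compare borel_measurable_times borel_measurable_const id_measurable)

text \<open>Removing the staircase leaves the pairs that are ordered but share a cell. The fineness
  \<open>p\<close> is chosen first, with an error below \<epsilon>/2 in all sections at once, and
  the size of the section afterwards; the uniformity of \<open>det2_lipschitz\<close> makes this
  order possible.\<close>

lemma det2_volterra:
  fixes \<phi> \<psi> :: "nat \<Rightarrow> real \<Rightarrow> complex^'m::finite"
  assumes \<phi>: "\<And>q. q < c \<Longrightarrow> \<phi> q \<in> L2 M" and \<psi>: "\<And>q. q < c \<Longrightarrow> \<psi> q \<in> L2 M"
    and e: "orthonormal_basis M e"
  shows "(\<lambda>N. det2 N (op_matrix M (kop M (\<lambda>x y. \<sigma> * y < \<sigma> * x) c \<phi> \<psi>) e)) \<longlonglongrightarrow> 1"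
proof -
  define A where "A = kop M (\<lambda>x y. \<sigma> * y < \<sigma> * x) c \<phi> \<psi>"
  define \<kappa> where "\<kappa> = (\<lambda>p x y. \<sigma> * y < \<sigma> * x \<and> \<not> cell p (\<sigma> * y) < cell p (\<sigma> * x))"
  define F where "F = (\<lambda>p. kop M (\<lambda>x y. cell p (\<sigma> * y) < cell p (\<sigma> * x)) c \<phi> \<psi>)"
  note eL2 = orthonormal_basis_L2[OF e]
  have rc: "region (\<lambda>x y. cell p (\<sigma> * y) < cell p (\<sigma> * x))" for p
    using region_compare[OF measurable_cell[of p \<sigma>] measurable_cell[of p \<sigma>]] by simp
  have \<kappa>: "region (\<kappa> p)" for p unfolding \<kappa>_def by (intro region_conj region_not region_volterra rc)
  have A: "dominated_op M A (kop_bound M (\<lambda>x y. \<sigma> * y < \<sigma> * x) c \<phi> \<psi>)"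
    unfolding A_def by (rule kop_dominated[OF \<phi> \<psi> region_volterra])
  have Fd: "dominated_op M (F p) (kop_bound M (\<lambda>x y. cell p (\<sigma> * y) < cell p (\<sigma> * x)) c \<phi> \<psi>)" for p
    unfolding F_def by (rule kop_dominated[OF \<phi> \<psi> rc])
  have Dd: "dominated_op M (kop M (\<kappa> p) c \<phi> \<psi>) (kop_bound M (\<kappa> p) c \<phi> \<psi>)" for p
    by (rule kop_dominated[OF \<phi> \<psi> \<kappa>])
  have split: "A f x = F p f x + kop M (\<kappa> p) c \<phi> \<psi> f x" if f: "f \<in> L2 M" and x: "x \<in> space M" for p f x
  proof -
    have "(LINT y|M. (if \<sigma> * y < \<sigma> * x then cdot (f y) (\<psi> q y) else 0)) =
       (LINT y|M. (if cell p (\<sigma> * y) < cell p (\<sigma> * x) then cdot (f y) (\<psi> q y) else 0)) +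
       (LINT y|M. (if \<kappa> p x y then cdot (f y) (\<psi> q y) else 0))" if q: "q < c" for q
    proof -
      have I: "integrable M (\<lambda>y. if \<kappa>' x y then cdot (f y) (\<psi> q y) else 0)" if "region \<kappa>'" for \<kappa>'
        using integrable_cdot[OF f L2_restrict(1)[OF \<psi>[OF q] that x]]
        by (rule Bochner_Integration.integrable_cong[THEN iffD1, rotated -1]) (auto simp: cdot_def)
      \<comment> \<open>Cells are monotone, so the staircase lies inside the triangle and the two
        regions on the right are disjoint with union the triangle.\<close>
      have "\<not> cell p (\<sigma> * y) < cell p (\<sigma> * x)" if "\<not> \<sigma> * y < \<sigma> * x" for y
        using cell_mono[of "\<sigma> * x" "\<sigma> * y" p] that by simp
      then show ?thesis
        by (subst Bochner_Integration.integral_add[symmetric, OF I[OF rc] I[OF \<kappa>]])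
           (auto intro!: Bochner_Integration.integral_cong simp: \<kappa>_def)
    qed
    then show ?thesis unfolding A_def F_def kop_def sum.distrib[symmetric] by (intro sum.cong refl) simp
  qed
  define B where "B = sqrt (real CARD('m)) * L2_norm M (kop_bound M (\<lambda>x y. \<sigma> * y < \<sigma> * x) c \<phi> \<psi>)"
  define K where "K = 2 * exp ((B + 1)\<^sup>2 / 2)"
  have K: "K > 0" by (simp add: K_def)
  show ?thesis
    unfolding A_def[symmetric]
  proof (rule LIMSEQ_I)
    fix \<epsilon> :: real assume \<epsilon>: "0 < \<epsilon>"
    define d where "d = min (1/2) (\<epsilon> / (4 * K))"
    have d: "0 < d" "d \<le> 1/2" using \<epsilon> K by (auto simp: d_def)
    have "K * d \<le> K * (\<epsilon> / (4 * K))" using K by (intro mult_left_mono) (auto simp: d_def)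
    then have Kd: "K * d < \<epsilon> / 2" using K \<epsilon> by simp
    have "eventually (\<lambda>p. \<not> \<kappa> p x y) sequentially" for x y
    proof (cases "\<sigma> * y < \<sigma> * x")
      case True
      then show ?thesis using cell_separates[OF True] by (auto simp: \<kappa>_def)
    qed (simp add: \<kappa>_def)
    then have "(\<lambda>p. L2_norm M (kop_bound M (\<kappa> p) c \<phi> \<psi>)) \<longlonglongrightarrow> 0"
      by (intro kop_bound_diagonal_cells_tendsto \<phi> \<psi> \<kappa>)
    from tendsto_mult_left[OF this, of "sqrt (real CARD('m))"]
    have "(\<lambda>p. sqrt (real CARD('m)) * L2_norm M (kop_bound M (\<kappa> p) c \<phi> \<psi>)) \<longlonglongrightarrow> 0" by simp
    then have "eventually (\<lambda>p. sqrt (real CARD('m)) * L2_norm M (kop_bound M (\<kappa> p) c \<phi> \<psi>) < d) sequentially"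
      using d(1) by (intro order_tendstoD(2)) auto
    then obtain p where p: "sqrt (real CARD('m)) * L2_norm M (kop_bound M (\<kappa> p) c \<phi> \<psi>) < d"
      by (auto simp: eventually_sequentially)
    have near: "cmod (det2 N (op_matrix M (F p) e) - det2 N (op_matrix M A e)) < \<epsilon> / 2" for N
    proof -
      have "op_matrix M (F p) e i j - op_matrix M A e i j = - op_matrix M (kop M (\<kappa> p) c \<phi> \<psi>) e i j" for i j
      proof -
        have L: "F p (e j) \<in> L2 M" "kop M (\<kappa> p) c \<phi> \<psi> (e j) \<in> L2 M" "A (e j) \<in> L2 M"
          using dominated_op_L2(1)[OF Fd eL2] dominated_op_L2(1)[OF Dd eL2] dominated_op_L2(1)[OF A eL2] by auto
        have "op_matrix M A e i j = L2_inner M (\<lambda>x. F p (e j) x + kop M (\<kappa> p) c \<phi> \<psi> (e j) x) (e i)"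
          unfolding op_matrix_def using split[OF eL2] L L2_add(1)[OF L(1,2)] eL2
          by (intro L2_inner_cong_AE AE_I2 L2_measurable) auto
        then show ?thesis by (simp add: op_matrix_def L2_inner_add_left[OF L(1,2) eL2])
      qed
      then have "hs N (\<lambda>i j. op_matrix M (F p) e i j - op_matrix M A e i j) \<le> d"
        using hs_op_matrix_le[OF Dd e, of N p] p by simp
      then have "cmod (det2 N (op_matrix M (F p) e) - det2 N (op_matrix M A e)) \<le> 2 * exp ((hs N (op_matrix M A e) + 1)\<^sup>2 / 2) * d"
        by (rule det2_lipschitz[OF _ d])
      also have "\<dots> \<le> K * d"
        unfolding K_def using hs_op_matrix_le[OF A e, of N] d
        by (intro mult_right_mono mult_left_mono) (auto simp: B_def intro!: divide_right_mono power_mono)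
      finally show ?thesis using Kd by simp
    qed
    have "(\<lambda>N. det2 N (op_matrix M (F p) e)) \<longlonglongrightarrow> 1"
      unfolding F_def by (rule det2_staircase[OF \<phi> \<psi> e])
    then obtain N0 where N0: "\<And>N. N \<ge> N0 \<Longrightarrow> cmod (det2 N (op_matrix M (F p) e) - 1) < \<epsilon> / 2"
      using LIMSEQ_D[of _ 1 "\<epsilon> / 2"] \<epsilon> by (metis half_gt_zero)
    have "cmod (det2 N (op_matrix M A e) - 1) < \<epsilon>" if "N \<ge> N0" for N
      using norm_triangle_sub[of "det2 N (op_matrix M A e) - 1" "det2 N (op_matrix M (F p) e) - 1"] near[of N] N0[OF that]
      by (simp add: norm_minus_commute)
    then show "\<exists>N0. \<forall>N\<ge>N0. norm (det2 N (op_matrix M A e) - 1) < \<epsilon>" by blast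
  qed
qed

text \<open>\<open>op_inverse\<close> picks some preimage; injectivity makes this choice agree
  almost everywhere with the explicit solution.\<close>

lemma volterra_injective:
  fixes \<phi> \<psi> :: "nat \<Rightarrow> real \<Rightarrow> complex^'m::finite"
  assumes \<phi>: "\<And>q. q < c \<Longrightarrow> \<phi> q \<in> L2 M" and \<psi>: "\<And>q. q < c \<Longrightarrow> \<psi> q \<in> L2 M"
    and ex: "\<exists>e :: nat \<Rightarrow> real \<Rightarrow> complex^'m. orthonormal_basis M e"
    and v: "v \<in> L2 M" and fp: "AE x in M. v x = kop M (\<lambda>x y. \<sigma> * y < \<sigma> * x) c \<phi> \<psi> v x"
  shows "AE x in M. v x = 0"
proof -
  let ?A = "kop M (\<lambda>x y. \<sigma> * y < \<sigma> * x) c \<phi> \<psi>"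
  obtain e :: "nat \<Rightarrow> real \<Rightarrow> complex^'m" where e: "orthonormal_basis M e" using ex by blast
  note A = kop_dominated[OF \<phi> \<psi> region_volterra[of \<sigma>]]
  note lim = det2_volterra[OF \<phi> \<psi> e, where \<sigma> = \<sigma>]
  \<comment> \<open>The operator is perturbed by zero, written with \<open>W = 0\<close> and
    \<open>\<rho> = v\<close>. The limit stays 1, while the formula gives one minus the squared norm
    of \<open>v\<close>.\<close>
  have "(\<lambda>N. det2 N (op_matrix M ?A e)) \<longlonglongrightarrow>
     1 * det_I_plus 1 (\<lambda>p q. - L2_inner M v v) * exp (\<Sum>q<(1::nat). L2_inner M (\<lambda>x. 0) v)"
  proof (rule det2_finite_rank_perturbation[OF sigma_finite_measure_axioms A A e v L2_zero(1) v _ _ lim])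
    show "AE x in M. 0 = v x - ?A v x" using fp by (rule eventually_mono) simp
  qed simp_all
  from LIMSEQ_unique[OF this lim] have "det_I_plus 1 (\<lambda>p q. - L2_inner M v v) = 1" by simp
  moreover have "det_I_plus 1 (\<lambda>p q. - L2_inner M v v) = 1 - L2_inner M v v"
    by (simp add: det_I_plus_def det_def'[OF sec_carrier] kron_def)
  ultimately have "L2_inner M v v = 0" by simp
  then have "L2_norm M v = 0" by (simp add: L2_inner_self)
  then show ?thesis by (rule L2_norm_zero_AE[OF v])
qed

text \<open>The factor of the Volterra part is 1 and disappears. The case \<open>d = 0\<close>
  evaluates the Volterra operator itself.\<close>

lemma det2_volterra_plus_finite_rank:
  fixes \<phi> \<psi> :: "nat \<Rightarrow> real \<Rightarrow> complex^'m::finite"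
  assumes \<phi>: "\<And>q. q < c \<Longrightarrow> \<phi> q \<in> L2 M" and \<psi>: "\<And>q. q < c \<Longrightarrow> \<psi> q \<in> L2 M"
    and ex: "\<exists>e :: nat \<Rightarrow> real \<Rightarrow> complex^'m. orthonormal_basis M e"
    and L2: "\<And>q. q < d \<Longrightarrow> V q \<in> L2 M" "\<And>q. q < d \<Longrightarrow> W q \<in> L2 M" "\<And>q. q < d \<Longrightarrow> \<rho> q \<in> L2 M"
    and VW: "\<And>q. q < d \<Longrightarrow> AE x in M. W q x = V q x - kop M (\<lambda>x y. \<sigma> * y < \<sigma> * x) c \<phi> \<psi> (V q) x"
    and B: "dominated_op M B k"
    and BA: "\<And>f x. f \<in> L2 M \<Longrightarrow> x \<in> space M \<Longrightarrow>
       B f x = kop M (\<lambda>x y. \<sigma> * y < \<sigma> * x) c \<phi> \<psi> f x + (\<Sum>q<d. L2_inner M f (\<rho> q) *s W q x)"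
  shows "det2_I_minus M B = det_I_plus d (\<lambda>p q. - L2_inner M (V q) (\<rho> p)) * exp (\<Sum>q<d. L2_inner M (W q) (\<rho> q))"
proof (rule det2_I_minus_eqI[OF sigma_finite_measure_axioms B ex])
  fix e :: "nat \<Rightarrow> real \<Rightarrow> complex^'m" assume e: "orthonormal_basis M e"
  show "(\<lambda>N. det2 N (op_matrix M B e)) \<longlonglongrightarrow>
      det_I_plus d (\<lambda>p q. - L2_inner M (V q) (\<rho> p)) * exp (\<Sum>q<d. L2_inner M (W q) (\<rho> q))"
    using det2_finite_rank_perturbation[OF sigma_finite_measure_axioms kop_dominated[OF \<phi> \<psi> region_volterra] B e
        L2 VW BA det2_volterra[OF \<phi> \<psi> e]] by simp
qed

end

section \<open>Semi-separable kernels\<close>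

text \<open>Determinants over finite index types are carried to numbered matrices along an
  enumeration: conjugation by \<open>\<beta>\<close> is a bijection between the permutations and
  preserves their signs.\<close>

lemma det_eq_det_sec:
  fixes A :: "complex^'n^'n"
  assumes \<beta>: "bij_betw \<beta> {0..<c} (UNIV :: 'n set)"
  shows "det A = Determinant.det (sec c (\<lambda>i j. A $ \<beta> i $ \<beta> j))"
proof -
  have inj: "inj_on \<beta> {0..<c}" and img: "\<beta> ` {0..<c} = UNIV" using \<beta> by (auto simp: bij_betw_def)
  \<comment> \<open>\<open>bij_betw_permutations\<close> describes the conjugated permutation in
    this conditional form.\<close>
  have mp: "(\<lambda>x. if x \<in> UNIV then \<beta> (p (inv_into {0..<c} \<beta> x)) else x) = map_permutation {0..<c} \<beta> p" for p
    using img by (auto simp: map_permutation_def restrict_id_def fun_eq_iff)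
  have bij: "bij_betw (map_permutation {0..<c} \<beta>) {p. p permutes {0..<c}} {p. p permutes (UNIV :: 'n set)}"
    using bij_betw_permutations[OF \<beta>] unfolding mp .
  have "det A = (\<Sum>p\<in>{p. p permutes {0..<c}}. of_int (sign (map_permutation {0..<c} \<beta> p)) *
      (\<Prod>i\<in>UNIV. A $ i $ map_permutation {0..<c} \<beta> p i))"
    unfolding det_def by (rule sum.reindex_bij_betw[OF bij, symmetric])
  also have "\<dots> = (\<Sum>p\<in>{p. p permutes {0..<c}}. signof p * (\<Prod>i = 0..<c. A $ \<beta> i $ \<beta> (p i)))"
  proof (rule sum.cong[OF refl])
    fix p assume "p \<in> {p. p permutes {0..<c}}"
    then have p: "p permutes {0..<c}" by simp
    have "(\<Prod>i\<in>UNIV. A $ i $ map_permutation {0..<c} \<beta> p i) = (\<Prod>i = 0..<c. A $ \<beta> i $ map_permutation {0..<c} \<beta> p (\<beta> i))"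
      by (rule prod.reindex_bij_betw[OF \<beta>, symmetric])
    also have "\<dots> = (\<Prod>i = 0..<c. A $ \<beta> i $ \<beta> (p i))"
      by (intro prod.cong refl) (simp add: map_permutation_apply[OF inj])
    finally show "of_int (sign (map_permutation {0..<c} \<beta> p)) * (\<Prod>i\<in>UNIV. A $ i $ map_permutation {0..<c} \<beta> p i)
        = signof p * (\<Prod>i = 0..<c. A $ \<beta> i $ \<beta> (p i))"
      by (simp add: sign_map_permutation[OF inj p])
  qed
  also have "\<dots> = Determinant.det (sec c (\<lambda>i j. A $ \<beta> i $ \<beta> j))"
    unfolding det_def'[OF sec_carrier]
    by (intro sum.cong refl arg_cong2[where f = "(*)"] prod.cong) (auto dest: permutes_in_image)
  finally show ?thesis .
qed

text \<open>Enumerating the sum type with the left summand first makes the section a four-block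
  matrix. At either endpoint of the interval one off-diagonal block of \<open>U\<close> vanishes, so
  this suffices for \<open>U a\<close> and \<open>U b\<close>.\<close>

lemma det_block_matrix:
  fixes A :: "complex^'n1^'n1" and B :: "complex^'n2^'n1" and C :: "complex^'n1^'n2" and D :: "complex^'n2^'n2"
  assumes "B = 0 \<or> C = 0"
  shows "det (block_matrix A B C D) = det A * det D"
proof -
  define c1 where "c1 = CARD('n1)"
  define c2 where "c2 = CARD('n2)"
  obtain \<beta>1 where \<beta>1: "bij_betw \<beta>1 {0..<c1} (UNIV :: 'n1 set)"
    using ex_bij_betw_nat_finite[of "UNIV :: 'n1 set"] by (auto simp: c1_def)
  obtain \<beta>2 where \<beta>2: "bij_betw \<beta>2 {0..<c2} (UNIV :: 'n2 set)"
    using ex_bij_betw_nat_finite[of "UNIV :: 'n2 set"] by (auto simp: c2_def)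
  define \<beta> where "\<beta> = (\<lambda>i. if i < c1 then Inl (\<beta>1 i) else Inr (\<beta>2 (i - c1)))"
  have \<beta>: "bij_betw \<beta> {0..<c1 + c2} (UNIV :: ('n1 + 'n2) set)"
    unfolding bij_betw_def
  proof
    show "inj_on \<beta> {0..<c1 + c2}"
    proof (rule inj_onI)
      fix i j assume ij: "i \<in> {0..<c1 + c2}" "j \<in> {0..<c1 + c2}" "\<beta> i = \<beta> j"
      show "i = j"
      proof (cases "i < c1")
        case True
        then have "j < c1" "\<beta>1 i = \<beta>1 j" using ij by (auto simp: \<beta>_def split: if_splits)
        then show ?thesis using True \<beta>1 by (auto simp: bij_betw_def inj_on_def)
      next
        case False
        then have "\<not> j < c1" "\<beta>2 (i - c1) = \<beta>2 (j - c1)" using ij by (auto simp: \<beta>_def split: if_splits)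
        moreover have "i - c1 = j - c1"
          using False ij calculation \<beta>2 by (intro inj_onD[of \<beta>2 "{0..<c2}"]) (auto simp: bij_betw_def)
        ultimately show ?thesis using False by simp
      qed
    qed
    show "\<beta> ` {0..<c1 + c2} = UNIV"
    proof (intro equalityI subsetI UNIV_I)
      fix x :: "'n1 + 'n2"
      show "x \<in> \<beta> ` {0..<c1 + c2}"
      proof (cases x)
        case (Inl p)
        obtain i where "i < c1" "p = \<beta>1 i" using \<beta>1 by (force simp: bij_betw_def)
        then show ?thesis using Inl by (intro image_eqI[of _ _ i]) (auto simp: \<beta>_def)
      next
        case (Inr p)
        obtain i where "i < c2" "p = \<beta>2 i" using \<beta>2 by (force simp: bij_betw_def)
        then show ?thesis using Inr by (intro image_eqI[of _ _ "c1 + i"]) (auto simp: \<beta>_def)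
      qed
    qed
  qed
  let ?A = "sec c1 (\<lambda>i j. A $ \<beta>1 i $ \<beta>1 j)" and ?D = "sec c2 (\<lambda>i j. D $ \<beta>2 i $ \<beta>2 j)"
  let ?B = "Matrix.mat c1 c2 (\<lambda>(i,j). B $ \<beta>1 i $ \<beta>2 j)" and ?C = "Matrix.mat c2 c1 (\<lambda>(i,j). C $ \<beta>2 i $ \<beta>1 j)"
  have "sec (c1 + c2) (\<lambda>i j. block_matrix A B C D $ \<beta> i $ \<beta> j) = four_block_mat ?A ?B ?C ?D"
    by (rule eq_matI) (auto simp: block_matrix_def \<beta>_def)
  moreover have "Determinant.det (four_block_mat ?A ?B ?C ?D) = Determinant.det ?A * Determinant.det ?D"
  proof (cases "B = 0")
    case True
    then have "?B = 0\<^sub>m c1 c2" by (intro eq_matI) auto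
    then show ?thesis by (intro det_four_block_mat_upper_right_zero) auto
  next
    case False
    then have "?C = 0\<^sub>m c2 c1" using assms by (intro eq_matI) auto
    then show ?thesis by (intro det_four_block_mat_lower_left_zero) auto
  qed
  ultimately show ?thesis
    by (simp add: det_eq_det_sec[OF \<beta>] det_eq_det_sec[OF \<beta>1] det_eq_det_sec[OF \<beta>2])
qed

lemma bounded_linear_axis: "bounded_linear (\<lambda>x. axis i x :: 'b::real_normed_vector^'n)"
proof (rule bounded_linear_intro)
  show "norm (axis i x :: 'b^'n) \<le> norm x * 1" for x
  proof -
    have "(\<Sum>j\<in>UNIV. (norm ((axis i x :: 'b^'n) $ j))\<^sup>2) = (\<Sum>j\<in>UNIV. if j = i then (norm x)\<^sup>2 else 0)"
      by (intro sum.cong refl) (auto simp: axis_def)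
    then show ?thesis by (simp add: norm_vec_def L2_set_def)
  qed
qed (auto simp: axis_def vec_eq_iff)

lemma vec_eq_sum_axis: "v = (\<Sum>i\<in>UNIV. axis i (v $ i))" for v :: "'b::real_normed_vector^'n"
  by (simp add: vec_eq_iff axis_def)

text \<open>Splitting along the axes reduces integrability to the components. Entries may come from
  any Euclidean space, so that \<open>integral_matrix\<close> can use this twice, for rows and for
  entries.\<close>

lemma integral_vec:
  fixes v :: "real \<Rightarrow> 'b::euclidean_space^'n"
  assumes "\<And>i. integrable M (\<lambda>y. v y $ i)"
  shows "integrable M v" "integral\<^sup>L M v $ i = (LINT y|M. v y $ i)"
proof -
  have "integrable M (\<lambda>y. \<Sum>i\<in>UNIV. axis i (v y $ i) :: 'b^'n)"
    by (intro Bochner_Integration.integrable_sum integrable_bounded_linear[OF bounded_linear_axis] assms)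
  then show int: "integrable M v" by (simp only: vec_eq_sum_axis[symmetric])
  show "integral\<^sup>L M v $ i = (LINT y|M. v y $ i)"
    by (rule integral_bounded_linear[OF bounded_linear_vec_nth int, symmetric])
qed

lemma measurable_vec:
  fixes v :: "real \<Rightarrow> 'b::euclidean_space^'n"
  assumes "\<And>i. (\<lambda>y. v y $ i) \<in> borel_measurable M"
  shows "v \<in> borel_measurable M"
proof -
  have "(\<lambda>y. axis i (v y $ i) :: 'b^'n) \<in> borel_measurable M" for i
    using borel_measurable_continuous_on[OF linear_continuous_on[OF bounded_linear_axis] assms] .
  then have "(\<lambda>y. \<Sum>i\<in>UNIV. axis i (v y $ i) :: 'b^'n) \<in> borel_measurable M"
    by (intro borel_measurable_sum)
  then show ?thesis by (simp only: vec_eq_sum_axis[symmetric])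
qed

lemma integral_smult_vec:
  fixes v :: "complex^'m"
  assumes "integrable M c"
  shows "integrable M (\<lambda>y. c y *s v)" "(LINT y|M. c y *s v) = (LINT y|M. c y) *s v"
proof -
  have bl: "bounded_linear (\<lambda>c. c *s v)" by (rule bounded_bilinear.bounded_linear_left[OF bounded_bilinear_smult_vec])
  show "integrable M (\<lambda>y. c y *s v)" by (rule integrable_bounded_linear[OF bl assms])
  show "(LINT y|M. c y *s v) = (LINT y|M. c y) *s v" by (rule integral_bounded_linear[OF bl assms])
qed

text \<open>The conjugation undoes that of \<open>cdot\<close>, so that integrating a row of a
  matrix function against a vector function becomes an inner product.\<close>

definition cnj_row :: "'p \<Rightarrow> complex^'m^'p \<Rightarrow> complex^'m" where
  "cnj_row p X = (\<chi> k. cnj (X $ p $ k))"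

lemma L2_column:
  fixes X :: "real \<Rightarrow> complex^'p^'m"
  assumes X: "X \<in> L2 M"
  shows "(\<lambda>x. column j (X x)) \<in> L2 M"
proof (rule L2_dominated(1)[OF X])
  have "(\<lambda>x. X x $ i $ j) \<in> borel_measurable M" for i
    using L2_measurable[OF X] by (intro measurable_vec_nth)
  then show "(\<lambda>x. column j (X x)) \<in> borel_measurable M" by (intro measurable_vec) (simp add: column_def)
  have "norm (column j Y) \<le> norm Y" for Y :: "complex^'p^'m"
    unfolding norm_vec_def[of "column j Y"] norm_vec_def[of Y]
    by (intro L2_set_mono) (auto simp: column_def intro: Finite_Cartesian_Product.norm_nth_le)
  then show "AE x in M. norm (column j (X x)) \<le> norm (X x)" by simp
qed

lemma L2_cnj_row:
  fixes X :: "real \<Rightarrow> complex^'m^'p"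
  assumes X: "X \<in> L2 M"
  shows "(\<lambda>x. cnj_row p (X x)) \<in> L2 M"
proof (rule L2_dominated(1)[OF X])
  have "(\<lambda>x. cnj (X x $ p $ k)) \<in> borel_measurable M" for k
    using L2_measurable[OF X] by (intro measurable_cnj measurable_vec_nth)
  then show "(\<lambda>x. cnj_row p (X x)) \<in> borel_measurable M" by (intro measurable_vec) (simp add: cnj_row_def)
  have "norm (cnj_row p Y) \<le> norm Y" for Y :: "complex^'m^'p"
  proof -
    have "norm (cnj_row p Y) = norm (Y $ p)" by (simp add: norm_vec_def cnj_row_def)
    also have "\<dots> \<le> norm Y" by (rule Finite_Cartesian_Product.norm_nth_le)
    finally show ?thesis .
  qed
  then show "AE x in M. norm (cnj_row p (X x)) \<le> norm (X x)" by simp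
qed

lemma cdot_cnj_row: "cdot u (cnj_row p X) = (X *v u) $ p"
  by (simp add: cdot_def cnj_row_def matrix_vector_mult_def mult.commute)

lemma matrix_vector_mult_sum_columns: "F *v w = (\<Sum>p\<in>UNIV. w $ p *s column p F)" for F :: "complex^'p^'m"
  by (simp add: vec_eq_iff matrix_vector_mult_def column_def mult.commute)

lemma mat_mult_nth: "(mat \<alpha> ** X) $ i $ j = \<alpha> * X $ i $ j" for X :: "complex^'p^'m"
proof -
  have "(mat \<alpha> ** X) $ i $ j = (\<Sum>k\<in>UNIV. if k = i then \<alpha> * X $ i $ j else 0)"
    unfolding matrix_matrix_mult_def vec_lambda_beta by (intro sum.cong refl) (auto simp: mat_def)
  then show ?thesis by simp
qed

lemma column_mult: "column j (A ** B) = A *v column j B"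
  by (simp add: vec_eq_iff column_def matrix_vector_mult_def matrix_matrix_mult_def)

lemma matrix_mult_nth_eq_cdot: "(A ** B) $ i $ j = cdot (column j B) (cnj_row i A)"
  unfolding cdot_cnj_row column_mult[symmetric] by (simp add: column_def)

lemma integral_matrix:
  fixes X :: "real \<Rightarrow> complex^'p^'m"
  assumes "\<And>j. integrable M (\<lambda>y. column j (X y))"
  shows "integrable M X" "column j (integral\<^sup>L M X) = (LINT y|M. column j (X y))"
    "integral\<^sup>L M X $ i $ j = (LINT y|M. X y $ i $ j)"
proof -
  have e: "integrable M (\<lambda>y. X y $ i $ j)" for i j
  proof -
    have "integrable M (\<lambda>y. column j (X y) $ i)" by (rule integrable_bounded_linear[OF bounded_linear_vec_nth assms])
    then show ?thesis by (simp add: column_def)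
  qed
  have r: "integrable M (\<lambda>y. X y $ i)" for i by (rule integral_vec(1)[OF e])
  have r2: "integral\<^sup>L M (\<lambda>y. X y $ i) $ j = (LINT y|M. X y $ i $ j)" for i j by (rule integral_vec(2)[OF e])
  show "integrable M X" by (rule integral_vec(1)[OF r])
  show n: "integral\<^sup>L M X $ i $ j = (LINT y|M. X y $ i $ j)" for i j
    by (simp add: integral_vec(2)[OF r] r2)
  show "column j (integral\<^sup>L M X) = (LINT y|M. column j (X y))"
  proof (rule vec_eq_iff[THEN iffD2], rule allI)
    fix i
    have "(LINT y|M. column j (X y)) $ i = (LINT y|M. column j (X y) $ i)"
      by (rule integral_bounded_linear[OF bounded_linear_vec_nth assms, symmetric])
    then show "column j (integral\<^sup>L M X) $ i = (LINT y|M. column j (X y)) $ i" by (simp add: column_def n)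
  qed
qed

lemma dominated_op_cong:
  fixes A B :: "'m::finite operator"
  assumes B: "dominated_op M B h" and eq: "\<And>f x. f \<in> L2 M \<Longrightarrow> x \<in> space M \<Longrightarrow> A f x = B f x"
  shows "dominated_op M A h"
  unfolding dominated_op_def
proof (intro conjI ballI allI)
  show "h \<in> L2 M" by (rule dominated_opD(1)[OF B])
  fix f :: "real \<Rightarrow> complex^'m" assume f: "f \<in> L2 M"
  show "A f \<in> borel_measurable M"
    using dominated_opD(2)[OF B f] by (subst measurable_cong[of M _ "B f"]) (auto simp: eq f)
  fix x assume x: "x \<in> space M"
  show "norm (A f x) \<le> h x * L2_norm M f" using dominated_opD(5)[OF B f x] by (simp add: eq f x)
  show "A (\<lambda>y. c *s f y) x = c *s A f x" for c
    by (simp add: eq L2_smult f x dominated_opD(4)[OF B f x])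
  fix g :: "real \<Rightarrow> complex^'m" assume g: "g \<in> L2 M"
  show "A (\<lambda>y. f y + g y) x = A f x + A g x"
    by (simp add: eq L2_add f g x dominated_opD(3)[OF B f g x])
qed

context line_measure
begin

lemma integrable_restricted_cdot:
  assumes f: "f \<in> L2 M" and \<psi>: "\<psi> \<in> L2 M" and \<kappa>: "region \<kappa>" and x: "x \<in> space M"
  shows "integrable M (\<lambda>y. if \<kappa> x y then cdot (f y) (\<psi> y) else 0)"
proof -
  have "(\<lambda>y. if \<kappa> x y then cdot (f y) (\<psi> y) else 0) = (\<lambda>y. cdot (f y) (if \<kappa> x y then \<psi> y else 0))"
    by (auto simp: cdot_def)
  then show ?thesis using integrable_cdot[OF f L2_restrict(1)[OF \<psi> \<kappa> x]] by simp
qed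

lemma kop_integral:
  assumes f: "f \<in> L2 M" and \<psi>: "\<And>q. q < c \<Longrightarrow> \<psi> q \<in> L2 M" and \<kappa>: "region \<kappa>" and x: "x \<in> space M"
  shows "integrable M (\<lambda>y. if \<kappa> x y then (\<Sum>q<c. cdot (f y) (\<psi> q y) *s v q) else 0)"
    and "(LINT y|M. (if \<kappa> x y then (\<Sum>q<c. cdot (f y) (\<psi> q y) *s v q) else 0)) =
       (\<Sum>q<c. (LINT y|M. (if \<kappa> x y then cdot (f y) (\<psi> q y) else 0)) *s v q)"
proof -
  have eq: "(if \<kappa> x y then (\<Sum>q<c. cdot (f y) (\<psi> q y) *s v q) else 0) =
      (\<Sum>q<c. (if \<kappa> x y then cdot (f y) (\<psi> q y) else 0) *s v q)" for y
    by simp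
  note I = integral_smult_vec[OF integrable_restricted_cdot[OF f \<psi> \<kappa> x]]
  show "integrable M (\<lambda>y. if \<kappa> x y then (\<Sum>q<c. cdot (f y) (\<psi> q y) *s v q) else 0)"
    unfolding eq by (intro Bochner_Integration.integrable_sum I) simp
  show "(LINT y|M. (if \<kappa> x y then (\<Sum>q<c. cdot (f y) (\<psi> q y) *s v q) else 0)) =
       (\<Sum>q<c. (LINT y|M. (if \<kappa> x y then cdot (f y) (\<psi> q y) else 0)) *s v q)"
    unfolding eq by (subst Bochner_Integration.integral_sum) (auto intro!: I sum.cong)
qed

text \<open>The orientation is carried by \<sigma>: the value 1 yields the formulas with
  \<open>Ha\<close>, and the value -1, with the two pairs of factors exchanged, those with
  \<open>Hb\<close>. The columns of \<open>Fh\<close> are the solutions \<open>V\<close> of the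
  perturbation lemma up to the factor \<alpha>, and all entries of the small determinant are their
  inner products with conjugated rows of \<open>G2\<close>.\<close>

lemma semiseparable_det2:
  fixes F1 :: "real \<Rightarrow> complex^'p::finite^'m::finite" and G1 :: "real \<Rightarrow> complex^'m^'p"
    and F2 Fh :: "real \<Rightarrow> complex^'r::finite^'m" and G2 :: "real \<Rightarrow> complex^'m^'r"
    and A K :: "'m operator" and \<sigma> :: real and \<alpha> :: complex
  assumes ex: "\<exists>e :: nat \<Rightarrow> real \<Rightarrow> complex^'m. orthonormal_basis M e"
    and L2: "F1 \<in> L2 M" "G1 \<in> L2 M" "F2 \<in> L2 M" "G2 \<in> L2 M" "Fh \<in> L2 M"
    and A: "\<And>f x. f \<in> L2 M \<Longrightarrow> x \<in> space M \<Longrightarrow>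
       A f x = (LINT y|M. (if \<sigma> * y < \<sigma> * x then (F1 x ** G1 y - F2 x ** G2 y) *v f y else 0))"
    and K: "\<And>f x. f \<in> L2 M \<Longrightarrow> x \<in> space M \<Longrightarrow>
       K f x = (LINT y|M. (if \<sigma> * y < \<sigma> * x then F1 x ** G1 y else F2 x ** G2 y) *v f y)"
    and Fh: "AE x in M. Fh x = F2 x + mat \<alpha> **
       (LINT y|M. (if \<sigma> * y < \<sigma> * x then (F1 x ** G1 y - F2 x ** G2 y) ** Fh y else 0))"
  shows "det2_I_minus M (\<lambda>f x. \<alpha> *s A f x) = 1"
    and "det2_I_minus M (\<lambda>f x. \<alpha> *s K f x) =
       det (mat 1 - mat \<alpha> ** (LINT y|M. G2 y ** Fh y)) * exp (\<alpha> * (LINT y|M. trace (F2 y ** G2 y)))"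
    and "matrix (\<lambda>u. u - \<alpha> *s (LINT y|M. G2 y *v op_inverse M (op_I_minus \<alpha> A) (\<lambda>x. F2 x *v u) y))
       = mat 1 - mat \<alpha> ** (LINT y|M. G2 y ** Fh y)"
    and "op_trace M ((\<lambda>u x. F2 x *v u) \<circ> (\<lambda>f. LINT y|M. G2 y *v f y)) = (LINT y|M. trace (F2 y ** G2 y))"
proof -
  define c1 where "c1 = CARD('p)"
  define c2 where "c2 = CARD('r)"
  obtain \<beta>1 where \<beta>1: "bij_betw \<beta>1 {0..<c1} (UNIV :: 'p set)"
    using ex_bij_betw_nat_finite[of "UNIV :: 'p set"] by (auto simp: c1_def)
  obtain \<beta>2 where \<beta>2: "bij_betw \<beta>2 {0..<c2} (UNIV :: 'r set)"
    using ex_bij_betw_nat_finite[of "UNIV :: 'r set"] by (auto simp: c2_def)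
  define c where "c = c1 + c2"
  define \<kappa> where "\<kappa> = (\<lambda>x y. \<sigma> * y < \<sigma> * x)"
  have \<kappa>: "region \<kappa>" unfolding \<kappa>_def by (rule region_volterra)
  \<comment> \<open>The columns of \<open>F1\<close>, then the negated columns of \<open>F2\<close>:
    the minus sign of the kernel is absorbed into the left factors.\<close>
  define \<phi> where "\<phi> = (\<lambda>q x. if q < c1 then column (\<beta>1 q) (F1 x) else - 1 *s column (\<beta>2 (q - c1)) (F2 x))"
  define \<psi> where "\<psi> = (\<lambda>q y. if q < c1 then cnj_row (\<beta>1 q) (G1 y) else cnj_row (\<beta>2 (q - c1)) (G2 y))"
  define w where "w = (\<lambda>q x. column (\<beta>2 q) (F2 x))"
  define \<rho> where "\<rho> = (\<lambda>q y. cnj_row (\<beta>2 q) (G2 y))"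
  define v where "v = (\<lambda>q x. column (\<beta>2 q) (Fh x))"
  have \<phi>: "\<phi> q \<in> L2 M" for q
    unfolding \<phi>_def by (cases "q < c1") (auto intro!: L2_column L2_smult(1)[of _ M "-1", simplified] L2)
  have \<psi>: "\<psi> q \<in> L2 M" for q unfolding \<psi>_def by (cases "q < c1") (auto intro!: L2_cnj_row L2)
  have w: "w q \<in> L2 M" and \<rho>: "\<rho> q \<in> L2 M" and v: "v q \<in> L2 M" for q
    unfolding w_def \<rho>_def v_def by (intro L2_column L2_cnj_row L2)+
  have \<alpha>\<phi>: "(\<lambda>x. \<alpha> *s \<phi> q x) \<in> L2 M" for q by (rule L2_smult[OF \<phi>])
  have rank2: "(F2 x ** G2 y) *v u = (\<Sum>q<c2. cdot u (\<rho> q y) *s w q x)" for x y u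
  proof -
    have "(F2 x ** G2 y) *v u = (\<Sum>p\<in>UNIV. (G2 y *v u) $ p *s column p (F2 x))"
      by (simp only: matrix_vector_mul_assoc[symmetric] matrix_vector_mult_sum_columns[of "F2 x"])
    also have "\<dots> = (\<Sum>q\<in>{0..<c2}. (G2 y *v u) $ \<beta>2 q *s column (\<beta>2 q) (F2 x))"
      by (rule sum.reindex_bij_betw[OF \<beta>2, symmetric])
    finally show ?thesis by (simp add: cdot_cnj_row \<rho>_def w_def lessThan_atLeast0)
  qed
  have rank1: "(F1 x ** G1 y) *v u = (\<Sum>q<c1. cdot u (\<psi> q y) *s \<phi> q x)" for x y u
  proof -
    have "(F1 x ** G1 y) *v u = (\<Sum>p\<in>UNIV. (G1 y *v u) $ p *s column p (F1 x))"
      by (simp only: matrix_vector_mul_assoc[symmetric] matrix_vector_mult_sum_columns[of "F1 x"])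
    also have "\<dots> = (\<Sum>q\<in>{0..<c1}. (G1 y *v u) $ \<beta>1 q *s column (\<beta>1 q) (F1 x))"
      by (rule sum.reindex_bij_betw[OF \<beta>1, symmetric])
    finally show ?thesis by (simp add: cdot_cnj_row \<psi>_def \<phi>_def lessThan_atLeast0)
  qed
  have rankH: "(F1 x ** G1 y - F2 x ** G2 y) *v u = (\<Sum>q<c. cdot u (\<psi> q y) *s \<phi> q x)" for x y u
  proof -
    have "(\<Sum>q<c. cdot u (\<psi> q y) *s \<phi> q x) = (\<Sum>q<c1. cdot u (\<psi> q y) *s \<phi> q x) + (\<Sum>q<c2. cdot u (\<psi> (q + c1) y) *s \<phi> (q + c1) x)"
      unfolding c_def lessThan_atLeast0
      using sum.atLeastLessThan_concat[of 0 c1 "c1 + c2" "\<lambda>q. cdot u (\<psi> q y) *s \<phi> q x"]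
        sum.shift_bounds_nat_ivl[of "\<lambda>q. cdot u (\<psi> q y) *s \<phi> q x" 0 c1 c2] by (simp add: add.commute)
    also have "(\<Sum>q<c2. cdot u (\<psi> (q + c1) y) *s \<phi> (q + c1) x) = - (\<Sum>q<c2. cdot u (\<rho> q y) *s w q x)"
      by (simp add: \<psi>_def \<phi>_def \<rho>_def w_def sum_negf)
    finally show ?thesis by (simp add: matrix_vector_mult_diff_rdistrib rank1 rank2)
  qed
  \<comment> \<open>The scalar \<alpha> goes into the left factors as well, so the results on
    \<open>kop\<close> apply directly to \<alpha> A.\<close>
  have Akop: "\<alpha> *s A f x = kop M \<kappa> c (\<lambda>q x. \<alpha> *s \<phi> q x) \<psi> f x" if f: "f \<in> L2 M" and x: "x \<in> space M" for f x
  proof -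
    have "A f x = (\<Sum>q<c. (LINT y|M. (if \<kappa> x y then cdot (f y) (\<psi> q y) else 0)) *s \<phi> q x)"
      unfolding A[OF f x] rankH \<kappa>_def by (rule kop_integral(2)[OF f \<psi> \<kappa> x, unfolded \<kappa>_def])
    then show ?thesis by (simp add: kop_def vec_eq_iff sum_distrib_left mult_ac)
  qed
  note vk = kop_dominated[where c = c and \<phi> = "\<lambda>q x. \<alpha> *s \<phi> q x" and \<psi> = \<psi>, OF \<alpha>\<phi> \<psi> \<kappa>]
  have domA: "dominated_op M (\<lambda>f x. \<alpha> *s A f x) (kop_bound M \<kappa> c (\<lambda>q x. \<alpha> *s \<phi> q x) \<psi>)"
    by (rule dominated_op_cong[OF vk Akop])
  show "det2_I_minus M (\<lambda>f x. \<alpha> *s A f x) = 1"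
  proof -
    \<comment> \<open>With no finite rank part the small determinant has size zero and the exponent
      is an empty sum.\<close>
    have "det2_I_minus M (\<lambda>f x. \<alpha> *s A f x) =
        det_I_plus 0 (\<lambda>p q. - L2_inner M (v q) (\<rho> p)) * exp (\<Sum>q<(0::nat). L2_inner M (w q) (\<rho> q))"
      by (rule det2_volterra_plus_finite_rank[OF \<alpha>\<phi> \<psi> ex _ _ _ _ domA, where \<sigma> = \<sigma>])
         (simp_all add: Akop \<kappa>_def)
    then show ?thesis by (simp add: det_I_plus_def)
  qed

  have eqv: "AE x in M. v q x = w q x + \<alpha> *s A (v q) x" for q
    using Fh AE_space
  proof eventually_elim
    case (elim x)
    have "integrable M (\<lambda>y. column j (if \<sigma> * y < \<sigma> * x then (F1 x ** G1 y - F2 x ** G2 y) ** Fh y else 0))"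
      and "(LINT y|M. column j (if \<sigma> * y < \<sigma> * x then (F1 x ** G1 y - F2 x ** G2 y) ** Fh y else 0)) = A (\<lambda>y. column j (Fh y)) x" for j
    proof -
      have L: "(\<lambda>y. column j (Fh y)) \<in> L2 M" by (rule L2_column[OF L2(5)])
      have eq: "column j (if \<sigma> * y < \<sigma> * x then (F1 x ** G1 y - F2 x ** G2 y) ** Fh y else 0) =
          (if \<sigma> * y < \<sigma> * x then (F1 x ** G1 y - F2 x ** G2 y) *v column j (Fh y) else 0)" for y
        by (simp add: column_mult) (simp add: column_def vec_eq_iff)
      show "integrable M (\<lambda>y. column j (if \<sigma> * y < \<sigma> * x then (F1 x ** G1 y - F2 x ** G2 y) ** Fh y else 0))"
        unfolding eq rankH using kop_integral(1)[where \<psi> = \<psi> and c = c, OF L \<psi> \<kappa> elim(2)] unfolding \<kappa>_def .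
      show "(LINT y|M. column j (if \<sigma> * y < \<sigma> * x then (F1 x ** G1 y - F2 x ** G2 y) ** Fh y else 0)) = A (\<lambda>y. column j (Fh y)) x"
        unfolding eq A[OF L elim(2)] ..
    qed
    note I = this
    have "column j (Fh x) = column j (F2 x) + \<alpha> *s column j (LINT y|M. (if \<sigma> * y < \<sigma> * x then (F1 x ** G1 y - F2 x ** G2 y) ** Fh y else 0))" for j
      by (subst elim(1)) (simp add: vec_eq_iff column_def mat_mult_nth)
    then show ?case by (simp add: v_def w_def integral_matrix(2)[OF I(1)] I(2))
  qed
  \<comment> \<open>The finite rank part of \<alpha> K has left factors
    \<open>\<alpha> *s w q\<close>, so by linearity the solutions are scaled by \<alpha>
    too.\<close>
  have VW: "AE x in M. \<alpha> *s w q x = \<alpha> *s v q x - kop M \<kappa> c (\<lambda>q x. \<alpha> *s \<phi> q x) \<psi> (\<lambda>x. \<alpha> *s v q x) x" for q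
    using eqv[of q] AE_space
  proof eventually_elim
    case (elim x)
    have "kop M \<kappa> c (\<lambda>q x. \<alpha> *s \<phi> q x) \<psi> (\<lambda>x. \<alpha> *s v q x) x = \<alpha> *s (\<alpha> *s A (v q) x)"
      using dominated_opD(4)[OF vk v elim(2)] Akop[OF v elim(2)] by simp
    moreover have "\<alpha> *s v q x = \<alpha> *s w q x + \<alpha> *s (\<alpha> *s A (v q) x)"
      by (subst elim(1)) (simp only: vector_add_ldistrib)
    ultimately show ?case by simp
  qed
  \<comment> \<open>On the region, F1 G1 = (F1 G1 - F2 G2) + F2 G2. Thus F2 G2 extends over the
    whole square and becomes the finite rank part.\<close>
  have Kkop: "\<alpha> *s K f x = kop M \<kappa> c (\<lambda>q x. \<alpha> *s \<phi> q x) \<psi> f x + (\<Sum>q<c2. L2_inner M f (\<rho> q) *s (\<alpha> *s w q x))"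
    if f: "f \<in> L2 M" and x: "x \<in> space M" for f x
  proof -
    have R: "region (\<lambda>_ _. True)" unfolding region_def by simp
    have "(if \<sigma> * y < \<sigma> * x then F1 x ** G1 y else F2 x ** G2 y) *v f y =
        (if \<kappa> x y then (\<Sum>q<c. cdot (f y) (\<psi> q y) *s \<phi> q x) else 0) + (if True then (\<Sum>q<c2. cdot (f y) (\<rho> q y) *s w q x) else 0)" for y
      unfolding rankH[symmetric] rank2[symmetric] \<kappa>_def by (simp add: matrix_vector_mult_diff_rdistrib)
    then have "K f x = (\<Sum>q<c. (LINT y|M. (if \<kappa> x y then cdot (f y) (\<psi> q y) else 0)) *s \<phi> q x) +
       (\<Sum>q<c2. (LINT y|M. (if True then cdot (f y) (\<rho> q y) else 0)) *s w q x)"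
      unfolding K[OF f x]
      by (simp only: Bochner_Integration.integral_add[OF kop_integral(1)[where \<psi> = \<psi> and c = c, OF f \<psi> \<kappa> x] kop_integral(1)[where \<psi> = \<rho> and c = c2, OF f \<rho> R x]]
          kop_integral(2)[where \<psi> = \<psi> and c = c, OF f \<psi> \<kappa> x] kop_integral(2)[where \<psi> = \<rho> and c = c2, OF f \<rho> R x])
    then show ?thesis
      by (simp add: kop_def L2_inner_cdot vec_eq_iff sum_distrib_left distrib_left mult_ac)
  qed
  define \<Gamma> where "\<Gamma> = (LINT y|M. G2 y ** Fh y)"
  have intGF: "integrable M (\<lambda>y. column j (G2 y ** Fh y))" for j
  proof (rule integral_vec(1))
    fix i
    show "integrable M (\<lambda>y. column j (G2 y ** Fh y) $ i)"
      unfolding column_mult cdot_cnj_row[symmetric] by (intro integrable_cdot L2_column L2_cnj_row L2)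
  qed
  have \<Gamma>ij: "\<Gamma> $ \<beta>2 i $ \<beta>2 j = L2_inner M (v j) (\<rho> i)" for i j
    unfolding \<Gamma>_def integral_matrix(3)[OF intGF] matrix_mult_nth_eq_cdot L2_inner_cdot v_def \<rho>_def ..
  have tr: "(LINT y|M. trace (F2 y ** G2 y)) = (\<Sum>q<c2. L2_inner M (w q) (\<rho> q))"
  proof -
    have "trace (F2 y ** G2 y) = (\<Sum>q<c2. cdot (w q y) (\<rho> q y))" for y
    proof -
      have "trace (F2 y ** G2 y) = (\<Sum>i\<in>UNIV. \<Sum>p\<in>UNIV. F2 y $ i $ p * G2 y $ p $ i)"
        by (simp add: trace_def matrix_matrix_mult_def)
      also have "\<dots> = (\<Sum>p\<in>UNIV. \<Sum>i\<in>UNIV. F2 y $ i $ p * G2 y $ p $ i)" by (rule sum.swap)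
      also have "\<dots> = (\<Sum>q\<in>{0..<c2}. \<Sum>i\<in>UNIV. F2 y $ i $ \<beta>2 q * G2 y $ \<beta>2 q $ i)"
        by (rule sum.reindex_bij_betw[OF \<beta>2, symmetric])
      finally show ?thesis by (simp add: cdot_def w_def \<rho>_def cnj_row_def column_def lessThan_atLeast0)
    qed
    then show ?thesis
      unfolding L2_inner_cdot by (simp add: Bochner_Integration.integral_sum integrable_cdot w \<rho>)
  qed
  show "det2_I_minus M (\<lambda>f x. \<alpha> *s K f x) =
       det (mat 1 - mat \<alpha> ** (LINT y|M. G2 y ** Fh y)) * exp (\<alpha> * (LINT y|M. trace (F2 y ** G2 y)))"
  proof -
    have R: "region (\<lambda>_ _. True)" unfolding region_def by simp
    have \<alpha>w: "(\<lambda>x. \<alpha> *s w q x) \<in> L2 M" for q by (rule L2_smult[OF w])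
    have "dominated_op M (\<lambda>f x. \<alpha> *s K f x)
        (\<lambda>x. kop_bound M \<kappa> c (\<lambda>q x. \<alpha> *s \<phi> q x) \<psi> x + kop_bound M (\<lambda>_ _. True) c2 (\<lambda>q x. \<alpha> *s w q x) \<rho> x)"
      by (rule dominated_op_cong[OF dominated_op_add[OF vk kop_dominated[where c = c2 and \<phi> = "\<lambda>q x. \<alpha> *s w q x" and \<psi> = \<rho>, OF \<alpha>w \<rho> R]]])
         (simp add: Kkop kop_inner[of "\<lambda>_ _. True"])
    then have "det2_I_minus M (\<lambda>f x. \<alpha> *s K f x) =
        det_I_plus c2 (\<lambda>p q. - L2_inner M (\<lambda>x. \<alpha> *s v q x) (\<rho> p)) * exp (\<Sum>q<c2. L2_inner M (\<lambda>x. \<alpha> *s w q x) (\<rho> q))"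
      by (intro det2_volterra_plus_finite_rank[OF \<alpha>\<phi> \<psi> ex L2_smult(1)[OF v] \<alpha>w \<rho> VW[unfolded \<kappa>_def] _ Kkop[unfolded \<kappa>_def]])
    also have "det_I_plus c2 (\<lambda>p q. - L2_inner M (\<lambda>x. \<alpha> *s v q x) (\<rho> p)) = det (mat 1 - mat \<alpha> ** \<Gamma>)"
    proof -
      have mat1: "(mat 1 :: complex^'r^'r) $ i $ j = (if i = j then 1 else 0)" for i j by (simp add: mat_def)
      have "\<beta>2 i = \<beta>2 j \<longleftrightarrow> i = j" if "i < c2" "j < c2" for i j
        using \<beta>2 that by (auto simp: bij_betw_def inj_on_def)
      then have "sec c2 (\<lambda>i j. (mat 1 - mat \<alpha> ** \<Gamma>) $ \<beta>2 i $ \<beta>2 j) = sec c2 (\<lambda>p q. kron p q + - L2_inner M (\<lambda>x. \<alpha> *s v q x) (\<rho> p))"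
        by (intro sec_cong) (simp add: mat_mult_nth \<Gamma>ij L2_inner_smult_left kron_def mat1)
      then show ?thesis unfolding det_eq_det_sec[OF \<beta>2] det_I_plus_def by simp
    qed
    also have "(\<Sum>q<c2. L2_inner M (\<lambda>x. \<alpha> *s w q x) (\<rho> q)) = \<alpha> * (LINT y|M. trace (F2 y ** G2 y))"
      by (simp add: tr L2_inner_smult_left sum_distrib_left)
    finally show ?thesis by (simp add: \<Gamma>_def)
  qed

  show "matrix (\<lambda>u. u - \<alpha> *s (LINT y|M. G2 y *v op_inverse M (op_I_minus \<alpha> A) (\<lambda>x. F2 x *v u) y))
       = mat 1 - mat \<alpha> ** (LINT y|M. G2 y ** Fh y)"
  proof -
    have "(LINT y|M. G2 y *v op_inverse M (op_I_minus \<alpha> A) (\<lambda>x. F2 x *v u) y) = \<Gamma> *v u" for u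
    proof -
      \<comment> \<open>An explicit preimage of \<open>F2 x *v u\<close>. The one chosen by
        \<open>op_inverse\<close> differs from it by a fixed point of \<alpha> A, hence only on a
        null set.\<close>
      define z where "z = (\<lambda>x. Fh x *v u)"
      have zc: "z x = (\<Sum>q<c2. u $ \<beta>2 q *s v q x)" for x
        unfolding z_def v_def matrix_vector_mult_sum_columns[of "Fh x"] lessThan_atLeast0
        by (rule sum.reindex_bij_betw[OF \<beta>2, symmetric])
      have wc: "F2 x *v u = (\<Sum>q<c2. u $ \<beta>2 q *s w q x)" for x
        unfolding w_def matrix_vector_mult_sum_columns[of "F2 x"] lessThan_atLeast0
        by (rule sum.reindex_bij_betw[OF \<beta>2, symmetric])
      have z: "z \<in> L2 M" unfolding zc[abs_def] by (intro L2_sum L2_smult v)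
      have "AE x in M. \<forall>q\<in>{..<c2}. v q x = w q x + \<alpha> *s A (v q) x" using eqv by (intro AE_finite_allI) auto
      then have zA: "AE x in M. op_I_minus \<alpha> A z x = F2 x *v u"
        using AE_space
      proof eventually_elim
        case (elim x)
        have "\<alpha> *s A z x = (\<Sum>q<c2. u $ \<beta>2 q *s (\<alpha> *s A (v q) x))"
          unfolding zc[abs_def] by (rule dominated_op_sum[OF domA v elim(2) finite_lessThan])
        moreover have "z x = (\<Sum>q<c2. u $ \<beta>2 q *s w q x) + (\<Sum>q<c2. u $ \<beta>2 q *s (\<alpha> *s A (v q) x))"
          unfolding zc sum.distrib[symmetric] using elim(1) by (intro sum.cong refl) (metis vector_add_ldistrib)
        ultimately show ?case by (simp add: op_I_minus_def wc)
      qed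
      define i where "i = op_inverse M (op_I_minus \<alpha> A) (\<lambda>x. F2 x *v u)"
      have "\<exists>i. i \<in> L2 M \<and> (AE x in M. op_I_minus \<alpha> A i x = F2 x *v u)" using z zA by blast
      from someI_ex[OF this] have i: "i \<in> L2 M" and iA: "AE x in M. op_I_minus \<alpha> A i x = F2 x *v u"
        unfolding i_def op_inverse_def by auto
      have "AE x in M. i x - z x = 0"
      proof (rule volterra_injective[OF \<alpha>\<phi> \<psi> ex L2_diff(1)[OF i z]])
        show "AE x in M. i x - z x = kop M (\<lambda>x y. \<sigma> * y < \<sigma> * x) c (\<lambda>q x. \<alpha> *s \<phi> q x) \<psi> (\<lambda>x. i x - z x) x"
          using iA zA AE_space
        proof eventually_elim
          case (elim x)
          have "kop M \<kappa> c (\<lambda>q x. \<alpha> *s \<phi> q x) \<psi> (\<lambda>x. i x - z x) x = \<alpha> *s A i x - \<alpha> *s A z x"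
            using dominated_op_diff[OF vk i z elim(3)] by (simp add: Akop[OF i elim(3)] Akop[OF z elim(3)])
          also have "\<dots> = i x - z x" using elim(1,2) by (simp add: op_I_minus_def algebra_simps)
          finally show ?case by (simp add: \<kappa>_def)
        qed
      qed
      then have iz: "AE x in M. i x = z x" by (rule eventually_mono) simp
      have comp: "integrable M (\<lambda>y. (G2 y *v f y) $ p)" if "f \<in> L2 M" for f p
        unfolding cdot_cnj_row[symmetric] by (intro integrable_cdot that L2_cnj_row L2)
      show ?thesis
      proof (rule vec_eq_iff[THEN iffD2], rule allI)
        fix p
        have "(LINT y|M. G2 y *v i y) $ p = L2_inner M i (\<lambda>y. cnj_row p (G2 y))"
          unfolding L2_inner_cdot cdot_cnj_row by (rule integral_vec(2)[OF comp[OF i]])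
        also have "\<dots> = L2_inner M z (\<lambda>y. cnj_row p (G2 y))"
          by (intro L2_inner_cong_AE iz L2_measurable i z L2_cnj_row L2)
        also have "\<dots> = (\<Sum>q<c2. u $ \<beta>2 q * L2_inner M (v q) (\<lambda>y. cnj_row p (G2 y)))"
          unfolding zc[abs_def] using v L2_cnj_row[OF L2(4)]
          by (subst L2_inner_sum_left) (auto simp: L2_smult L2_inner_smult_left)
        also have "\<dots> = (\<Sum>q<c2. u $ \<beta>2 q * \<Gamma> $ p $ \<beta>2 q)"
          unfolding \<Gamma>_def integral_matrix(3)[OF intGF] matrix_mult_nth_eq_cdot L2_inner_cdot v_def ..
        also have "\<dots> = (\<Sum>r\<in>UNIV. u $ r * \<Gamma> $ p $ r)"
          unfolding lessThan_atLeast0 by (rule sum.reindex_bij_betw[OF \<beta>2])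
        finally show "(LINT y|M. G2 y *v op_inverse M (op_I_minus \<alpha> A) (\<lambda>x. F2 x *v u) y) $ p = (\<Gamma> *v u) $ p"
          by (simp add: i_def matrix_vector_mult_def mult.commute)
      qed
    qed
    moreover have "u - \<alpha> *s (\<Gamma> *v u) = (mat 1 - mat \<alpha> ** \<Gamma>) *v u" for u
      by (simp add: matrix_vector_mult_diff_rdistrib)
         (simp add: vec_eq_iff matrix_vector_mult_def mat_mult_nth sum_distrib_left mult_ac)
    ultimately show ?thesis by (simp add: \<Gamma>_def)
  qed

  show "op_trace M ((\<lambda>u x. F2 x *v u) \<circ> (\<lambda>f. LINT y|M. G2 y *v f y)) = (LINT y|M. trace (F2 y ** G2 y))"
  proof -
    let ?QR = "(\<lambda>u x. F2 x *v u) \<circ> (\<lambda>f. LINT y|M. G2 y *v f y)"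
    \<comment> \<open>In any basis the diagonal sum splits into Parseval's identity for each pair
      \<open>w q\<close>, \<open>\<rho> q\<close>.\<close>
    have S: "(\<lambda>i. L2_inner M (?QR (e i)) (e i)) sums (LINT y|M. trace (F2 y ** G2 y))"
      if e: "orthonormal_basis M e" for e :: "nat \<Rightarrow> real \<Rightarrow> complex^'m"
    proof -
      note eL2 = orthonormal_basis_L2[OF e]
      have QRf: "?QR (e i) x = (\<Sum>q<c2. L2_inner M (e i) (\<rho> q) *s w q x)" for i x
      proof -
        have "(LINT y|M. G2 y *v e i y) $ p = L2_inner M (e i) (\<lambda>y. cnj_row p (G2 y))" for p
          unfolding L2_inner_cdot cdot_cnj_row
          by (rule integral_vec(2), unfold cdot_cnj_row[symmetric]) (intro integrable_cdot eL2 L2_cnj_row L2)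
        then have "?QR (e i) x = (\<Sum>p\<in>UNIV. L2_inner M (e i) (\<lambda>y. cnj_row p (G2 y)) *s column p (F2 x))"
          by (simp add: matrix_vector_mult_sum_columns[of "F2 x"])
        also have "\<dots> = (\<Sum>q\<in>{0..<c2}. L2_inner M (e i) (\<lambda>y. cnj_row (\<beta>2 q) (G2 y)) *s column (\<beta>2 q) (F2 x))"
          by (rule sum.reindex_bij_betw[OF \<beta>2, symmetric])
        finally show ?thesis by (simp add: \<rho>_def w_def lessThan_atLeast0)
      qed
      have "L2_inner M (?QR (e i)) (e i) = (\<Sum>q<c2. L2_inner M (w q) (e i) * L2_inner M (e i) (\<rho> q))" for i
        unfolding QRf[abs_def] using w eL2
        by (subst L2_inner_sum_left) (auto simp: L2_smult L2_inner_smult_left mult.commute)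
      then show ?thesis
        unfolding tr by (simp only:) (intro sums_sum parseval_sums[OF sigma_finite_measure_axioms e w \<rho>])
    qed
    obtain e0 :: "nat \<Rightarrow> real \<Rightarrow> complex^'m" where e0: "orthonormal_basis M e0" using ex by blast
    show ?thesis
      unfolding op_trace_def
    proof (rule the_equality)
      fix t assume "\<forall>e. orthonormal_basis M e \<longrightarrow> (\<lambda>i. L2_inner M (?QR (e i)) (e i)) sums t"
      then show "t = (LINT y|M. trace (F2 y ** G2 y))" using S[OF e0] e0 sums_unique2 by blast
    qed (use S in blast)
  qed
qed

end

section \<open>Lebesgue measure on an open interval and the final assembly\<close>

lemma sigma_finite_lebesgue: "sigma_finite_measure (lebesgue :: real measure)"
proof -
  obtain C :: "real set set" where C: "countable C" "C \<subseteq> sets lborel" "\<Union>C = space lborel" "\<forall>a\<in>C. emeasure lborel a \<noteq> \<infinity>"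
    using lborel.sigma_finite_countable by blast
  show ?thesis
    by (rule sigma_finite_measure.intro, rule exI[of _ C]) (use C in auto)
qed

lemma line_measure_lebesgue_on:
  assumes "S \<in> sets lebesgue"
  shows "line_measure (lebesgue_on S)"
proof -
  interpret sigma_finite_measure "lebesgue_on S"
    by (rule sigma_finite_measure_restrict_space[OF sigma_finite_lebesgue assms])
  have "(\<lambda>x. x) \<in> borel_measurable (lebesgue :: real measure)" by (rule measurable_completion) simp
  then show ?thesis by unfold_locales (rule measurable_restrict_space1)
qed

lemma measurable_matrix_vector_mult:
  fixes G :: "real \<Rightarrow> complex^'m^'p"
  assumes "G \<in> borel_measurable M" "f \<in> borel_measurable M"
  shows "(\<lambda>y. G y *v f y) \<in> borel_measurable M"
proof (rule measurable_vec)
  show "(\<lambda>y. (G y *v f y) $ i) \<in> borel_measurable M" for i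
    unfolding matrix_vector_mult_def vec_lambda_beta
    by (intro borel_measurable_sum borel_measurable_times measurable_vec_nth assms)
qed

lemma einterval_integral_below:
  fixes F :: "real \<Rightarrow> 'b::{banach, second_countable_topology}"
  assumes "x \<in> einterval a b"
  shows "(LINT y:einterval a (ereal x)|lebesgue. F y) = (LINT y|lebesgue_on (einterval a b). (if y < x then F y else 0))"
proof -
  have "indicator (einterval a (ereal x)) y *\<^sub>R F y = indicator (einterval a b) y *\<^sub>R (if y < x then F y else 0)" for y
    using assms by (auto simp: einterval_def indicator_def) (meson ereal_less_eq(3) le_less_trans less_imp_le less_le_trans)+
  then show ?thesis
    by (subst integral_restrict_space) (auto simp: set_lebesgue_integral_def)
qed

lemma einterval_integral_above:
  fixes F :: "real \<Rightarrow> 'b::{banach, second_countable_topology}"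
  assumes "x \<in> einterval a b"
  shows "(LINT y:einterval (ereal x) b|lebesgue. F y) = (LINT y|lebesgue_on (einterval a b). (if x < y then F y else 0))"
proof -
  have "indicator (einterval (ereal x) b) y *\<^sub>R F y = indicator (einterval a b) y *\<^sub>R (if x < y then F y else 0)" for y
    using assms by (auto simp: einterval_def indicator_def) (meson ereal_less_eq(3) le_less_trans less_imp_le less_le_trans)+
  then show ?thesis
    by (subst integral_restrict_space) (auto simp: set_lebesgue_integral_def)
qed

lemma einterval_integral_full:
  fixes F :: "real \<Rightarrow> 'b::{banach, second_countable_topology}"
  shows "(LINT y:einterval a b|lebesgue. F y) = (LINT y|lebesgue_on (einterval a b). F y)"
  by (subst integral_restrict_space) (auto simp: set_lebesgue_integral_def)

text \<open>The kernel is prescribed only off the diagonal. Its row at \<open>x\<close> is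
  nevertheless measurable on applying it to \<open>f\<close>, since it agrees with a measurable
  function away from the single point \<open>x\<close>, and that point is null.\<close>

lemma kernel_integral_off_diagonal:
  fixes k :: "real \<Rightarrow> complex^'m::finite^'m" and F1 :: "complex^'p::finite^'m" and F2 :: "complex^'r::finite^'m"
  assumes meas: "G1 \<in> borel_measurable M" "G2 \<in> borel_measurable M" "f \<in> borel_measurable M"
    and id: "(\<lambda>y. y) \<in> borel_measurable M" and x: "AE y in M. y \<noteq> x"
    and P: "Measurable.pred M P"
    and k: "\<And>y. y \<in> space M \<Longrightarrow> y \<noteq> x \<Longrightarrow> k y = (if P y then F1 ** G1 y else F2 ** G2 y)"
  shows "(LINT y|M. k y *v f y) = (LINT y|M. (if P y then F1 ** G1 y else F2 ** G2 y) *v f y)"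
proof -
  let ?g = "\<lambda>y. (if P y then F1 ** G1 y else F2 ** G2 y) *v f y"
  have "?g = (\<lambda>y. if P y then F1 *v (G1 y *v f y) else F2 *v (G2 y *v f y))"
    by (auto simp: matrix_vector_mul_assoc)
  moreover have "(\<lambda>y. if P y then F1 *v (G1 y *v f y) else F2 *v (G2 y *v f y)) \<in> borel_measurable M"
    using P by (intro measurable_If measurable_matrix_vector_mult meas borel_measurable_const) auto
  ultimately have g: "?g \<in> borel_measurable M" by simp
  have "Measurable.pred M (\<lambda>y. y = x)" using id by measurable
  then have "{y \<in> space M. y = x} \<in> sets M" by (simp only: pred_def)
  then have "(\<lambda>y. if y = x then k x *v f x else ?g y) \<in> borel_measurable M"
    using g by (intro measurable_If borel_measurable_const)
  also have "(\<lambda>y. if y = x then k x *v f x else ?g y) \<in> borel_measurable M \<longleftrightarrow> (\<lambda>y. k y *v f y) \<in> borel_measurable M"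
    by (rule measurable_cong) (auto simp: k)
  finally have "(\<lambda>y. k y *v f y) \<in> borel_measurable M" .
  moreover have "AE y in M. k y *v f y = ?g y"
    using x AE_space by eventually_elim (simp add: k)
  ultimately show ?thesis using g by (intro integral_cong_AE)
qed

theorem theorem3p3:
  fixes a b :: ereal and \<alpha> :: complex
    and f1 :: "real \<Rightarrow> complex^'n1^'m" and f2 :: "real \<Rightarrow> complex^'n2^'m"
    and g1 :: "real \<Rightarrow> complex^'m^'n1" and g2 :: "real \<Rightarrow> complex^'m^'n2"
    and M :: "real measure"
    and H Kker :: "real \<Rightarrow> real \<Rightarrow> complex^'m^'m"
    and K Ha Hb :: "'m operator"
    and Q :: "complex^'n2 \<Rightarrow> real \<Rightarrow> complex^'m" and R :: "(real \<Rightarrow> complex^'m) \<Rightarrow> complex^'n2"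
    and S :: "complex^'n1 \<Rightarrow> real \<Rightarrow> complex^'m" and T :: "(real \<Rightarrow> complex^'m) \<Rightarrow> complex^'n1"
    and fh1 :: "real \<Rightarrow> complex^'n1^'m" and fh2 :: "real \<Rightarrow> complex^'n2^'m"
    and U :: "ereal \<Rightarrow> complex^('n1+'n2)^('n1+'n2)"
  assumes ab: "a < b"
    and M: "M = lebesgue_on (einterval a b)"
    and L2: "f1 \<in> L2 M" "f2 \<in> L2 M" "g1 \<in> L2 M" "g2 \<in> L2 M"
    and Kker: "\<And>x x'. x \<in> einterval a b \<Longrightarrow> x' \<in> einterval a b \<Longrightarrow> x' < x \<Longrightarrow>
                 Kker x x' = f1 x ** g1 x'"
              "\<And>x x'. x \<in> einterval a b \<Longrightarrow> x' \<in> einterval a b \<Longrightarrow> x < x' \<Longrightarrow>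
                 Kker x x' = f2 x ** g2 x'"
    and K: "K = (\<lambda>f x. LINT x':einterval a b|lebesgue. Kker x x' *v f x')"
    and H: "H = (\<lambda>x x'. f1 x ** g1 x' - f2 x ** g2 x')"
    and Ha: "Ha = (\<lambda>f x. LINT x':einterval a x|lebesgue. H x x' *v f x')"
    and Hb: "Hb = (\<lambda>f x. - (LINT x':einterval x b|lebesgue. H x x' *v f x'))"
    and Q: "Q = (\<lambda>u x. f2 x *v u)"
    and R: "R = (\<lambda>f. LINT x':einterval a b|lebesgue. g2 x' *v f x')"
    and S: "S = (\<lambda>v x. f1 x *v v)"
    and T: "T = (\<lambda>f. LINT x':einterval a b|lebesgue. g1 x' *v f x')"
    and fh_L2: "fh1 \<in> L2 M" "fh2 \<in> L2 M"
    and fh1: "AE x in M. fh1 x =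
                f1 x - mat \<alpha> ** (LINT x':einterval x b|lebesgue. H x x' ** fh1 x')"
    and fh2: "AE x in M. fh2 x =
                f2 x + mat \<alpha> ** (LINT x':einterval a x|lebesgue. H x x' ** fh2 x')"
    and U: "U = (\<lambda>x. block_matrix
                (mat 1 - mat \<alpha> ** (LINT x':einterval x b|lebesgue. g1 x' ** fh1 x'))
                (mat \<alpha> ** (LINT x':einterval a x|lebesgue. g1 x' ** fh2 x'))
                (mat \<alpha> ** (LINT x':einterval x b|lebesgue. g2 x' ** fh1 x'))
                (mat 1 - mat \<alpha> ** (LINT x':einterval a x|lebesgue. g2 x' ** fh2 x')))"
  shows "det2_I_minus M (\<lambda>f x. \<alpha> *s Ha f x) = 1 \<and>
         det2_I_minus M (\<lambda>f x. \<alpha> *s Hb f x) = 1 \<and>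
         det2_I_minus M (\<lambda>f x. \<alpha> *s K f x) =
           det (matrix (\<lambda>v. v - \<alpha> *s T (op_inverse M (op_I_minus \<alpha> Hb) (S v)))) *
           exp (\<alpha> * op_trace M (S \<circ> T)) \<and>
         det2_I_minus M (\<lambda>f x. \<alpha> *s K f x) =
           det (mat 1 - mat \<alpha> ** (LINT x:einterval a b|lebesgue. g1 x ** fh1 x)) *
           exp (\<alpha> * (LINT x:einterval a b|lebesgue. trace (f1 x ** g1 x))) \<and>
         det2_I_minus M (\<lambda>f x. \<alpha> *s K f x) =
           det (U a) * exp (\<alpha> * (LINT x:einterval a b|lebesgue. trace (f1 x ** g1 x))) \<and>
         det2_I_minus M (\<lambda>f x. \<alpha> *s K f x) =
           det (matrix (\<lambda>u. u - \<alpha> *s R (op_inverse M (op_I_minus \<alpha> Ha) (Q u)))) *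
           exp (\<alpha> * op_trace M (Q \<circ> R)) \<and>
         det2_I_minus M (\<lambda>f x. \<alpha> *s K f x) =
           det (mat 1 - mat \<alpha> ** (LINT x:einterval a b|lebesgue. g2 x ** fh2 x)) *
           exp (\<alpha> * (LINT x:einterval a b|lebesgue. trace (f2 x ** g2 x))) \<and>
         det2_I_minus M (\<lambda>f x. \<alpha> *s K f x) =
           det (U b) * exp (\<alpha> * (LINT x:einterval a b|lebesgue. trace (f2 x ** g2 x)))"
proof -
  have E: "einterval a b \<in> sets lebesgue" by (simp add: borel_einterval sets_completionI_sets)
  have spM: "space M = einterval a b" by (simp add: M)
  interpret line_measure M unfolding M by (rule line_measure_lebesgue_on[OF E])
  \<comment> \<open>A compact subinterval of positive length, to carry orthonormal families of any
    size.\<close>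
  obtain c0 where "c0 \<in> einterval a b" using einterval_nonempty[OF ab] by blast
  then obtain r where r: "r > 0" "cball c0 r \<subseteq> einterval a b"
    using open_einterval open_contains_cball by blast
  then have cd: "c0 - r < c0 + r" "{c0 - r..c0 + r} \<subseteq> einterval a b" by (auto simp: cball_eq_atLeastAtMost)
  have ex: "\<exists>e :: nat \<Rightarrow> real \<Rightarrow> complex^'m. orthonormal_basis M e"
    unfolding M using orthonormal_basis_exists[OF E cd] by blast
  note below = einterval_integral_below[of _ a b, folded M]
  note above = einterval_integral_above[of _ a b, folded M]
  note full = einterval_integral_full[of a b, folded M]
  have point: "AE y in M. y \<noteq> x" for x
  proof -
    have "{x} \<in> null_sets lebesgue" by (simp add: negligible_iff_null_sets[symmetric])
    from AE_not_in[OF this] have "AE y in lebesgue. y \<noteq> x" by simp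
    then show ?thesis unfolding M using E by (subst AE_restrict_space_iff) (auto elim!: eventually_mono)
  qed
  have pred1: "Measurable.pred M (\<lambda>y. y < x)" and pred2: "Measurable.pred M (\<lambda>y. x < y)" for x
    using id_measurable by measurable
  note meas = L2_measurable[OF L2(3)] L2_measurable[OF L2(4)]

  have Ha': "Ha f x = (LINT y|M. (if 1 * y < 1 * x then (f1 x ** g1 y - f2 x ** g2 y) *v f y else 0))"
    if "x \<in> space M" for f x
    using that unfolding spM by (simp add: Ha H below)
  have K1: "K f x = (LINT y|M. (if 1 * y < 1 * x then f1 x ** g1 y else f2 x ** g2 y) *v f y)"
    if f: "f \<in> L2 M" and x: "x \<in> space M" for f x
    unfolding K full mult_1
    using x by (intro kernel_integral_off_diagonal[OF meas L2_measurable[OF f] id_measurable point[of x] pred1])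
      (auto simp: spM Kker)
  have fh2': "AE x in M. fh2 x = f2 x + mat \<alpha> **
      (LINT y|M. (if 1 * y < 1 * x then (f1 x ** g1 y - f2 x ** g2 y) ** fh2 y else 0))"
    using fh2 AE_space
  proof eventually_elim
    case (elim x)
    then show ?case unfolding spM by (simp add: below H)
  qed
  note one = semiseparable_det2[OF ex L2(1,3,2,4) fh_L2(2) Ha' K1 fh2']

  \<comment> \<open>The minus sign in the definition of \<open>Hb\<close> exchanges the two products
    in \<open>H\<close>; this is the kernel that the reversed orientation requires.\<close>
  have Hb': "Hb f x = (LINT y|M. (if -1 * y < -1 * x then (f2 x ** g2 y - f1 x ** g1 y) *v f y else 0))"
    if "x \<in> space M" for f x
  proof -
    have "Hb f x = - (LINT y|M. (if x < y then H x y *v f y else 0))"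
      using that unfolding spM by (simp add: Hb above)
    also have "\<dots> = (LINT y|M. - (if x < y then H x y *v f y else 0))" by simp
    also have "\<dots> = (LINT y|M. (if -1 * y < -1 * x then (f2 x ** g2 y - f1 x ** g1 y) *v f y else 0))"
      by (intro Bochner_Integration.integral_cong refl) (simp add: H matrix_vector_mult_diff_rdistrib)
    finally show ?thesis .
  qed
  have K2: "K f x = (LINT y|M. (if -1 * y < -1 * x then f2 x ** g2 y else f1 x ** g1 y) *v f y)"
    if f: "f \<in> L2 M" and x: "x \<in> space M" for f x
  proof -
    have "(LINT y|M. Kker x y *v f y) = (LINT y|M. (if x < y then f2 x ** g2 y else f1 x ** g1 y) *v f y)"
      using x by (intro kernel_integral_off_diagonal[OF meas(2,1) L2_measurable[OF f] id_measurable point[of x] pred2])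
        (auto simp: spM Kker)
    then show ?thesis unfolding K full by simp
  qed
  have fh1': "AE x in M. fh1 x = f1 x + mat \<alpha> **
      (LINT y|M. (if -1 * y < -1 * x then (f2 x ** g2 y - f1 x ** g1 y) ** fh1 y else 0))"
    using fh1 AE_space
  proof eventually_elim
    case (elim x)
    have neg: "- ((A - B) ** C) = (B - A) ** C" for A B :: "complex^'m^'m" and C :: "complex^'n1^'m"
      by (simp add: vec_eq_iff matrix_matrix_mult_def algebra_simps sum_subtractf)
    have "(LINT y|M. (if -1 * y < -1 * x then (f2 x ** g2 y - f1 x ** g1 y) ** fh1 y else 0))
        = (LINT y|M. - (if x < y then H x y ** fh1 y else 0))"
      by (intro Bochner_Integration.integral_cong refl) (simp add: H neg)
    also have "\<dots> = - (LINT y:einterval x b|lebesgue. H x y ** fh1 y)"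
      using elim(2) unfolding spM by (simp add: above)
    finally have e: "(LINT y|M. (if -1 * y < -1 * x then (f2 x ** g2 y - f1 x ** g1 y) ** fh1 y else 0))
        = - (LINT y:einterval x b|lebesgue. H x y ** fh1 y)" .
    have "mat \<alpha> ** (- X) = - (mat \<alpha> ** X)" for X :: "complex^'n1^'m"
      by (simp add: vec_eq_iff mat_mult_nth)
    then show ?case unfolding e using elim(1) by simp
  qed
  \<comment> \<open>Orientation reversed and indices 1 and 2 exchanged; the solution is now
    \<open>fh1\<close>.\<close>
  note two = semiseparable_det2[OF ex L2(2,4,1,3) fh_L2(1) Hb' K2 fh1']

  have mat0': "mat \<alpha> ** (0 :: complex^'n2^'n1) = 0" "mat \<alpha> ** (0 :: complex^'n1^'n2) = 0"
    "mat \<alpha> ** (0 :: complex^'n1^'n1) = 0" "mat \<alpha> ** (0 :: complex^'n2^'n2) = 0"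
    by (simp_all add: vec_eq_iff mat_mult_nth)
  \<comment> \<open>At \<open>a\<close> the integrals over the empty interval vanish: the upper
    right block is zero and the lower right block is the identity.\<close>
  have Ua: "det (U a) = det (mat 1 - mat \<alpha> ** (LINT y|M. g1 y ** fh1 y))"
    unfolding U full by (subst det_block_matrix) (simp_all add: einterval_same set_lebesgue_integral_def mat0')
  \<comment> \<open>At \<open>b\<close> it is the lower left block that vanishes, and the upper left
    block is the identity.\<close>
  have Ub: "det (U b) = det (mat 1 - mat \<alpha> ** (LINT y|M. g2 y ** fh2 y))"
    unfolding U full by (subst det_block_matrix) (simp_all add: einterval_same set_lebesgue_integral_def mat0')
  have inv1: "matrix (\<lambda>u. u - \<alpha> *s (LINT y|M. g2 y *v op_inverse M (op_I_minus \<alpha> Ha) (\<lambda>x. f2 x *v u) y))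
      = mat 1 - mat \<alpha> ** (LINT y|M. g2 y ** fh2 y)"
    by (rule one(3))
  have inv2: "matrix (\<lambda>u. u - \<alpha> *s (LINT y|M. g1 y *v op_inverse M (op_I_minus \<alpha> Hb) (\<lambda>x. f1 x *v u) y))
      = mat 1 - mat \<alpha> ** (LINT y|M. g1 y ** fh1 y)"
    by (rule two(3))
  have tr1: "op_trace M ((\<lambda>u x. f2 x *v u) \<circ> (\<lambda>f. LINT y|M. g2 y *v f y)) = (LINT y|M. trace (f2 y ** g2 y))"
    by (rule one(4))
  have tr2: "op_trace M ((\<lambda>u x. f1 x *v u) \<circ> (\<lambda>f. LINT y|M. g1 y *v f y)) = (LINT y|M. trace (f1 y ** g1 y))"
    by (rule two(4))
  show ?thesis
    unfolding Ua Ub full Q R S T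
    unfolding inv1 inv2 tr1 tr2
    by (intro conjI one(1,2) two(1,2))
qed

end
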